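(* Let $0<p,q\le\infty$ and suppose that $p<\infty$ or $1\le q$. Assume $r:=\min(p,q)<1$, $r<u\le\infty$, $t>0$, and $s\in\mathbb{R}$. Then there exists $m\in L^\infty(\mathbb{R}^d)$ such that $\mathcal{K}_u^{s,t}[m]<\infty$, but $T_m$ is not bounded on $\dot F_p^{0,q}$, if one of the following conditions holds: (1) $s<d/r-d/u$; (2) $s=d/r-d/u$ and $t>r$.
   Context: Convention: $1/\infty=0$. Fourier transform: $\widehat f(\xi)=\int_{\mathbb{R}^d} f(x)e^{-2\pi i\langle x,\xi\rangle}dx$; $f^\vee$ is the inverse Fourier transform. Cutoff: $\varphi$ is a fixed smooth function on $\mathbb{R}^d$ with $0\le\varphi\le1$, $\varphi=1$ on $\{1/2\le|\xi|\le2\}$, $\mathrm{supp}\,\varphi\subset\{1/4\le|\xi|\le4\}$. Herz spaces: let $B_0=\{x:|x|\le2\}$ and $B_k=\{x\in\mathbb{R}^d:2^k<|x|\le2^{k+1}\}$ for $k\ge1$. For $0<u\le\infty$, $t>0$ ($t=\infty$ allowed), $s\in\mathbb{R}$, $\|f\|_{K_u^{s,t}}:=\big(\sum_{k=0}^\infty 2^{skt}\|f\|_{L^u(B_k)}^t\big)^{1/t}$ (supremum if $t=\infty$). Put $\mathcal{K}_u^{s,t}[m]:=\sup_{k\in\mathbb{Z}}\big\|(m(2^k\cdot)\varphi)^\vee\big\|_{K_u^{s,t}}$. Littlewood–Paley pieces: $\phi$ is a fixed smooth function with $\widehat\phi$ supported in $\{1/2\le|\xi|\le2\}$ and $\sum_{k\in\mathbb{Z}}\widehat{\phi_k}(\xi)=1$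 for $\xi\ne0$, where $\phi_k=2^{kd}\phi(2^k\cdot)$; $\Pi_kf:=\phi_k*f$. Triebel–Lizorkin space: $\dot F_p^{0,q}$ is the space of $f\in S'/\mathcal{P}$ (tempered distributions modulo polynomials) with finite (quasi-)norm $\|f\|_{\dot F_p^{0,q}}:=\big\|\big(\sum_{k\in\mathbb{Z}}|\Pi_kf|^q\big)^{1/q}\big\|_{L^p}$ if $p<\infty$ or $p=q=\infty$ (supremum over $k$ if $q=\infty$), and $\|f\|_{\dot F_\infty^{0,q}}:=\sup_{P}\big(\frac1{|P|}\int_P\sum_{k=-\log_2 l(P)}^\infty|\Pi_kf(x)|^q\,dx\big)^{1/q}$ if $p=\infty$, $q<\infty$, the supremum being over all dyadic cubes $P\subset\mathbb{R}^d$ with side length $l(P)$. Multiplier operator: $T_mf=(m\widehat f)^\vee$ for $f\in S_\infty$, the space of Schwartz functions all of whose moments vanish. "$T_m$ is not bounded on $\dot F_p^{0,q}$" means that there is no constant $C<\infty$ with $\|T_mf\|_{\dot F_p^{0,q}}\le C\|f\|_{\dot F_p^{0,q}}$ for all $f\in S_\infty$ (the left side being $\infty$ if $T_mf\notin\dot F_p^{0,q}$). *)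

theory Defs
  imports "HOL-Analysis.Analysis" "HOL-Probability.Essential_Supremum"
begin

section \<open>Quasi-norms with exponents in $(0,\infty]$\<close>

text \<open>
  Exponents are extended nonnegative reals.  Since \<open>1 / \<infinity> = 0\<close> in type \<^typ>\<open>ennreal\<close>,
  the term \<open>enn2real (1 / p)\<close> is the real number $1/p$ under the convention $1/\infty = 0$.
\<close>

text \<open>Only used for a positive real exponent.\<close>

definition epowr :: "ennreal \<Rightarrow> real \<Rightarrow> ennreal" where
  "epowr x a = (if x = \<infinity> then \<infinity> else ennreal (enn2real x powr a))"

definition lq_norm :: "ennreal \<Rightarrow> 'i set \<Rightarrow> ('i \<Rightarrow> ennreal) \<Rightarrow> ennreal" where
  "lq_norm q I a =
     (if q = \<infinity> then (SUP i\<in>I. a i)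
      else epowr (\<Sum>\<^sub>\<infinity>i\<in>I. epowr (a i) (enn2real q)) (enn2real (1 / q)))"

definition Lp_norm :: "ennreal \<Rightarrow> 'a measure \<Rightarrow> ('a \<Rightarrow> ennreal) \<Rightarrow> ennreal" where
  "Lp_norm p M g =
     (if p = \<infinity> then esssup M g
      else epowr (\<integral>\<^sup>+x. epowr (g x) (enn2real p) \<partial>M) (enn2real (1 / p)))"

definition L_infinity :: "('a::euclidean_space \<Rightarrow> complex) set" where
  "L_infinity = {m. m \<in> borel_measurable lborel \<and> (\<exists>C::real. AE x in lborel. norm (m x) \<le> C)}"


section \<open>Smooth functions, Schwartz functions, tempered distributions\<close>

text \<open>
  \<open>iter_partial [b\<^sub>1, \<dots>, b\<^sub>n] f\<close> is $\partial_{b_1} \cdots \partial_{b_n} f$ for basis vectors \<open>b\<^sub>i\<close>.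
\<close>

fun iter_partial :: "'a list \<Rightarrow> ('a::euclidean_space \<Rightarrow> 'b::real_normed_vector) \<Rightarrow> 'a \<Rightarrow> 'b" where
  "iter_partial [] f = f"
| "iter_partial (b # bs) f = (\<lambda>x. frechet_derivative (iter_partial bs f) (at x) b)"

definition smooth :: "('a::euclidean_space \<Rightarrow> 'b::real_normed_vector) \<Rightarrow> bool" where
  "smooth f \<longleftrightarrow> (\<forall>bs. set bs \<subseteq> Basis \<longrightarrow> iter_partial bs f differentiable_on UNIV)"

definition Schwartz :: "('a::euclidean_space \<Rightarrow> complex) set" where
  "Schwartz = {f. smooth f \<and>
     (\<forall>bs N. set bs \<subseteq> Basis \<longrightarrow>
        (\<exists>C. \<forall>x. (1 + norm x) ^ N * norm (iter_partial bs f x) \<le> C))}"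

definition Schwartz_seminorm :: "nat \<Rightarrow> ('a::euclidean_space \<Rightarrow> complex) \<Rightarrow> real" where
  "Schwartz_seminorm N f =
     (SUP (bs, x)\<in>{bs. set bs \<subseteq> Basis \<and> length bs \<le> N} \<times> UNIV.
        (1 + norm x) ^ N * norm (iter_partial bs f x))"

text \<open>The space $S_\infty$: all moments vanish.\<close>

definition S_infinity :: "('a::euclidean_space \<Rightarrow> complex) set" where
  "S_infinity = {f \<in> Schwartz. \<forall>\<alpha> :: 'a \<Rightarrow> nat.
     (LINT x|lborel. complex_of_real (\<Prod>b\<in>Basis. (x \<bullet> b) ^ \<alpha> b) * f x) = 0}"

text \<open>
  A tempered distribution is a functional of which only the values on Schwartz functions matter.
\<close>

definition tempered_distribution :: "(('a::euclidean_space \<Rightarrow> complex) \<Rightarrow> complex) \<Rightarrow> bool" where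
  "tempered_distribution \<Lambda> \<longleftrightarrow>
     (\<forall>f\<in>Schwartz. \<forall>g\<in>Schwartz. \<Lambda> (\<lambda>x. f x + g x) = \<Lambda> f + \<Lambda> g) \<and>
     (\<forall>c. \<forall>f\<in>Schwartz. \<Lambda> (\<lambda>x. c * f x) = c * \<Lambda> f) \<and>
     (\<exists>C N. \<forall>f\<in>Schwartz. norm (\<Lambda> f) \<le> C * Schwartz_seminorm N f)"

definition distribution_of ::
    "('a::euclidean_space \<Rightarrow> complex) \<Rightarrow> ('a \<Rightarrow> complex) \<Rightarrow> complex" where
  "distribution_of f = (\<lambda>g. LINT x|lborel. f x * g x)"

text \<open>$\phi * \Lambda$, for \<open>\<phi>\<close> Schwartz and \<open>\<Lambda>\<close> a tempered distribution.\<close>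

definition convolve_dist ::
    "('a::euclidean_space \<Rightarrow> complex) \<Rightarrow> (('a \<Rightarrow> complex) \<Rightarrow> complex) \<Rightarrow> 'a \<Rightarrow> complex" where
  "convolve_dist \<phi> \<Lambda> x = \<Lambda> (\<lambda>y. \<phi> (x - y))"


section \<open>Fourier transform and multiplier operators\<close>

definition fourier :: "('a::euclidean_space \<Rightarrow> complex) \<Rightarrow> 'a \<Rightarrow> complex" where
  "fourier f \<xi> = (LINT x|lborel. f x * exp (- 2 * complex_of_real pi * \<i> * complex_of_real (x \<bullet> \<xi>)))"

definition inv_fourier :: "('a::euclidean_space \<Rightarrow> complex) \<Rightarrow> 'a \<Rightarrow> complex" where
  "inv_fourier g x = (LINT \<xi>|lborel. g \<xi> * exp (2 * complex_of_real pi * \<i> * complex_of_real (x \<bullet> \<xi>)))"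

text \<open>
  For bounded \<open>m\<close> and Schwartz \<open>f\<close> the product of \<open>m\<close> and \<open>fourier f\<close> is integrable, hence
  the inverse Fourier transform is given by the integral.
\<close>

definition multiplier_op ::
    "('a::euclidean_space \<Rightarrow> complex) \<Rightarrow> ('a \<Rightarrow> complex) \<Rightarrow> 'a \<Rightarrow> complex" where
  "multiplier_op m f = inv_fourier (\<lambda>\<xi>. m \<xi> * fourier f \<xi>)"


section \<open>Herz spaces\<close>

definition cutoff :: "('a::euclidean_space \<Rightarrow> real) \<Rightarrow> bool" where
  "cutoff \<eta> \<longleftrightarrow> smooth \<eta> \<and> (\<forall>\<xi>. 0 \<le> \<eta> \<xi> \<and> \<eta> \<xi> \<le> 1) \<and>
     (\<forall>\<xi>. 1/2 \<le> norm \<xi> \<and> norm \<xi> \<le> 2 \<longrightarrow> \<eta> \<xi> = 1) \<and>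
     closure {\<xi>. \<eta> \<xi> \<noteq> 0} \<subseteq> {\<xi>. 1/4 \<le> norm \<xi> \<and> norm \<xi> \<le> 4}"

definition herz_shell :: "nat \<Rightarrow> 'a::euclidean_space set" where
  "herz_shell k = (if k = 0 then {x. norm x \<le> 2} else {x. 2 ^ k < norm x \<and> norm x \<le> 2 ^ (k + 1)})"

definition herz_norm ::
    "ennreal \<Rightarrow> real \<Rightarrow> ennreal \<Rightarrow> ('a::euclidean_space \<Rightarrow> complex) \<Rightarrow> ennreal" where
  "herz_norm u s t f =
     lq_norm t UNIV (\<lambda>k::nat. ennreal (2 powr (s * real k)) *
       Lp_norm u (restrict_space lborel (herz_shell k)) (\<lambda>x. ennreal (norm (f x))))"

definition herz_multiplier_norm ::
    "('a::euclidean_space \<Rightarrow> real) \<Rightarrow> ennreal \<Rightarrow> real \<Rightarrow> ennreal \<Rightarrow> ('a \<Rightarrow> complex) \<Rightarrow> ennreal" where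
  "herz_multiplier_norm \<eta> u s t m =
     (SUP k::int. herz_norm u s t
        (inv_fourier (\<lambda>\<xi>. m ((2 powr real_of_int k) *\<^sub>R \<xi>) * complex_of_real (\<eta> \<xi>))))"


section \<open>Triebel-Lizorkin spaces\<close>

definition dilate :: "int \<Rightarrow> ('a::euclidean_space \<Rightarrow> complex) \<Rightarrow> 'a \<Rightarrow> complex" where
  "dilate k \<phi> x =
     complex_of_real (2 powr (real_of_int k * real DIM('a))) * \<phi> ((2 powr real_of_int k) *\<^sub>R x)"

definition littlewood_paley :: "('a::euclidean_space \<Rightarrow> complex) \<Rightarrow> bool" where
  "littlewood_paley \<phi> \<longleftrightarrow> \<phi> \<in> Schwartz \<and>
     closure {\<xi>. fourier \<phi> \<xi> \<noteq> 0} \<subseteq> {\<xi>. 1/2 \<le> norm \<xi> \<and> norm \<xi> \<le> 2} \<and>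
     (\<forall>\<xi>. \<xi> \<noteq> 0 \<longrightarrow> ((\<lambda>k::int. fourier (dilate k \<phi>) \<xi>) has_sum 1) UNIV)"

definition LP_piece ::
    "('a::euclidean_space \<Rightarrow> complex) \<Rightarrow> int \<Rightarrow> (('a \<Rightarrow> complex) \<Rightarrow> complex) \<Rightarrow> 'a \<Rightarrow> complex" where
  "LP_piece \<phi> k \<Lambda> = convolve_dist (dilate k \<phi>) \<Lambda>"

text \<open>The dyadic cube of side length $2^{-j}$ with lower corner $2^{-j} n$.\<close>

definition dyadic_cube :: "int \<Rightarrow> ('a \<Rightarrow> int) \<Rightarrow> 'a::euclidean_space set" where
  "dyadic_cube j n = {x. \<forall>b\<in>Basis.
     2 powr (- real_of_int j) * real_of_int (n b) \<le> x \<bullet> b \<and>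
     x \<bullet> b < 2 powr (- real_of_int j) * (real_of_int (n b) + 1)}"

text \<open>
  Elements of $S'/\mathcal{P}$ are given by representatives: as all moments of \<open>\<phi>\<close> vanish, its
  convolution with a polynomial is zero, so the quasi-norm does not see the choice.
\<close>

definition TL_norm ::
    "('a::euclidean_space \<Rightarrow> complex) \<Rightarrow> ennreal \<Rightarrow> ennreal \<Rightarrow> (('a \<Rightarrow> complex) \<Rightarrow> complex) \<Rightarrow> ennreal" where
  "TL_norm \<phi> p q \<Lambda> =
     (if p < \<infinity> \<or> q = \<infinity> then
        Lp_norm p lborel (\<lambda>x. lq_norm q UNIV (\<lambda>k. ennreal (norm (LP_piece \<phi> k \<Lambda> x))))
      else
        (SUP (j, n)\<in>UNIV. epowr
           ((\<integral>\<^sup>+x\<in>dyadic_cube j n.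
               (\<Sum>\<^sub>\<infinity>k\<in>{j..}. epowr (ennreal (norm (LP_piece \<phi> k \<Lambda> x))) (enn2real q)) \<partial>lborel)
            / emeasure lborel (dyadic_cube j n :: 'a set))
           (enn2real (1 / q))))"

definition TL_space ::
    "('a::euclidean_space \<Rightarrow> complex) \<Rightarrow> ennreal \<Rightarrow> ennreal \<Rightarrow> (('a \<Rightarrow> complex) \<Rightarrow> complex) set" where
  "TL_space \<phi> p q = {\<Lambda>. tempered_distribution \<Lambda> \<and> TL_norm \<phi> p q \<Lambda> < \<infinity>}"

definition multiplier_bounded ::
    "('a::euclidean_space \<Rightarrow> complex) \<Rightarrow> ennreal \<Rightarrow> ennreal \<Rightarrow> ('a \<Rightarrow> complex) \<Rightarrow> bool" where
  "multiplier_bounded \<phi> p q m \<longleftrightarrow> (\<exists>C::real. \<forall>f\<in>S_infinity.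
     (if distribution_of (multiplier_op m f) \<in> TL_space \<phi> p q
      then TL_norm \<phi> p q (distribution_of (multiplier_op m f)) else \<infinity>)
     \<le> ennreal C * TL_norm \<phi> p q (distribution_of f))"

end

theory Submission
  imports Defs "HOL-Probability.Characteristic_Functions"
begin

text \<open>
  Fix $r = \min(p, q) < 1$ and the weight $W(x) = (1 + \delta |x|)^{-d/r} (1 + \ln (1 + \delta |x|))^{-1/r}$.
  It is integrable because $r < 1$, the function $W^r$ is not, and the decay of \<open>W\<close> is exactly what the
  Herz norm tolerates.  Let $K(x) = W(x) e^{2 \pi i \langle x, b \rangle}$ for a unit vector \<open>b\<close>, and let \<open>m\<close>
  be the sum of the dilates of $\widehat{K} \widehat{\phi}$ by the powers of $2^8$.  The given function \<open>\<phi>\<close>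
  serves as test bump: since $\widehat{\phi}(b) = 1$ and \<open>W\<close> is almost constant at unit scale for small
  \<open>\<delta>\<close>, the Littlewood--Paley piece of $T_m \phi$ at its own scale has modulus at least $W / 2$.

  If $p \le q$, then \<open>\<phi>\<close> itself is a counterexample, as $W \notin L^p$.  If $q < p$, superpose bumps
  of scale $R^{-(k+1)}$ at the centres of the cells of side $R^{-k}$ of the unit cube, for
  $k = 0, \dots, R^d - 1$ and \<open>R\<close> a power of $2^8$.  The position of a point relative to its cells is
  governed by its base \<open>R\<close> digits, which are independent; an exponential moment estimate bounds the norm
  of these functions uniformly in \<open>R\<close>.  The phases of the kernels of the bumps of one scale agree, and
  averaging over the unit cube bounds the norm of the image from below by the integral of $W^q$ over a
  cube of side \<open>R\<close>, which tends to infinity.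
\<close>

section \<open>Lebesgue measure and decay\<close>

text \<open>The exponents of the weight \<open>W\<close> are forced. On the dyadic shell of radius
  \<open>2^k\<close> it is about \<open>2^(-kd/r) k^(-1/r)\<close>, so its \<open>L^u\<close> norm
  times \<open>2^(ks)\<close> is about \<open>2^(-k\<epsilon>) k^(-1/r)\<close> with
  \<open>\<epsilon> = d/r - d/u - s\<close>: the Herz norm is finite for
  \<open>\<epsilon> > 0\<close>, and for \<open>\<epsilon> = 0\<close> exactly when
  \<open>t > r\<close>. The integral of \<open>W^r\<close> over the same shell is about
  \<open>1/k\<close>, hence the divergence. If \<open>q < p\<close>, a single bump shows nothing,
  because \<open>W\<close> then lies in \<open>L^p\<close>; the divergence has to be carried by the
  inner \<open>l^q\<close> sum over many scales. A bump of relative scale \<open>1/R\<close>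
  occupies a fraction \<open>R^(-d)\<close> of its cell. With \<open>R^d\<close> levels a point
  therefore meets a bounded number of bumps on average, while the images, through the tail of
  \<open>W\<close>, contribute the whole integral of \<open>W^q\<close> over a cube of side
  \<open>R\<close>. The base \<open>2^8\<close> leaves room for three annuli, those of the symbol,
  of the Littlewood-Paley function and of the cutoff, so that every frequency window sees at most
  one dilate.\<close>

lemma nn_integral_lborel_affine:
  fixes f :: "'a::euclidean_space \<Rightarrow> ennreal"
  assumes [measurable]: "f \<in> borel_measurable borel" and "c \<noteq> 0"
  shows "(\<integral>\<^sup>+x. f (t + c *\<^sub>R x) \<partial>lborel) = ennreal (1 / \<bar>c\<bar> ^ DIM('a)) * (\<integral>\<^sup>+x. f x \<partial>lborel)"
proof -
  have "(\<integral>\<^sup>+x. f x \<partial>lborel) = ennreal (\<bar>c\<bar> ^ DIM('a)) * (\<integral>\<^sup>+x. f (t + c *\<^sub>R x) \<partial>lborel)"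
    by (subst lborel_affine[OF assms(2), of t])
       (simp add: nn_integral_density nn_integral_distr nn_integral_cmult)
  moreover have "ennreal (1 / \<bar>c\<bar> ^ DIM('a)) * ennreal (\<bar>c\<bar> ^ DIM('a)) = 1"
    using assms(2) by (simp add: ennreal_mult[symmetric])
  ultimately show ?thesis
    by (simp add: mult.assoc[symmetric])
qed

lemma integrable_lborel_affine:
  fixes f :: "'a::euclidean_space \<Rightarrow> 'b :: {banach, second_countable_topology}"
  assumes f: "integrable lborel f" and c: "c \<noteq> 0"
  shows "integrable lborel (\<lambda>x. f (t + c *\<^sub>R x))"
proof -
  have [measurable]: "f \<in> borel_measurable borel"
    using f by auto
  show ?thesis
    using f c unfolding integrable_iff_bounded
    by (auto simp: nn_integral_lborel_affine[where f="\<lambda>x. ennreal (norm (f x))"]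
        intro!: ennreal_mult_less_top[THEN iffD2])
qed

lemma integral_lborel_affine:
  fixes f :: "'a::euclidean_space \<Rightarrow> 'b :: {banach, second_countable_topology}"
  assumes f: "integrable lborel f" and c: "c \<noteq> 0"
  shows "(LINT x|lborel. f (t + c *\<^sub>R x)) = (1 / \<bar>c\<bar> ^ DIM('a)) *\<^sub>R (LINT x|lborel. f x)"
proof -
  have [measurable]: "f \<in> borel_measurable borel"
    using f by auto
  have "(LINT x|lborel. f x) = \<bar>c\<bar> ^ DIM('a) *\<^sub>R (LINT x|lborel. f (t + c *\<^sub>R x))"
    using c integrable_lborel_affine[OF f c, of t]
    by (subst lborel_affine[OF c, of t]) (simp add: integral_density integral_distr)
  then show ?thesis
    using c by simp
qed

lemma nn_integral_lborel_reflect: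
  fixes f :: "'a::euclidean_space \<Rightarrow> ennreal"
  assumes "f \<in> borel_measurable borel"
  shows "(\<integral>\<^sup>+y. f (x - y) \<partial>lborel) = (\<integral>\<^sup>+y. f y \<partial>lborel)"
  using nn_integral_lborel_affine[OF assms, of "-1" x] by simp

lemma integral_lborel_reflect:
  fixes f :: "'a::euclidean_space \<Rightarrow> 'b :: {banach, second_countable_topology}"
  assumes "integrable lborel f"
  shows "(LINT y|lborel. f (x - y)) = (LINT y|lborel. f y)"
  using integral_lborel_affine[OF assms, of "-1" x] by simp

lemma integrable_lborel_reflect:
  fixes f :: "'a::euclidean_space \<Rightarrow> 'b :: {banach, second_countable_topology}"
  assumes "integrable lborel f"
  shows "integrable lborel (\<lambda>y. f (x - y))"
  using integrable_lborel_affine[OF assms, of "-1" x] by simp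

section \<open>Dyadic shells and integrability of polynomial decay\<close>

lemma emeasure_herz_shell_le:
  "emeasure lborel (herz_shell k :: 'a::euclidean_space set)
     \<le> ennreal (unit_ball_vol (real DIM('a)) * 2 ^ ((k + 1) * DIM('a)))"
proof -
  have "emeasure lborel (herz_shell k :: 'a set) \<le> emeasure lborel (cball (0::'a) (2 ^ (k + 1)))"
    by (intro emeasure_mono) (auto simp: herz_shell_def)
  then show ?thesis
    by (simp add: emeasure_cball power_mult[symmetric] flip: power_Suc)
qed

lemma borel_herz_shell [measurable]: "herz_shell k \<in> sets borel"
proof -
  have "herz_shell k = (if k = 0 then cball (0::'a) 2 else cball 0 (2 ^ (k + 1)) - cball 0 (2 ^ k))"
    by (auto simp: herz_shell_def)
  then show ?thesis by simp
qed

lemma disjoint_herz_shell: "disjoint_family (herz_shell :: nat \<Rightarrow> 'a::euclidean_space set)"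
proof -
  have *: "herz_shell i \<inter> (herz_shell j :: 'a set) = {}" if "i < j" for i j
  proof -
    have "(2::real) ^ (i + 1) \<le> 2 ^ j"
      using that by (intro power_increasing) auto
    then show ?thesis
      using that by (auto simp: herz_shell_def split: if_splits)
  qed
  show ?thesis
    unfolding disjoint_family_on_def by (metis * Int_commute linorder_neqE_nat)
qed

lemma UN_herz_shell: "(\<Union>k. herz_shell k) = (UNIV :: 'a::euclidean_space set)"
proof -
  have "\<exists>k. x \<in> herz_shell k" for x :: 'a
  proof -
    define k where "k = (LEAST k. norm x \<le> 2 ^ (k + 1))"
    obtain n where "norm x < 2 ^ n"
      using real_arch_pow[of 2 "norm x"] by auto
    then have "norm x \<le> 2 ^ (n + 1)"
      using norm_ge_zero[of x] by (simp del: norm_ge_zero)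
    then have 1: "norm x \<le> 2 ^ (k + 1)"
      unfolding k_def by (rule LeastI)
    have "2 ^ k < norm x" if "k \<noteq> 0"
    proof -
      have "\<not> norm x \<le> 2 ^ (k - 1 + 1)"
        using that unfolding k_def by (intro not_less_Least) auto
      then show ?thesis using that by simp
    qed
    with 1 have "x \<in> herz_shell k"
      by (auto simp: herz_shell_def)
    then show ?thesis ..
  qed
  then show ?thesis by auto
qed

lemma herz_shell_bounds:
  assumes "x \<in> herz_shell k"
  shows "2 ^ k \<le> 1 + norm x" "norm x \<le> 2 ^ (k + 1)"
  using assms by (auto simp: herz_shell_def split: if_splits)

lemma nn_integral_herz_shells:
  fixes f :: "'a::euclidean_space \<Rightarrow> ennreal"
  assumes [measurable]: "f \<in> borel_measurable borel"
  shows "(\<integral>\<^sup>+x. f x \<partial>lborel) = (\<Sum>k. \<integral>\<^sup>+x\<in>herz_shell k. f x \<partial>lborel)"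
proof -
  have "(\<integral>\<^sup>+x. f x \<partial>lborel) = (\<integral>\<^sup>+x\<in>(\<Union>k. herz_shell k). f x \<partial>lborel)"
    by (simp add: UN_herz_shell)
  also have "\<dots> = (\<Sum>k. \<integral>\<^sup>+x\<in>herz_shell k. f x \<partial>lborel)"
    by (intro nn_integral_disjoint_family) (auto simp: disjoint_herz_shell)
  finally show ?thesis .
qed

abbreviation decay :: "real \<Rightarrow> 'a::real_normed_vector \<Rightarrow> real" where
  "decay D x \<equiv> (1 + norm x) powr (- D)"

text \<open>On the \<open>k\<close>-th shell the integrand is at most \<open>2^(-kD)\<close> and the
  volume is of order \<open>2^(kd)\<close>, which leaves a geometric series of ratio
  \<open>2^(d - D)\<close>.\<close>

lemma integrable_decay:
  assumes D: "real DIM('a::euclidean_space) < D"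
  shows "integrable lborel (\<lambda>x::'a. decay D x)"
proof -
  let ?d = "real DIM('a)" and ?v = "unit_ball_vol (real DIM('a))"
  have b: "(\<integral>\<^sup>+x\<in>herz_shell k. ennreal (decay D x) \<partial>(lborel :: 'a measure))
      \<le> ennreal (?v * 2 ^ DIM('a) * (2 powr (?d - D)) ^ k)" for k
  proof -
    have "(\<integral>\<^sup>+x\<in>herz_shell k. ennreal (decay D x) \<partial>(lborel :: 'a measure))
      \<le> (\<integral>\<^sup>+x\<in>herz_shell k. ennreal ((2 ^ k) powr (- D)) \<partial>(lborel :: 'a measure))"
      using D by (intro nn_integral_mono)
        (auto simp: indicator_def intro!: powr_mono2' ennreal_leI herz_shell_bounds(1))
    also have "\<dots> = ennreal ((2 ^ k) powr (- D)) * emeasure lborel (herz_shell k :: 'a set)"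
      by (subst nn_integral_cmult_indicator) auto
    also have "\<dots> \<le> ennreal ((2 ^ k) powr (- D)) * ennreal (?v * 2 ^ ((k + 1) * DIM('a)))"
      by (intro mult_left_mono emeasure_herz_shell_le) auto
    also have "\<dots> = ennreal (?v * 2 ^ DIM('a) * (2 powr (?d - D)) ^ k)"
    proof -
      have "(2::real) ^ ((k + 1) * DIM('a)) = 2 ^ DIM('a) * 2 powr (real k * ?d)"
        by (simp add: power_add powr_realpow[symmetric] mult.commute)
      moreover have "(2 ^ k) powr (- D) * 2 powr (real k * ?d) = (2 powr (?d - D)) ^ k"
        by (simp add: powr_realpow[symmetric] powr_powr powr_add[symmetric] algebra_simps)
      ultimately show ?thesis
        by (subst ennreal_mult[symmetric]) (auto intro!: mult_nonneg_nonneg unit_ball_vol_nonneg)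
    qed
    finally show ?thesis .
  qed
  have lt: "2 powr (?d - D) < 1"
    using D by (simp add: powr_less_one)
  have "(\<integral>\<^sup>+x. ennreal (decay D x) \<partial>(lborel :: 'a measure))
      \<le> (\<Sum>k. ennreal (?v * 2 ^ DIM('a) * (2 powr (?d - D)) ^ k))"
    unfolding nn_integral_herz_shells[where f="\<lambda>x::'a. ennreal (decay D x)", simplified]
    by (intro suminf_le b) auto
  also have "\<dots> < \<infinity>"
    using lt by (subst suminf_ennreal2) (auto intro!: mult_nonneg_nonneg unit_ball_vol_nonneg summable_mult summable_geometric)
  finally show ?thesis
    by (intro integrableI_nonneg) auto
qed

text \<open>A multiplicative triangle inequality; it moves polynomial weights from one point to
  another in the decay estimates.\<close>

lemma peetre: "1 + norm x \<le> (1 + norm y) * (1 + norm (x - y :: 'a::real_normed_vector))"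
proof -
  have "norm x \<le> norm y + norm (x - y)"
    using norm_triangle_ineq[of y "x - y"] by simp
  moreover have "0 \<le> norm y * norm (x - y)"
    by simp
  ultimately have "1 + norm x \<le> 1 + norm y + norm (x - y) + norm y * norm (x - y)"
    by linarith
  then show ?thesis
    by (simp add: algebra_simps)
qed

lemma norm_integral_le:
  fixes f :: "'a \<Rightarrow> 'b :: {banach, second_countable_topology}"
  assumes g: "integrable M g" and le: "\<And>x. norm (f x) \<le> g x"
  shows "norm (LINT x|M. f x) \<le> (LINT x|M. g x)"
proof (cases "integrable M f")
  case True
  have "norm (LINT x|M. f x) \<le> (LINT x|M. norm (f x))"
    by (rule integral_norm_bound)
  also have "\<dots> \<le> (LINT x|M. g x)"
    using True g le by (intro integral_mono) auto
  finally show ?thesis .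
next
  \<comment> \<open>A nonintegrable \<open>f\<close> has Bochner integral 0, and \<open>g\<close> is
    nonnegative because it dominates a norm.\<close>
  case False
  have "0 \<le> g x" for x
    using le[of x] norm_ge_zero[of "f x"] by linarith
  then show ?thesis
    using False by (simp add: not_integrable_integral_eq)
qed

section \<open>Fourier integrals\<close>

text \<open>Both transforms are integrals against this kernel, \<open>fourier\<close> with
  \<open>- x\<close> and \<open>inv_fourier\<close> with \<open>x\<close>; through
  \<open>cis\<close> its modulus and its additivity are immediate.\<close>

definition character :: "'a::euclidean_space \<Rightarrow> 'a \<Rightarrow> complex" where
  "character x \<xi> = cis (2 * pi * (x \<bullet> \<xi>))"

lemma norm_character [simp]: "norm (character x \<xi>) = 1"
  by (simp add: character_def)

lemma character_add: "character (x + y) \<xi> = character x \<xi> * character y \<xi>"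
  by (simp add: character_def inner_add_left ring_distribs cis_mult)

lemma character_commute: "character x \<xi> = character \<xi> x"
  by (simp add: character_def inner_commute)

lemma character_scaleR_left: "character (c *\<^sub>R x) \<xi> = character x (c *\<^sub>R \<xi>)"
  by (simp add: character_def)

lemma character_zero [simp]: "character 0 \<xi> = 1" "character x 0 = 1"
  by (simp_all add: character_def)

lemma continuous_character [continuous_intros]:
  "continuous_on A f \<Longrightarrow> continuous_on A g \<Longrightarrow> continuous_on A (\<lambda>x. character (f x) (g x))"
  unfolding character_def by (intro continuous_intros)

lemma borel_measurable_character [measurable]:
  assumes [measurable]: "f \<in> borel_measurable M" "g \<in> borel_measurable M"
  shows "(\<lambda>x. character (f x) (g x)) \<in> borel_measurable M"
proof -
  have [measurable]: "cis \<in> borel_measurable borel"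
    by (intro borel_measurable_continuous_onI continuous_intros)
  show ?thesis
    unfolding character_def by measurable
qed

lemma fourier_eq: "fourier f \<xi> = (LINT x|lborel. f x * character (- x) \<xi>)"
  unfolding fourier_def character_def
  by (intro Bochner_Integration.integral_cong refl) (simp add: cis_conv_exp mult_ac)

lemma inv_fourier_eq: "inv_fourier g x = (LINT \<xi>|lborel. g \<xi> * character x \<xi>)"
  unfolding inv_fourier_def character_def
  by (intro Bochner_Integration.integral_cong refl) (simp add: cis_conv_exp mult_ac)

lemma integrable_mult_character:
  assumes f: "integrable lborel f" and [measurable]: "g \<in> borel_measurable borel" "h \<in> borel_measurable borel"
  shows "integrable lborel (\<lambda>x. f x * character (g x) (h x))"
proof (rule Bochner_Integration.integrable_bound[OF f])
  have [measurable]: "f \<in> borel_measurable borel"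
    using f by auto
  show "(\<lambda>x. f x * character (g x) (h x)) \<in> borel_measurable lborel"
    by measurable
qed (auto simp: norm_mult)

lemma integral_norm_bound_mult_character:
  assumes f: "integrable lborel f"
  shows "norm (LINT x|lborel. f x * character (g x) (h x)) \<le> (LINT x|lborel. norm (f x))"
proof -
  have "norm (LINT x|lborel. f x * character (g x) (h x))
     \<le> (LINT x|lborel. norm (f x * character (g x) (h x)))"
    by (rule integral_norm_bound)
  then show ?thesis by (simp add: norm_mult)
qed

lemma norm_fourier_le: "integrable lborel f \<Longrightarrow> norm (fourier f \<xi>) \<le> (LINT x|lborel. norm (f x))"
  unfolding fourier_eq by (rule integral_norm_bound_mult_character)

lemma norm_inv_fourier_le:
  "integrable lborel f \<Longrightarrow> norm (inv_fourier f \<xi>) \<le> (LINT x|lborel. norm (f x))"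
  unfolding inv_fourier_eq by (rule integral_norm_bound_mult_character)

lemma continuous_on_inv_fourier:
  fixes f :: "'a::euclidean_space \<Rightarrow> complex"
  assumes f: "integrable lborel f"
  shows "continuous_on UNIV (inv_fourier f)"
  unfolding continuous_on_sequentially
proof (intro allI ballI impI, elim conjE)
  fix X and x :: 'a assume X: "X \<longlonglongrightarrow> x"
  have [measurable]: "f \<in> borel_measurable borel"
    using f by auto
  have "(\<lambda>i. LINT \<xi>|lborel. f \<xi> * character (X i) \<xi>) \<longlonglongrightarrow> (LINT \<xi>|lborel. f \<xi> * character x \<xi>)"
  proof (rule integral_dominated_convergence[where w="\<lambda>x. norm (f x)"])
    have "(\<lambda>i. f \<xi> * character (X i) \<xi>) \<longlonglongrightarrow> f \<xi> * character x \<xi>" for \<xi>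
    proof -
      have "continuous_on UNIV (\<lambda>x. f \<xi> * character x \<xi>)"
        by (intro continuous_intros)
      then show ?thesis
        using X by (auto simp: continuous_on_sequentially comp_def)
    qed
    then show "AE \<xi> in lborel. (\<lambda>i. f \<xi> * character (X i) \<xi>) \<longlonglongrightarrow> f \<xi> * character x \<xi>"
      by simp
  qed (use f in \<open>auto simp: norm_mult\<close>)
  then show "(inv_fourier f \<circ> X) \<longlonglongrightarrow> inv_fourier f x"
    by (simp add: comp_def inv_fourier_eq)
qed

lemma fourier_eq_inv_fourier: "fourier f \<xi> = inv_fourier f (- \<xi>)"
  unfolding fourier_eq inv_fourier_eq
  by (simp add: character_def inner_commute)

lemma continuous_on_fourier:
  assumes f: "integrable lborel f"
  shows "continuous_on UNIV (fourier f)"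
proof -
  have "continuous_on UNIV (\<lambda>x. inv_fourier f (- x))"
    by (intro continuous_on_compose2[OF continuous_on_inv_fourier[OF f]] continuous_intros) auto
  then show ?thesis
    by (simp add: fourier_eq_inv_fourier[abs_def])
qed

lemma borel_measurable_fourier: "integrable lborel f \<Longrightarrow> fourier f \<in> borel_measurable borel"
  by (intro borel_measurable_continuous_onI continuous_on_fourier)

lemma borel_measurable_inv_fourier: "integrable lborel f \<Longrightarrow> inv_fourier f \<in> borel_measurable borel"
  by (intro borel_measurable_continuous_onI continuous_on_inv_fourier)

text \<open>By Fubini: a product one of whose factors is a Fourier transform becomes a convolution
  with the original function. Integrability of \<open>w\<close> and \<open>G\<close> is enough, so
  this applies to kernels whose transform is never inverted. It serves Gaussian summation,
  Littlewood-Paley pieces and the multiplier kernel alike.\<close>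

lemma inv_fourier_fourier_times:
  fixes w G :: "'a::euclidean_space \<Rightarrow> complex"
  assumes w: "integrable lborel w" and G: "integrable lborel G"
  shows "inv_fourier (\<lambda>\<xi>. fourier w (c *\<^sub>R \<xi>) * G \<xi>) x
     = (LINT y|lborel. w y * inv_fourier G (x - c *\<^sub>R y))"
proof -
  have [measurable]: "w \<in> borel_measurable borel" "G \<in> borel_measurable borel"
    using w G by auto
  let ?f = "\<lambda>\<xi> y. w y * G \<xi> * character (x - c *\<^sub>R y) \<xi>"
  have int: "integrable (lborel \<Otimes>\<^sub>M lborel) (\<lambda>(\<xi>, y). ?f \<xi> y)"
  proof (rule lborel_pair.Fubini_integrable)
    show "(\<lambda>(\<xi>, y). ?f \<xi> y) \<in> borel_measurable (lborel \<Otimes>\<^sub>M lborel)"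
      by measurable
    show "integrable lborel (\<lambda>\<xi>. LINT y|lborel. norm (case (\<xi>, y) of (\<xi>, y) \<Rightarrow> ?f \<xi> y))"
      using G by (simp add: norm_mult)
    show "AE \<xi> in lborel. integrable lborel (\<lambda>y. case (\<xi>, y) of (\<xi>, y) \<Rightarrow> ?f \<xi> y)"
      using w by (auto intro!: integrable_mult_character)
  qed
  have "inv_fourier (\<lambda>\<xi>. fourier w (c *\<^sub>R \<xi>) * G \<xi>) x = (LINT \<xi>|lborel. LINT y|lborel. ?f \<xi> y)"
    unfolding inv_fourier_eq
  proof (intro Bochner_Integration.integral_cong refl)
    fix \<xi>
    have "character (- y) (c *\<^sub>R \<xi>) * character x \<xi> = character (x - c *\<^sub>R y) \<xi>" for y
      using character_add[of "- c *\<^sub>R y" x \<xi>] character_scaleR_left[of c "- y" \<xi>] by simp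
    then have "(\<lambda>y. ?f \<xi> y) = (\<lambda>y. w y * character (- y) (c *\<^sub>R \<xi>) * (G \<xi> * character x \<xi>))"
      by (simp add: fun_eq_iff mult_ac)
    then show "fourier w (c *\<^sub>R \<xi>) * G \<xi> * character x \<xi> = (LINT y|lborel. ?f \<xi> y)"
      by (simp add: fourier_eq)
  qed
  also have "\<dots> = (LINT y|lborel. LINT \<xi>|lborel. ?f \<xi> y)"
    by (rule lborel_pair.Fubini_integral[symmetric]) (use int in simp)
  also have "\<dots> = (LINT y|lborel. w y * inv_fourier G (x - c *\<^sub>R y))"
    unfolding inv_fourier_eq by (simp add: mult.assoc)
  finally show ?thesis .
qed

text \<open>The decay half of the Schwartz condition, for the function itself. Kernels obtained as
  inverse transforms enter only through their size, so no control of derivatives is carried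
  along.\<close>

definition rapid :: "('a::euclidean_space \<Rightarrow> complex) \<Rightarrow> bool" where
  "rapid f \<longleftrightarrow> (\<forall>N::nat. \<exists>C. \<forall>x. (1 + norm x) ^ N * norm (f x) \<le> C)"

lemma rapidE:
  assumes "rapid f"
  obtains C where "0 < C" "\<And>x. norm (f x) \<le> C * inverse ((1 + norm x) ^ N)"
proof -
  obtain C where C: "\<And>x. (1 + norm x) ^ N * norm (f x) \<le> C"
    using assms unfolding rapid_def by blast
  have pos: "0 < (1 + norm x) ^ N" for x :: 'a
    by (simp add: add_pos_nonneg)
  have "norm (f x) \<le> (\<bar>C\<bar> + 1) * inverse ((1 + norm x) ^ N)" for x
    using C[of x] pos[of x] by (simp add: field_simps)
  then show thesis
    by (intro that[of "\<bar>C\<bar> + 1"]) auto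
qed

lemma integrable_inverse_power:
  "DIM('a) < N \<Longrightarrow> integrable lborel (\<lambda>x::'a::euclidean_space. inverse ((1 + norm x) ^ N))"
proof -
  assume "DIM('a) < N"
  moreover have "inverse ((1 + norm x) ^ N) = decay (real N) x" for x :: 'a
    by (simp add: powr_minus powr_realpow add_pos_nonneg)
  ultimately show ?thesis
    using integrable_decay[of "real N", where 'a='a] by simp
qed

lemma integrable_rapid:
  assumes "rapid f" and [measurable]: "f \<in> borel_measurable borel"
  shows "integrable lborel f"
proof -
  obtain C where C: "0 < C" "\<And>x. norm (f x) \<le> C * inverse ((1 + norm x) ^ (DIM('a) + 1))"
    using rapidE[OF assms(1)] by metis
  show ?thesis
  proof (rule Bochner_Integration.integrable_bound)
    show "integrable lborel (\<lambda>x::'a. C * inverse ((1 + norm x) ^ (DIM('a) + 1)))"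
      by (intro integrable_mult_right integrable_inverse_power) auto
    show "AE x in lborel. norm (f x) \<le> norm (C * inverse ((1 + norm x) ^ (DIM('a) + 1)))"
      using C by (auto intro!: AE_I2 order.trans[OF C(2)] simp del: power_Suc)
  qed measurable
qed

text \<open>Peetre's inequality splits \<open>(1 + |x|)^N\<close> between the two factors;
  \<open>w\<close> decays by \<open>d + 1\<close> further powers and so leaves an integrable
  majorant.\<close>

lemma rapid_convolution:
  fixes w g :: "'a::euclidean_space \<Rightarrow> complex"
  assumes w: "rapid w" and g: "rapid g"
  shows "rapid (\<lambda>x. LINT y|lborel. w y * g (x - c *\<^sub>R y))"
  unfolding rapid_def
proof
  fix N :: nat
  let ?d = "DIM('a) + 1"
  obtain A where A: "0 < A" "\<And>x. norm (w x) \<le> A * inverse ((1 + norm x) ^ (N + ?d))"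
    using rapidE[OF w] by metis
  obtain B where B: "0 < B" "\<And>x. norm (g x) \<le> B * inverse ((1 + norm x) ^ N)"
    using rapidE[OF g] by metis
  \<comment> \<open>This factor compares \<open>1 + |c y|\<close> with
    \<open>1 + |y|\<close>.\<close>
  define c' where "c' = max 1 \<bar>c\<bar>"
  let ?K = "A * B * c' ^ N"
  have bound: "(1 + norm x) ^ N * norm (w y * g (x - c *\<^sub>R y)) \<le> ?K * inverse ((1 + norm y) ^ ?d)" for x y
  proof -
    have "1 + norm (c *\<^sub>R y) \<le> c' * (1 + norm y)"
      unfolding c'_def by (auto simp: ring_distribs intro!: add_mono mult_right_mono)
    then have "1 + norm x \<le> c' * (1 + norm y) * (1 + norm (x - c *\<^sub>R y))"
      using peetre[of x "c *\<^sub>R y"] by (smt (verit) mult_right_mono norm_ge_zero)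
    then have "(1 + norm x) ^ N \<le> (c' * (1 + norm y) * (1 + norm (x - c *\<^sub>R y))) ^ N"
      by (intro power_mono) auto
    then have "(1 + norm x) ^ N * norm (w y * g (x - c *\<^sub>R y))
       \<le> (c' * (1 + norm y) * (1 + norm (x - c *\<^sub>R y))) ^ N *
         ((A * inverse ((1 + norm y) ^ (N + ?d))) * (B * inverse ((1 + norm (x - c *\<^sub>R y)) ^ N)))"
      unfolding norm_mult by (intro mult_mono A B) (auto intro!: mult_nonneg_nonneg zero_le_power simp: A B c'_def less_imp_le add_nonneg_nonneg)
    also have "\<dots> = ?K * inverse ((1 + norm y) ^ ?d)"
    proof -
      define a b where "a = 1 + norm y" and "b = 1 + norm (x - c *\<^sub>R y)"
      have "a \<noteq> 0" "b \<noteq> 0"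
        unfolding a_def b_def by (smt (verit) norm_ge_zero)+
      then show ?thesis
        unfolding a_def[symmetric] b_def[symmetric] by (simp add: power_mult_distrib power_add field_simps)
    qed
    finally show ?thesis .
  qed
  have "(1 + norm x) ^ N * norm (LINT y|lborel. w y * g (x - c *\<^sub>R y))
      \<le> (LINT y::'a|lborel. ?K * inverse ((1 + norm y) ^ ?d))" for x
  proof -
    let ?i = "\<lambda>y. w y * g (x - c *\<^sub>R y)"
    have pos: "0 < (1 + norm x) ^ N" by (simp add: add_pos_nonneg)
    have "norm (LINT y|lborel. (1 + norm x) ^ N *\<^sub>R ?i y) \<le> (LINT y::'a|lborel. ?K * inverse ((1 + norm y) ^ ?d))"
      using bound pos
      by (intro norm_integral_le integrable_mult_right integrable_inverse_power) auto
    then show ?thesis using pos by simp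
  qed
  then show "\<exists>C. \<forall>x. (1 + norm x) ^ N * norm (LINT y|lborel. w y * g (x - c *\<^sub>R y)) \<le> C"
    by blast
qed

section \<open>Fourier inversion\<close>

text \<open>Lebesgue measure as the image of a product of one-dimensional measures: integrals of
  product functions reduce to coordinates.\<close>

lemma lborel_eq_distr_PiM:
  "(lborel :: 'a::euclidean_space measure) = distr (\<Pi>\<^sub>M b\<in>Basis. lborel) borel (\<lambda>f. \<Sum>b\<in>Basis. f b *\<^sub>R b)"
  unfolding lborel_def[where 'a='a] by (simp add: lborel_eq_real)

lemma
  fixes f :: "'a::euclidean_space \<Rightarrow> real \<Rightarrow> 'b::{real_normed_field, banach, second_countable_topology}"
  assumes f: "\<And>b. b \<in> Basis \<Longrightarrow> integrable lborel (f b)"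
  shows integral_lborel_prod: "(LINT x|lborel. (\<Prod>b\<in>Basis. f b (x \<bullet> b))) = (\<Prod>b\<in>Basis. (LINT t|lborel. f b t))"
    and integrable_lborel_prod: "integrable lborel (\<lambda>x. \<Prod>b\<in>Basis. f b (x \<bullet> b))"
proof -
  interpret product_sigma_finite "\<lambda>_::'a. lborel :: real measure" ..
  have [measurable]: "f b \<in> borel_measurable borel" if "b \<in> Basis" for b
    using f[OF that] by auto
  have m: "(\<lambda>x. \<Prod>b\<in>Basis. f b (x \<bullet> b)) \<in> borel_measurable borel"
    by measurable
  have *: "(\<Prod>b\<in>Basis. f b ((\<Sum>i\<in>Basis. g i *\<^sub>R i) \<bullet> b)) = (\<Prod>b\<in>Basis. f b (g b))" for g
    by (intro prod.cong refl) simp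
  show "(LINT x|lborel. (\<Prod>b\<in>Basis. f b (x \<bullet> b))) = (\<Prod>b\<in>Basis. (LINT t|lborel. f b t))"
    unfolding lborel_eq_distr_PiM[where 'a='a]
    by (subst integral_distr[OF _ m]) (simp_all add: * f product_integral_prod)
  show "integrable lborel (\<lambda>x. \<Prod>b\<in>Basis. f b (x \<bullet> b))"
    unfolding lborel_eq_distr_PiM[where 'a='a]
    by (subst integrable_distr_eq[OF _ m]) (simp_all add: * f product_integrable_prod)
qed

section \<open>The Gaussian and inversion by Gaussian summation\<close>

definition gauss :: "'a::euclidean_space \<Rightarrow> complex" where
  "gauss \<xi> = (\<Prod>b\<in>Basis. complex_of_real (std_normal_density (\<xi> \<bullet> b)))"

lemma integrable_std_normal: "integrable lborel (\<lambda>t. complex_of_real (std_normal_density t))"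
  using integrable_normal_density[of 1 0] by (intro integrable_of_real) simp

lemma integrable_gauss: "integrable lborel gauss"
  unfolding gauss_def by (intro integrable_lborel_prod integrable_std_normal)

lemma continuous_on_gauss: "continuous_on UNIV gauss"
  unfolding gauss_def std_normal_density_def by (intro continuous_intros) auto

lemma gauss_zero_neq: "gauss 0 \<noteq> 0"
  by (simp add: gauss_def std_normal_density_def)

lemma norm_gauss_le: "norm (gauss (\<xi>::'a::euclidean_space)) \<le> norm (gauss (0::'a))"
  unfolding gauss_def prod_norm[symmetric]
  by (intro prod_mono conjI) (simp_all add: std_normal_density_def norm_divide divide_right_mono)

text \<open>Coordinate by coordinate this is the characteristic function of the standard normal
  distribution, evaluated at \<open>2 * pi * (x \<bullet> b)\<close>.\<close>

lemma inv_fourier_gauss: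
  "inv_fourier gauss x = (\<Prod>b\<in>Basis. complex_of_real (exp (- (2 * pi * (x \<bullet> b))\<^sup>2 / 2)))"
proof -
  have [measurable]: "cis \<in> borel_measurable borel"
    by (intro borel_measurable_continuous_onI continuous_intros)
  have c: "(LINT t|lborel. complex_of_real (std_normal_density t) * cis (s * t))
      = complex_of_real (exp (- s\<^sup>2 / 2))" for s
  proof -
    have "char std_normal_distribution s = (LINT t|lborel. std_normal_density t *\<^sub>R cis (s * t))"
      unfolding char_def by (subst integral_density) (auto simp: cis_conv_exp)
    then show ?thesis
      by (simp add: char_std_normal_distribution scaleR_conv_of_real)
  qed
  have eq: "gauss \<xi> * character x \<xi>
      = (\<Prod>b\<in>Basis. complex_of_real (std_normal_density (\<xi> \<bullet> b)) * cis ((2 * pi * (x \<bullet> b)) * (\<xi> \<bullet> b)))" for \<xi>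
  proof -
    have "character x \<xi> = cis (\<Sum>b\<in>Basis. (2 * pi * (x \<bullet> b)) * (\<xi> \<bullet> b))"
      by (simp add: character_def euclidean_inner[of x \<xi>] sum_distrib_left mult_ac)
    also have "\<dots> = (\<Prod>b\<in>Basis. cis ((2 * pi * (x \<bullet> b)) * (\<xi> \<bullet> b)))"
      by (induction rule: infinite_finite_induct) (auto simp: cis_mult[symmetric])
    finally show ?thesis
      by (simp add: gauss_def prod.distrib)
  qed
  show ?thesis
    unfolding inv_fourier_eq eq
    by (subst integral_lborel_prod)
      (auto simp: c intro!: Bochner_Integration.integrable_bound[OF integrable_std_normal] simp: norm_mult)
qed

text \<open>The second claim is the inversion formula for the Gaussian at the origin; it gives the
  mass of the approximate identity used below.\<close>

lemma
  shows integrable_inv_fourier_gauss: "integrable lborel (inv_fourier gauss :: 'a::euclidean_space \<Rightarrow> complex)"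
    and integral_inv_fourier_gauss: "(LINT x|lborel. inv_fourier gauss (x :: 'a)) = gauss (0 :: 'a)"
proof -
  let ?e = "\<lambda>t::real. complex_of_real (exp (- (2 * pi * t)\<^sup>2 / 2))"
  have e: "?e t = sqrt (2 * pi) * complex_of_real (std_normal_density (0 + (2 * pi) * t))" for t
    by (simp add: std_normal_density_def)
  have i: "integrable lborel ?e"
    unfolding e using lborel_integrable_real_affine[OF integrable_std_normal, of "2*pi" 0] by simp
  have "(LINT t|lborel. complex_of_real (std_normal_density t)) = 1"
    using integral_normal_density[of 1 0] by simp
  moreover have "(LINT t|lborel. complex_of_real (std_normal_density t))
      = (2 * pi) *\<^sub>R (LINT t|lborel. complex_of_real (std_normal_density (0 + (2 * pi) * t)))"
    using lborel_integral_real_affine[of "2*pi" "\<lambda>t. complex_of_real (std_normal_density t)" 0] by simp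
  ultimately have "(LINT t|lborel. complex_of_real (std_normal_density (0 + (2 * pi) * t))) = complex_of_real (1 / (2 * pi))"
    by (simp add: field_simps scaleR_conv_of_real)
  then have "(LINT t|lborel. ?e t) = complex_of_real (sqrt (2 * pi) * (1 / (2 * pi)))"
    unfolding e by simp
  also have "sqrt (2 * pi) * (1 / (2 * pi)) = std_normal_density 0"
    by (simp add: std_normal_density_def real_div_sqrt field_simps)
  finally have v: "(LINT t|lborel. ?e t) = complex_of_real (std_normal_density 0)" .
  show "integrable lborel (inv_fourier gauss :: 'a \<Rightarrow> complex)"
    unfolding inv_fourier_gauss[abs_def] using integrable_lborel_prod[of "\<lambda>_::'a. ?e"] i by simp
  show "(LINT x|lborel. inv_fourier gauss (x :: 'a)) = gauss (0 :: 'a)"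
    unfolding inv_fourier_gauss gauss_def
    using integral_lborel_prod[of "\<lambda>_::'a. ?e"] i v by simp
qed

text \<open>Multiplying the transform by \<open>gauss (\<epsilon> n *\<^sub>R \<xi>)\<close> turns
  the inversion integral into an average of \<open>f\<close> near \<open>x\<close> at scale
  \<open>\<epsilon> n\<close>; both sides converge by dominated convergence as the scale tends to
  0.\<close>

theorem inv_fourier_fourier:
  fixes f :: "'a::euclidean_space \<Rightarrow> complex"
  assumes f: "integrable lborel f" and cont: "continuous_on UNIV f" and bdd: "\<And>x. norm (f x) \<le> B"
    and ff: "integrable lborel (fourier f)"
  shows "inv_fourier (fourier f) x = f x"
proof -
  define k where "k = (inv_fourier gauss :: 'a \<Rightarrow> complex)"
  have k: "integrable lborel k" and kint: "(LINT x|lborel. k x) = gauss (0 :: 'a)"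
    unfolding k_def by (rule integrable_inv_fourier_gauss integral_inv_fourier_gauss)+
  have [measurable]: "f \<in> borel_measurable borel" "k \<in> borel_measurable borel"
      "fourier f \<in> borel_measurable borel" "gauss \<in> borel_measurable (borel :: 'a measure)"
    using f k ff integrable_gauss[where 'a='a] by auto
  define \<epsilon> where "\<epsilon> n = 1 / real (Suc n)" for n
  have \<epsilon>: "\<epsilon> n > 0" "\<epsilon> n \<noteq> 0" for n
    by (simp_all add: \<epsilon>_def)
  have \<epsilon>0: "\<epsilon> \<longlonglongrightarrow> 0"
    unfolding \<epsilon>_def by (rule LIMSEQ_Suc[OF lim_1_over_n])
  have eq: "(LINT \<xi>|lborel. (fourier f \<xi> * gauss (\<epsilon> n *\<^sub>R \<xi>)) * character x \<xi>)
      = (LINT z|lborel. f (x - \<epsilon> n *\<^sub>R z) * k z)" for n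
  proof -
    let ?g = "\<lambda>\<xi>. gauss (\<epsilon> n *\<^sub>R \<xi>)"
    have g: "integrable lborel (?g :: 'a \<Rightarrow> complex)"
      using integrable_lborel_affine[OF integrable_gauss \<epsilon>(2), of 0] by simp
    have gk: "inv_fourier ?g v = (1 / \<epsilon> n ^ DIM('a)) *\<^sub>R k ((1 / \<epsilon> n) *\<^sub>R v)" for v :: 'a
    proof -
      have "inv_fourier ?g v = (LINT \<xi>|lborel. gauss (0 + \<epsilon> n *\<^sub>R \<xi>) * character ((1 / \<epsilon> n) *\<^sub>R v) (0 + \<epsilon> n *\<^sub>R \<xi>))"
        using \<epsilon>[of n] by (simp add: inv_fourier_eq character_scaleR_left)
      also have "\<dots> = (1 / \<bar>\<epsilon> n\<bar> ^ DIM('a)) *\<^sub>R k ((1 / \<epsilon> n) *\<^sub>R v)"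
        unfolding k_def inv_fourier_eq
        by (rule integral_lborel_affine) (auto intro!: integrable_mult_character integrable_gauss \<epsilon>)
      finally show ?thesis
        using \<epsilon>[of n] by simp
    qed
    let ?F = "\<lambda>y. f y * k ((1 / \<epsilon> n) *\<^sub>R (x - y))"
    have kk: "integrable lborel (\<lambda>y. k ((1 / \<epsilon> n) *\<^sub>R (x - y)))"
      using integrable_lborel_affine[OF k, of "- (1 / \<epsilon> n)" "(1 / \<epsilon> n) *\<^sub>R x"] \<epsilon>[of n]
      by (simp add: scaleR_diff_right)
    have F: "integrable lborel ?F"
    proof (rule Bochner_Integration.integrable_bound)
      show "integrable lborel (\<lambda>y. B * norm (k ((1 / \<epsilon> n) *\<^sub>R (x - y))))"
        using kk by (intro integrable_mult_right integrable_norm)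
    qed (auto simp: norm_mult abs_mult intro!: AE_I2 mult_right_mono order.trans[OF bdd abs_ge_self])
    have "(LINT \<xi>|lborel. (fourier f \<xi> * gauss (\<epsilon> n *\<^sub>R \<xi>)) * character x \<xi>)
        = inv_fourier (\<lambda>\<xi>. fourier f (1 *\<^sub>R \<xi>) * ?g \<xi>) x"
      by (simp add: inv_fourier_eq)
    also have "\<dots> = (LINT y|lborel. f y * inv_fourier ?g (x - 1 *\<^sub>R y))"
      by (rule inv_fourier_fourier_times[OF f g])
    also have "\<dots> = (1 / \<bar>- \<epsilon> n\<bar> ^ DIM('a)) *\<^sub>R (LINT y|lborel. ?F y)"
      using \<epsilon>[of n] by (simp add: gk)
    also have "\<dots> = (LINT z|lborel. ?F (x + (- \<epsilon> n) *\<^sub>R z))"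
      by (rule integral_lborel_affine[symmetric, OF F]) (use \<epsilon>[of n] in auto)
    also have "\<dots> = (LINT z|lborel. f (x - \<epsilon> n *\<^sub>R z) * k z)"
      using \<epsilon>[of n] by simp
    finally show ?thesis .
  qed
  have lim1: "(\<lambda>n. LINT \<xi>|lborel. (fourier f \<xi> * gauss (\<epsilon> n *\<^sub>R \<xi>)) * character x \<xi>)
      \<longlonglongrightarrow> (LINT \<xi>|lborel. (fourier f \<xi> * gauss (0 *\<^sub>R \<xi>)) * character x \<xi>)"
  proof (rule integral_dominated_convergence[where w="\<lambda>\<xi>. norm (fourier f \<xi>) * norm (gauss (0::'a))"])
    show "AE \<xi> in lborel. (\<lambda>n. (fourier f \<xi> * gauss (\<epsilon> n *\<^sub>R \<xi>)) * character x \<xi>)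
        \<longlonglongrightarrow> (fourier f \<xi> * gauss (0 *\<^sub>R \<xi>)) * character x \<xi>"
      by (intro AE_I2 tendsto_mult tendsto_const continuous_on_tendsto_compose[OF continuous_on_gauss]
          tendsto_scaleR \<epsilon>0) auto
  qed (use ff in \<open>auto simp: norm_mult intro!: AE_I2 mult_left_mono norm_gauss_le\<close>)
  have lim2: "(\<lambda>n. LINT z|lborel. f (x - \<epsilon> n *\<^sub>R z) * k z) \<longlonglongrightarrow> (LINT z|lborel. f (x - 0 *\<^sub>R z) * k z)"
  proof (rule integral_dominated_convergence[where w="\<lambda>z. B * norm (k z)"])
    show "AE z in lborel. (\<lambda>n. f (x - \<epsilon> n *\<^sub>R z) * k z) \<longlonglongrightarrow> f (x - 0 *\<^sub>R z) * k z"
      by (intro AE_I2 tendsto_mult tendsto_const continuous_on_tendsto_compose[OF cont]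
          tendsto_diff tendsto_scaleR \<epsilon>0) auto
  qed (use k in \<open>auto simp: norm_mult intro!: AE_I2 mult_right_mono bdd\<close>)
  \<comment> \<open>\<open>gauss\<close> is not normalised at the origin, but the same nonzero
    factor \<open>gauss 0\<close> appears in both limits and cancels.\<close>
  have "inv_fourier (fourier f) x * gauss (0::'a) = f x * gauss (0::'a)"
    using LIMSEQ_unique[OF lim1[unfolded eq] lim2] kint
    by (simp add: inv_fourier_eq mult_ac)
  then show ?thesis
    using gauss_zero_neq[where 'a='a] by simp
qed

section \<open>Smooth functions of compact support\<close>

lemma integrable_continuous_compact_support:
  fixes F :: "'a::euclidean_space \<Rightarrow> 'b::{banach, second_countable_topology}"
  assumes "continuous_on UNIV F" and "\<And>x. \<rho> < norm x \<Longrightarrow> F x = 0"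
  shows "integrable lborel F"
proof -
  have "integrable lborel (\<lambda>x. indicator (cball 0 \<rho>) x *\<^sub>R F x)"
    by (intro borel_integrable_compact continuous_on_subset[OF assms(1)]) auto
  also have "(\<lambda>x. indicator (cball 0 \<rho>) x *\<^sub>R F x) = F"
    using assms(2) by (auto simp: fun_eq_iff indicator_def not_le)
  finally show ?thesis .
qed

lemma frechet_derivative_eq_zero_outside:
  fixes F :: "'a::euclidean_space \<Rightarrow> 'b::real_normed_vector"
  assumes "\<And>x. \<rho> < norm x \<Longrightarrow> F x = 0" and "\<rho> < norm x"
  shows "frechet_derivative F (at x) b = 0"
proof -
  have "((\<lambda>_. 0) has_derivative (\<lambda>_. 0)) (at x)"
    by (rule has_derivative_const)
  moreover have "open {y::'a. \<rho> < norm y}"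
    by (intro open_Collect_less continuous_intros)
  ultimately have "(F has_derivative (\<lambda>_. 0)) (at x)"
    by (rule has_derivative_transform_within_open) (use assms in auto)
  then show ?thesis
    using frechet_derivative_at by metis
qed

text \<open>A sequence of step lengths, instead of a real limit, makes dominated convergence for
  sequences applicable.\<close>

lemma difference_quotient_LIMSEQ:
  fixes F :: "'a::euclidean_space \<Rightarrow> 'b::real_normed_vector"
  assumes "(F has_derivative D) (at x)"
  shows "(\<lambda>n. real (Suc n) *\<^sub>R (F (x + (1 / real (Suc n)) *\<^sub>R b) - F x)) \<longlonglongrightarrow> D b"
proof -
  have "((\<lambda>s. F (x + s *\<^sub>R b)) has_derivative (\<lambda>h. D (h *\<^sub>R b))) (at 0)"
    by (rule has_derivative_compose[where g=F and f="\<lambda>s. x + s *\<^sub>R b"])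
      (use assms in \<open>auto intro!: derivative_eq_intros\<close>)
  moreover have "D (h *\<^sub>R b) = h *\<^sub>R D b" for h
    using assms by (simp add: has_derivative_bounded_linear bounded_linear.linear linear_scale)
  ultimately have "((\<lambda>s. F (x + s *\<^sub>R b)) has_vector_derivative D b) (at 0)"
    by (simp add: has_vector_derivative_def)
  then have "((\<lambda>s. norm (F (x + s *\<^sub>R b) - F x - s *\<^sub>R D b) / norm s) \<longlongrightarrow> 0) (at 0)"
    by (simp add: has_vector_derivative_def has_derivative_at)
  moreover {
  have "norm (F (x + s *\<^sub>R b) - F x - s *\<^sub>R D b) / norm s = norm ((F (x + s *\<^sub>R b) - F x) /\<^sub>R s - D b)"
    if "s \<noteq> 0" for s
  proof -
    have "(F (x + s *\<^sub>R b) - F x) /\<^sub>R s - D b = inverse s *\<^sub>R (F (x + s *\<^sub>R b) - F x - s *\<^sub>R D b)"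
      using that by (simp add: scaleR_diff_right)
    then show ?thesis by (simp add: divide_inverse mult.commute)
  qed
  then have "eventually (\<lambda>s. norm (F (x + s *\<^sub>R b) - F x - s *\<^sub>R D b) / norm s
      = norm ((F (x + s *\<^sub>R b) - F x) /\<^sub>R s - D b)) (at 0)"
    unfolding eventually_at_filter by simp }
  ultimately have "((\<lambda>s. norm ((F (x + s *\<^sub>R b) - F x) /\<^sub>R s - D b)) \<longlongrightarrow> 0) (at 0)"
    by (rule Lim_transform_eventually)
  then have *: "((\<lambda>s. (F (x + s *\<^sub>R b) - F x) /\<^sub>R s) \<longlongrightarrow> D b) (at 0)"
    by (rule LIM_zero_cancel[OF tendsto_norm_zero_cancel])
  have "filterlim (\<lambda>n. 1 / real (Suc n)) (at 0) sequentially"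
    unfolding filterlim_at using LIMSEQ_Suc[OF lim_1_over_n] by auto
  from filterlim_compose[OF * this] show ?thesis
    by simp
qed

text \<open>By translation invariance every difference quotient of \<open>F\<close> has integral 0,
  and the quotients converge to the derivative under a common integrable bound.\<close>

lemma integral_directional_derivative:
  fixes F :: "'a::euclidean_space \<Rightarrow> complex"
  assumes diff: "\<And>x. F differentiable (at x)"
    and cont: "continuous_on UNIV (\<lambda>x. frechet_derivative F (at x) b)"
    and supp: "\<And>x. \<rho> < norm x \<Longrightarrow> F x = 0"
  shows "(LINT x|lborel. frechet_derivative F (at x) b) = 0"
proof -
  define D where "D x = frechet_derivative F (at x)" for x
  have D: "(F has_derivative D x) (at x)" for x
    using diff unfolding D_def by (simp add: frechet_derivative_works)
  have D0: "D x b = 0" if "\<rho> < norm x" for x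
    unfolding D_def by (rule frechet_derivative_eq_zero_outside[OF supp that])
  have Fc: "continuous_on UNIV F"
    using D by (meson continuous_at_imp_continuous_on has_derivative_continuous)
  have Fi: "integrable lborel F"
    by (rule integrable_continuous_compact_support[OF Fc supp])
  have [measurable]: "F \<in> borel_measurable borel" "(\<lambda>x. D x b) \<in> borel_measurable borel"
    using Fi cont unfolding D_def by (auto intro: borel_measurable_continuous_onI)
  \<comment> \<open>A continuous derivative of compact support is bounded; by the mean value
    inequality the bound passes to the difference quotients.\<close>
  have "compact ((\<lambda>x. D x b) ` cball 0 \<rho>)"
    using cont unfolding D_def by (intro compact_continuous_image continuous_on_subset[OF cont]) auto
  then obtain M where "\<And>x. x \<in> cball 0 \<rho> \<Longrightarrow> norm (D x b) \<le> M"
    by (meson bounded_iff compact_imp_bounded imageI)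
  then have M: "norm (D x b) \<le> max M 0" for x
    using D0[of x] by (cases "norm x \<le> \<rho>") (auto simp: max.coboundedI1)
  define q where "q n x = real (Suc n) *\<^sub>R (F (x + (1 / real (Suc n)) *\<^sub>R b) - F x)" for n x
  have lip: "norm (F (x + t *\<^sub>R b) - F x) \<le> max M 0 * t" if "0 \<le> t" for x t
  proof -
    have "norm (F (x + t *\<^sub>R b) - F (x + 0 *\<^sub>R b)) \<le> max M 0 * norm (t - 0)"
    proof (rule differentiable_bound[where S="{0..t}" and f'="\<lambda>s h. D (x + s *\<^sub>R b) (h *\<^sub>R b)"])
      fix s
      show "((\<lambda>s. F (x + s *\<^sub>R b)) has_derivative (\<lambda>h. D (x + s *\<^sub>R b) (h *\<^sub>R b))) (at s within {0..t})"
        by (rule has_derivative_compose[where g=F and f="\<lambda>s. x + s *\<^sub>R b"])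
          (auto intro!: derivative_eq_intros D)
      have "D (x + s *\<^sub>R b) (h *\<^sub>R b) = h *\<^sub>R D (x + s *\<^sub>R b) b" for h
        using D[of "x + s *\<^sub>R b"] by (simp add: has_derivative_bounded_linear bounded_linear.linear linear_scale)
      then show "onorm (\<lambda>h. D (x + s *\<^sub>R b) (h *\<^sub>R b)) \<le> max M 0"
        using M[of "x + s *\<^sub>R b"] by (intro onorm_le) (simp add: mult.commute mult_left_mono)
    qed (use that in auto)
    then show ?thesis using that by simp
  qed
  have q0: "(LINT x|lborel. q n x) = 0" for n
  proof -
    have "integrable lborel (\<lambda>x. F ((1 / real (Suc n)) *\<^sub>R b + 1 *\<^sub>R x))"
      by (rule integrable_lborel_affine[OF Fi]) simp
    moreover have "(LINT x|lborel. F ((1 / real (Suc n)) *\<^sub>R b + 1 *\<^sub>R x)) = (LINT x|lborel. F x)"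
      using integral_lborel_affine[OF Fi, of 1] by simp
    ultimately show ?thesis
      using Fi by (simp add: q_def add.commute)
  qed
  have "(\<lambda>n. LINT x|lborel. q n x) \<longlonglongrightarrow> (LINT x|lborel. D x b)"
  \<comment> \<open>Step lengths are at most 1, so all quotients vanish outside the ball enlarged by
    \<open>norm b\<close>.\<close>
  proof (rule integral_dominated_convergence[where w="\<lambda>x. indicator (cball 0 (\<rho> + norm b)) x *\<^sub>R max M 0"])
    show "AE x in lborel. (\<lambda>n. q n x) \<longlonglongrightarrow> D x b"
      unfolding q_def using D by (intro AE_I2 difference_quotient_LIMSEQ)
    show "integrable lborel (\<lambda>x::'a. indicator (cball 0 (\<rho> + norm b)) x *\<^sub>R max M 0)"
      by (intro borel_integrable_compact continuous_intros compact_cball)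
    show "AE x in lborel. norm (q n x) \<le> indicator (cball 0 (\<rho> + norm b)) x *\<^sub>R max M 0" for n
    proof (intro AE_I2)
      fix x :: 'a
      let ?t = "1 / real (Suc n)"
      have t: "0 \<le> ?t" "?t \<le> 1" by auto
      show "norm (q n x) \<le> indicator (cball 0 (\<rho> + norm b)) x *\<^sub>R max M 0"
      proof (cases "norm x \<le> \<rho> + norm b")
        case True
        have "norm (q n x) \<le> real (Suc n) * (max M 0 * ?t)"
          unfolding q_def norm_scaleR using lip[OF t(1), of x] by (intro mult_mono) auto
        then show ?thesis using True by simp
      next
        case False
        have "norm (?t *\<^sub>R b) \<le> norm b"
          using mult_right_mono[OF t(2), of "norm b"] by simp
        moreover have "norm x \<le> norm (x + ?t *\<^sub>R b) + norm (?t *\<^sub>R b)"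
          using norm_triangle_ineq4[of "x + ?t *\<^sub>R b" "?t *\<^sub>R b"] by simp
        ultimately have "\<rho> < norm (x + ?t *\<^sub>R b)" "\<rho> < norm x"
          using False norm_ge_zero[of b] by linarith+
        then show ?thesis
          by (simp add: q_def supp)
      qed
    qed
  qed (auto simp: q_def)
  then show ?thesis
    by (simp add: q0 D_def LIMSEQ_const_iff)
qed

lemma character_has_derivative:
  "(character x has_derivative (\<lambda>h. complex_of_real (2 * pi * (x \<bullet> h)) * \<i> * character x \<xi>)) (at \<xi>)"
proof -
  let ?l = "\<lambda>\<xi>. \<i> * complex_of_real (2 * pi * (x \<bullet> \<xi>))"
  have "(?l has_derivative ?l) (at \<xi>)"
    by (intro has_derivative_mult_right has_derivative_of_real has_derivative_inner_right has_derivative_ident)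
  moreover have "(exp has_derivative (\<lambda>h. h * exp (?l \<xi>))) (at (?l \<xi>))"
    proof -
    have "(\<lambda>h. h * exp (?l \<xi>)) = (*) (exp (?l \<xi>))"
      by (rule ext) (rule mult.commute)
    then show ?thesis
      using DERIV_exp[of "?l \<xi>"] unfolding has_field_derivative_def by metis
  qed
  ultimately have "((\<lambda>\<xi>. exp (?l \<xi>)) has_derivative (\<lambda>h. ?l h * exp (?l \<xi>))) (at \<xi>)"
    by (rule has_derivative_compose)
  then show ?thesis
    by (simp add: character_def[abs_def] cis_conv_exp mult_ac)
qed

text \<open>Integration by parts: the product rule for \<open>g\<close> times a character,
  integrated, without boundary term.\<close>

lemma inv_fourier_directional_derivative:
  fixes g :: "'a::euclidean_space \<Rightarrow> complex"
  assumes diff: "\<And>x. g differentiable (at x)"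
    and cont: "continuous_on UNIV (\<lambda>x. frechet_derivative g (at x) b)"
    and supp: "\<And>x. \<rho> < norm x \<Longrightarrow> g x = 0"
  shows "inv_fourier (\<lambda>\<xi>. frechet_derivative g (at \<xi>) b) x
    = - (complex_of_real (2 * pi * (x \<bullet> b)) * \<i>) * inv_fourier g x"
proof -
  let ?F = "\<lambda>\<xi>. g \<xi> * character x \<xi>"
  let ?D = "\<lambda>\<xi>. frechet_derivative g (at \<xi>) b"
  let ?a = "complex_of_real (2 * pi * (x \<bullet> b)) * \<i>"
  have gc: "continuous_on UNIV g"
    using diff by (meson continuous_at_imp_continuous_on differentiable_imp_continuous_within)
  have gi: "integrable lborel g" and Di: "integrable lborel ?D"
    using supp frechet_derivative_eq_zero_outside[OF supp]
    by (auto intro!: integrable_continuous_compact_support[OF gc] integrable_continuous_compact_support[OF cont])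
  have "(?F has_derivative (\<lambda>h. g \<xi> * (complex_of_real (2 * pi * (x \<bullet> h)) * \<i> * character x \<xi>)
       + frechet_derivative g (at \<xi>) h * character x \<xi>)) (at \<xi>)" for \<xi>
    using diff[of \<xi>] by (intro has_derivative_mult character_has_derivative) (simp add: frechet_derivative_works)
  note F_has = this
  have F: "?F differentiable (at \<xi>)" for \<xi>
    using F_has by (rule differentiableI)
  have F': "frechet_derivative ?F (at \<xi>) b = ?D \<xi> * character x \<xi> + ?a * (g \<xi> * character x \<xi>)" for \<xi>
    by (subst frechet_derivative_at[OF F_has, symmetric]) (simp only: mult_ac add.commute)
  have "(LINT \<xi>|lborel. frechet_derivative ?F (at \<xi>) b) = 0"
    by (rule integral_directional_derivative[where \<rho>=\<rho>])
      (auto simp: F F' supp intro!: continuous_intros gc cont)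
  then have "(LINT \<xi>|lborel. ?D \<xi> * character x \<xi>) + ?a * (LINT \<xi>|lborel. g \<xi> * character x \<xi>) = 0"
    unfolding F' using gi Di by (simp add: integrable_mult_character)
  then show ?thesis
    unfolding inv_fourier_eq by (simp add: add_eq_0_iff)
qed

section \<open>Iterated derivatives and the decay of inverse transforms\<close>

lemma smooth_differentiable:
  "smooth f \<Longrightarrow> set bs \<subseteq> Basis \<Longrightarrow> iter_partial bs f differentiable (at x)"
  unfolding smooth_def differentiable_on_def by simp

lemma smooth_continuous:
  "smooth f \<Longrightarrow> set bs \<subseteq> Basis \<Longrightarrow> continuous_on UNIV (iter_partial bs f)"
  unfolding smooth_def using differentiable_imp_continuous_on by blast

lemma iter_partial_eq_zero_outside:
  fixes f :: "'a::euclidean_space \<Rightarrow> 'b::real_normed_vector"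
  assumes "\<And>x. \<rho> < norm x \<Longrightarrow> f x = 0"
  shows "\<rho> < norm x \<Longrightarrow> iter_partial bs f x = 0"
  using assms by (induction bs arbitrary: x) (auto intro!: frechet_derivative_eq_zero_outside)

lemma iter_partial_of_real:
  fixes g :: "'a::euclidean_space \<Rightarrow> real"
  assumes "smooth g" "set bs \<subseteq> Basis"
  shows "iter_partial bs (\<lambda>x. complex_of_real (g x)) = (\<lambda>x. complex_of_real (iter_partial bs g x))"
  using assms(2)
proof (induction bs)
  case (Cons b bs)
  then have IH: "iter_partial bs (\<lambda>x. complex_of_real (g x)) = (\<lambda>x. complex_of_real (iter_partial bs g x))"
    by simp
  have "(iter_partial bs g has_derivative frechet_derivative (iter_partial bs g) (at x)) (at x)" for x
    using smooth_differentiable[OF assms(1)] Cons.prems by (simp add: frechet_derivative_works)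
  then have "((\<lambda>x. complex_of_real (iter_partial bs g x)) has_derivative
      (\<lambda>h. complex_of_real (frechet_derivative (iter_partial bs g) (at x) h))) (at x)" for x
    by (intro has_derivative_of_real)
  from fun_cong[OF frechet_derivative_at[OF this], of _ b] show ?case
    by (simp add: IH fun_eq_iff)
qed simp

text \<open>The cutoff is real-valued, whereas the transforms are taken of complex
  functions.\<close>

lemma smooth_of_real:
  fixes g :: "'a::euclidean_space \<Rightarrow> real"
  assumes "smooth g"
  shows "smooth (\<lambda>x. complex_of_real (g x))"
proof -
  have "iter_partial bs (\<lambda>x. complex_of_real (g x)) differentiable_on UNIV" if "set bs \<subseteq> Basis" for bs
  proof -
    have "((\<lambda>x. complex_of_real (iter_partial bs g x)) has_derivative
        (\<lambda>h. complex_of_real (frechet_derivative (iter_partial bs g) (at x) h))) (at x)" for x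
      using smooth_differentiable[OF assms that] by (intro has_derivative_of_real) (simp add: frechet_derivative_works)
    then show ?thesis
      unfolding iter_partial_of_real[OF assms that] differentiable_on_def differentiable_def by blast
  qed
  then show ?thesis by (simp add: smooth_def)
qed

text \<open>Repeated derivatives in one direction suffice, because decay will be tested along the
  largest coordinate of \<open>x\<close>.\<close>

lemma inv_fourier_iter_partial:
  fixes g :: "'a::euclidean_space \<Rightarrow> complex"
  assumes "smooth g" and "\<And>x. \<rho> < norm x \<Longrightarrow> g x = 0" and "b \<in> Basis"
  shows "inv_fourier (iter_partial (replicate n b) g) x
    = (- (complex_of_real (2 * pi * (x \<bullet> b)) * \<i>)) ^ n * inv_fourier g x"
proof (induction n)
  case (Suc n)
  have b: "set (replicate n b) \<subseteq> Basis" "set (replicate (Suc n) b) \<subseteq> Basis"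
    using assms(3) by auto
  have "inv_fourier (\<lambda>\<xi>. frechet_derivative (iter_partial (replicate n b) g) (at \<xi>) b) x
    = - (complex_of_real (2 * pi * (x \<bullet> b)) * \<i>) * inv_fourier (iter_partial (replicate n b) g) x"
    using smooth_continuous[OF assms(1) b(2)] iter_partial_eq_zero_outside[OF assms(2)]
    by (intro inv_fourier_directional_derivative smooth_differentiable[OF assms(1) b(1)]) auto
  then show ?case
    by (simp add: Suc.IH)
qed simp

text \<open>Derivatives of \<open>g\<close> become powers of a coordinate of \<open>x\<close>. The
  coordinate of largest modulus satisfies \<open>|x| \<le> d |x \<bullet> b|\<close>, so its
  \<open>N\<close>-th power controls the full weight.\<close>

lemma rapid_inv_fourier:
  fixes g :: "'a::euclidean_space \<Rightarrow> complex"
  assumes g: "smooth g" and supp: "\<And>x. \<rho> < norm x \<Longrightarrow> g x = 0"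
  shows "rapid (inv_fourier g)"
  unfolding rapid_def
proof
  fix N :: nat
  define I where "I n b = (LINT \<xi>|lborel. norm (iter_partial (replicate n b) g \<xi>))" for n b
  have I: "\<bar>x \<bullet> b\<bar> ^ n * norm (inv_fourier g x) \<le> I n b" if "b \<in> Basis" for x b n
  proof -
    have "set (replicate n b) \<subseteq> Basis"
      using that by auto
    then have "integrable lborel (iter_partial (replicate n b) g)"
      using iter_partial_eq_zero_outside[OF supp]
      by (intro integrable_continuous_compact_support[OF smooth_continuous[OF g]]) auto
    note le = norm_inv_fourier_le[OF this, of x]
    have eq: "inv_fourier (iter_partial (replicate n b) g) x
        = (- (complex_of_real (2 * pi * (x \<bullet> b)) * \<i>)) ^ n * inv_fourier g x"
      by (rule inv_fourier_iter_partial[OF g _ that]) (rule supp)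
    from le have "(2 * pi * \<bar>x \<bullet> b\<bar>) ^ n * norm (inv_fourier g x) \<le> I n b"
      unfolding I_def eq
      by (simp add: norm_mult norm_power power_mult_distrib abs_mult)
    moreover have "\<bar>x \<bullet> b\<bar> ^ n \<le> (2 * pi * \<bar>x \<bullet> b\<bar>) ^ n"
    proof (intro power_mono)
      have "1 * \<bar>x \<bullet> b\<bar> \<le> (2 * pi) * \<bar>x \<bullet> b\<bar>"
        using pi_gt3 by (intro mult_right_mono) auto
      then show "\<bar>x \<bullet> b\<bar> \<le> 2 * pi * \<bar>x \<bullet> b\<bar>" by simp
    qed auto
    ultimately show ?thesis
      by (meson mult_right_mono norm_ge_zero order_trans)
  qed
  let ?d = "real DIM('a)"
  \<comment> \<open>\<open>I 0\<close> covers bounded \<open>x\<close> and \<open>I N\<close> the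
    decay; summing over \<open>Basis\<close> makes the constant independent of the coordinate chosen
    for \<open>x\<close>.\<close>
  let ?C = "2 ^ N * (\<Sum>b\<in>Basis. I 0 b + ?d ^ N * I N b)"
  have I0: "0 \<le> I n b" for n b
    unfolding I_def by simp
  have "(1 + norm x) ^ N * norm (inv_fourier g x) \<le> ?C" for x
  proof -
    obtain b :: 'a where b: "b \<in> Basis" and max: "\<And>c. c \<in> Basis \<Longrightarrow> \<bar>x \<bullet> c\<bar> \<le> \<bar>x \<bullet> b\<bar>"
    proof -
      let ?M = "(\<lambda>c. \<bar>x \<bullet> c\<bar>) ` (Basis::'a set)"
      have "Max ?M \<in> ?M"
        by (rule Max_in) auto
      then obtain b where b: "Max ?M = \<bar>x \<bullet> b\<bar>" "b \<in> Basis"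
        by (rule imageE)
      have "\<bar>x \<bullet> c\<bar> \<le> \<bar>x \<bullet> b\<bar>" if "c \<in> Basis" for c
        unfolding b(1)[symmetric] using that by (intro Max_ge) auto
      with b(2) that show thesis by blast
    qed
    have "norm x \<le> (\<Sum>c\<in>Basis. \<bar>x \<bullet> c\<bar>)"
      by (rule norm_le_l1)
    also have "\<dots> \<le> (\<Sum>c\<in>(Basis::'a set). \<bar>x \<bullet> b\<bar>)"
      by (intro sum_mono max)
    finally have n: "norm x \<le> ?d * \<bar>x \<bullet> b\<bar>" by simp
    have "(1 + norm x) ^ N \<le> (2 * max 1 (?d * \<bar>x \<bullet> b\<bar>)) ^ N"
      using n by (intro power_mono) auto
    also have "\<dots> \<le> 2 ^ N * (1 + (?d * \<bar>x \<bullet> b\<bar>) ^ N)"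
      unfolding power_mult_distrib[of 2] by (intro mult_left_mono) (auto simp: max_def)
    finally have "(1 + norm x) ^ N * norm (inv_fourier g x)
        \<le> 2 ^ N * (1 + (?d * \<bar>x \<bullet> b\<bar>) ^ N) * norm (inv_fourier g x)"
      by (intro mult_right_mono) auto
    also have "\<dots> = 2 ^ N * (\<bar>x \<bullet> b\<bar> ^ 0 * norm (inv_fourier g x)
        + ?d ^ N * (\<bar>x \<bullet> b\<bar> ^ N * norm (inv_fourier g x)))"
      by (simp add: algebra_simps power_mult_distrib)
    also have "\<dots> \<le> 2 ^ N * (I 0 b + ?d ^ N * I N b)"
      by (intro mult_left_mono add_mono I b) auto
    also have "\<dots> \<le> ?C"
      by (intro mult_left_mono member_le_sum[of b]) (auto intro!: I0 add_nonneg_nonneg mult_nonneg_nonneg b)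
    finally show ?thesis .
  qed
  then show "\<exists>C. \<forall>x. (1 + norm x) ^ N * norm (inv_fourier g x) \<le> C" by blast
qed

section \<open>Schwartz functions and vanishing moments\<close>

lemma Schwartz_rapid: "(f :: 'a::euclidean_space \<Rightarrow> complex) \<in> Schwartz \<Longrightarrow> rapid f"
proof -
  assume "f \<in> Schwartz"
  then have "set [] \<subseteq> (Basis :: 'a set) \<longrightarrow> (\<exists>C. \<forall>x. (1 + norm x) ^ N * norm (iter_partial [] f x) \<le> C)" for N
    unfolding Schwartz_def mem_Collect_eq by blast
  then show ?thesis by (simp add: rapid_def)
qed

lemma Schwartz_continuous: "f \<in> Schwartz \<Longrightarrow> continuous_on UNIV f"
  unfolding Schwartz_def using smooth_continuous[of f "[]"] by simp

lemma Schwartz_borel_measurable: "f \<in> Schwartz \<Longrightarrow> f \<in> borel_measurable borel"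
  by (intro borel_measurable_continuous_onI Schwartz_continuous)

lemma Schwartz_integrable: "f \<in> Schwartz \<Longrightarrow> integrable lborel f"
  by (intro integrable_rapid Schwartz_rapid Schwartz_borel_measurable)

lemma SchwartzI:
  assumes "\<And>bs. set bs \<subseteq> Basis \<Longrightarrow> iter_partial bs f differentiable_on UNIV"
    and "\<And>bs. set bs \<subseteq> Basis \<Longrightarrow> rapid (iter_partial bs f)"
  shows "f \<in> Schwartz"
  using assms unfolding Schwartz_def smooth_def rapid_def by auto

lemma Schwartz_iter_partial_rapid: "f \<in> Schwartz \<Longrightarrow> set bs \<subseteq> Basis \<Longrightarrow> rapid (iter_partial bs f)"
  unfolding Schwartz_def rapid_def by auto

lemma Schwartz_smooth: "f \<in> Schwartz \<Longrightarrow> smooth f"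
  unfolding Schwartz_def by auto

lemma rapid_sum:
  assumes "\<And>i. i \<in> I \<Longrightarrow> rapid (f i)"
  shows "rapid (\<lambda>x. \<Sum>i\<in>I. f i x)"
  unfolding rapid_def
proof
  fix N
  have "\<exists>C. \<forall>i\<in>I. \<forall>x. (1 + norm x) ^ N * norm (f i x) \<le> C i"
    using assms unfolding rapid_def by (intro bchoice) auto
  then obtain C where C: "\<And>i x. i \<in> I \<Longrightarrow> (1 + norm x) ^ N * norm (f i x) \<le> C i"
    by auto
  have "(1 + norm x) ^ N * norm (\<Sum>i\<in>I. f i x) \<le> (\<Sum>i\<in>I. C i)" for x
  proof -
    have "(1 + norm x) ^ N * norm (\<Sum>i\<in>I. f i x) \<le> (1 + norm x) ^ N * (\<Sum>i\<in>I. norm (f i x))"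
      by (intro mult_left_mono norm_sum) auto
    also have "\<dots> \<le> (\<Sum>i\<in>I. C i)"
      unfolding sum_distrib_left by (intro sum_mono C)
    finally show ?thesis .
  qed
  then show "\<exists>C. \<forall>x. (1 + norm x) ^ N * norm (\<Sum>i\<in>I. f i x) \<le> C" by blast
qed

lemma rapid_cmult:
  assumes "rapid f"
  shows "rapid (\<lambda>x. c * f x)"
  unfolding rapid_def
proof
  fix N
  obtain C where "\<And>x. (1 + norm x) ^ N * norm (f x) \<le> C"
    using assms unfolding rapid_def by metis
  then have "(1 + norm x) ^ N * norm (c * f x) \<le> norm c * C" for x
    using mult_left_mono[of "(1 + norm x) ^ N * norm (f x)" C "norm c"] by (simp add: norm_mult mult_ac)
  then show "\<exists>C. \<forall>x. (1 + norm x) ^ N * norm (c * f x) \<le> C" by blast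
qed

lemma rapid_affine:
  fixes f :: "'a::euclidean_space \<Rightarrow> complex"
  assumes f: "rapid f" and \<mu>: "0 < \<mu>"
  shows "rapid (\<lambda>x. f (\<mu> *\<^sub>R (x - c)))"
  unfolding rapid_def
proof
  fix N
  obtain C where C: "\<And>x. (1 + norm x) ^ N * norm (f x) \<le> C"
    using f unfolding rapid_def by metis
  define K where "K = (1 + norm c) * max 1 (1 / \<mu>)"
  have "(1 + norm x) ^ N * norm (f (\<mu> *\<^sub>R (x - c))) \<le> K ^ N * C" for x
  proof -
    have "1 + norm (x - c) \<le> max 1 (1 / \<mu>) * (1 + \<mu> * norm (x - c))"
    proof -
      have "norm (x - c) = (1 / \<mu>) * (\<mu> * norm (x - c))"
        using \<mu> by simp
      also have "\<dots> \<le> max 1 (1 / \<mu>) * (\<mu> * norm (x - c))"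
        using \<mu> by (intro mult_right_mono) auto
      finally show ?thesis
        by (simp add: ring_distribs)
    qed
    then have "(1 + norm c) * (1 + norm (x - c)) \<le> (1 + norm c) * (max 1 (1 / \<mu>) * (1 + \<mu> * norm (x - c)))"
      by (intro mult_left_mono) auto
    then have "1 + norm x \<le> K * (1 + \<mu> * norm (x - c))"
      using peetre[of x c] unfolding K_def by (simp add: mult.assoc)
    then have "(1 + norm x) ^ N \<le> (K * (1 + norm (\<mu> *\<^sub>R (x - c)))) ^ N"
      using \<mu> by (intro power_mono) auto
    then have "(1 + norm x) ^ N * norm (f (\<mu> *\<^sub>R (x - c)))
        \<le> K ^ N * ((1 + norm (\<mu> *\<^sub>R (x - c))) ^ N * norm (f (\<mu> *\<^sub>R (x - c))))"
      unfolding power_mult_distrib mult.assoc[symmetric] by (intro mult_right_mono) auto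
    also have "\<dots> \<le> K ^ N * C"
      using \<mu> by (intro mult_left_mono C) (auto simp: K_def)
    finally show ?thesis .
  qed
  then show "\<exists>C. \<forall>x. (1 + norm x) ^ N * norm (f (\<mu> *\<^sub>R (x - c))) \<le> C" by blast
qed

lemma iter_partial_sum:
  assumes "finite I" "\<And>i. i \<in> I \<Longrightarrow> smooth (f i)" "set bs \<subseteq> Basis"
  shows "iter_partial bs (\<lambda>x. \<Sum>i\<in>I. f i x) = (\<lambda>x. \<Sum>i\<in>I. iter_partial bs (f i) x)"
  using assms(3)
proof (induction bs)
  case (Cons b bs)
  then have b: "set bs \<subseteq> Basis" by simp
  have "((\<lambda>x. \<Sum>i\<in>I. iter_partial bs (f i) x) has_derivative
      (\<lambda>h. \<Sum>i\<in>I. frechet_derivative (iter_partial bs (f i)) (at x) h)) (at x)" for x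
    using smooth_differentiable[OF assms(2) b] by (intro has_derivative_sum) (simp add: frechet_derivative_works)
  from fun_cong[OF frechet_derivative_at[OF this], of _ b] show ?case
    by (simp add: Cons.IH[OF b] fun_eq_iff)
qed simp

lemma Schwartz_sum:
  fixes f :: "'i \<Rightarrow> 'a::euclidean_space \<Rightarrow> complex"
  assumes "finite I" "\<And>i. i \<in> I \<Longrightarrow> f i \<in> Schwartz"
  shows "(\<lambda>x. \<Sum>i\<in>I. f i x) \<in> Schwartz"
proof (rule SchwartzI)
  fix bs :: "'a list" assume bs: "set bs \<subseteq> Basis"
  have eq: "iter_partial bs (\<lambda>x. \<Sum>i\<in>I. f i x) = (\<lambda>x. \<Sum>i\<in>I. iter_partial bs (f i) x)"
    using assms bs by (intro iter_partial_sum Schwartz_smooth) auto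
  show "iter_partial bs (\<lambda>x. \<Sum>i\<in>I. f i x) differentiable_on UNIV"
    unfolding eq differentiable_on_def using smooth_differentiable[OF Schwartz_smooth[OF assms(2)] bs]
    by (auto intro!: differentiable_sum assms(1))
  show "rapid (iter_partial bs (\<lambda>x. \<Sum>i\<in>I. f i x))"
    unfolding eq by (intro rapid_sum Schwartz_iter_partial_rapid assms(2) bs)
qed

lemma iter_partial_affine:
  assumes "smooth f" "set bs \<subseteq> Basis"
  shows "iter_partial bs (\<lambda>x. f (\<mu> *\<^sub>R (x - c))) = (\<lambda>x. \<mu> ^ length bs *\<^sub>R iter_partial bs f (\<mu> *\<^sub>R (x - c)))"
  using assms(2)
proof (induction bs)
  case (Cons b bs)
  then have b: "set bs \<subseteq> Basis" by simp
  have d: "((\<lambda>x. \<mu> ^ length bs *\<^sub>R iter_partial bs f (\<mu> *\<^sub>R (x - c))) has_derivative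
      (\<lambda>h. \<mu> ^ length bs *\<^sub>R frechet_derivative (iter_partial bs f) (at (\<mu> *\<^sub>R (x - c))) (\<mu> *\<^sub>R h))) (at x)" for x
  proof (rule has_derivative_scaleR_right)
    have "(iter_partial bs f has_derivative frechet_derivative (iter_partial bs f) (at (\<mu> *\<^sub>R (x - c)))) (at (\<mu> *\<^sub>R (x - c)))"
      using smooth_differentiable[OF assms(1) b] by (simp add: frechet_derivative_works)
    moreover have "((\<lambda>x. \<mu> *\<^sub>R (x - c)) has_derivative (\<lambda>h. \<mu> *\<^sub>R h)) (at x)"
      by (auto intro!: derivative_eq_intros)
    ultimately show "((\<lambda>x. iter_partial bs f (\<mu> *\<^sub>R (x - c))) has_derivative
      (\<lambda>h. frechet_derivative (iter_partial bs f) (at (\<mu> *\<^sub>R (x - c))) (\<mu> *\<^sub>R h))) (at x)"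
      by (rule has_derivative_compose[rotated])
  qed
  have l: "frechet_derivative (iter_partial bs f) (at y) (\<mu> *\<^sub>R b) = \<mu> *\<^sub>R frechet_derivative (iter_partial bs f) (at y) b" for y
    using linear_frechet_derivative[OF smooth_differentiable[OF assms(1) b]] by (simp add: linear_scale)
  show ?case
    using fun_cong[OF frechet_derivative_at[OF d], of _ b]
    by (simp add: Cons.IH[OF b] fun_eq_iff l mult.commute)
qed simp

lemma Schwartz_affine:
  fixes f :: "'a::euclidean_space \<Rightarrow> complex"
  assumes f: "f \<in> Schwartz" and \<mu>: "0 < \<mu>"
  shows "(\<lambda>x. f (\<mu> *\<^sub>R (x - c))) \<in> Schwartz"
proof (rule SchwartzI)
  fix bs :: "'a list" assume bs: "set bs \<subseteq> Basis"
  note eq = iter_partial_affine[OF Schwartz_smooth[OF f] bs]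
  have d: "iter_partial bs f differentiable (at y)" for y
    by (rule smooth_differentiable[OF Schwartz_smooth[OF f] bs])
  have "(\<lambda>x. \<mu> ^ length bs *\<^sub>R iter_partial bs f (\<mu> *\<^sub>R (x - c))) differentiable (at x)" for x
    by (intro differentiable_scaleR differentiable_const
        differentiable_compose[of "iter_partial bs f" "\<lambda>x. \<mu> *\<^sub>R (x - c)"] d differentiable_diff differentiable_ident)
  then show "iter_partial bs (\<lambda>x. f (\<mu> *\<^sub>R (x - c))) differentiable_on UNIV"
    unfolding eq by (simp add: differentiable_on_def)
  show "rapid (iter_partial bs (\<lambda>x. f (\<mu> *\<^sub>R (x - c))))"
    unfolding eq scaleR_conv_of_real
    by (intro rapid_cmult rapid_affine Schwartz_iter_partial_rapid f bs \<mu>)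
qed

section \<open>Vanishing moments from a spectral gap at the origin\<close>

lemma norm_character_diff_le: "norm (character x \<xi> - character x \<zeta>) \<le> 2 * pi * \<bar>x \<bullet> (\<xi> - \<zeta>)\<bar>"
proof -
  have "character x \<xi> = character x \<zeta> * character x (\<xi> - \<zeta>)"
    using character_add[of \<zeta> "\<xi> - \<zeta>" x] by (simp add: character_commute)
  then have "norm (character x \<xi> - character x \<zeta>) = norm (character x \<zeta> * (character x (\<xi> - \<zeta>) - 1))"
    by (simp add: ring_distribs)
  also have "\<dots> = norm (character x (\<xi> - \<zeta>) - 1)"
    by (simp add: norm_mult)
  also have "\<dots> \<le> \<bar>2 * pi * (x \<bullet> (\<xi> - \<zeta>))\<bar>"
    using iexp_approx1[of "2 * pi * (x \<bullet> (\<xi> - \<zeta>))" 0] by (simp add: character_def cis_conv_exp)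
  finally show ?thesis by (simp add: abs_mult)
qed

text \<open>Each list element corresponds to one derivative of the Fourier transform, so induction
  on the list is induction on the order of differentiation.\<close>

definition monom_fn :: "'a::euclidean_space list \<Rightarrow> 'a \<Rightarrow> complex" where
  "monom_fn bs x = (\<Prod>b\<leftarrow>bs. complex_of_real (x \<bullet> b))"

lemma norm_monom_fn_le: "set bs \<subseteq> Basis \<Longrightarrow> norm (monom_fn bs x) \<le> (1 + norm x) ^ length bs"
proof (induction bs)
  case (Cons b bs)
  have "\<bar>x \<bullet> b\<bar> \<le> 1 + norm x"
    using Cons.prems Basis_le_norm[of b x] by simp
  then show ?case
    using Cons unfolding monom_fn_def by (auto simp: norm_mult intro!: mult_mono)
qed (simp add: monom_fn_def)

lemma borel_measurable_monom_fn [measurable]: "monom_fn bs \<in> borel_measurable borel"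
proof (induction bs)
  case (Cons b bs)
  have "monom_fn (b # bs) = (\<lambda>x. complex_of_real (x \<bullet> b) * monom_fn bs x)"
    by (simp add: monom_fn_def fun_eq_iff)
  then show ?case using Cons.IH by simp
qed (simp add: monom_fn_def[abs_def])

lemma rapid_monom_fn_mult:
  assumes f: "rapid f" and "set bs \<subseteq> Basis"
  shows "rapid (\<lambda>x. monom_fn bs x * f x)"
  unfolding rapid_def
proof
  fix N
  obtain C where C: "\<And>x. (1 + norm x) ^ (N + length bs) * norm (f x) \<le> C"
    using f unfolding rapid_def by metis
  have "(1 + norm x) ^ N * norm (monom_fn bs x * f x) \<le> C" for x
  proof -
    have "(1 + norm x) ^ N * norm (monom_fn bs x * f x)
       \<le> (1 + norm x) ^ N * ((1 + norm x) ^ length bs * norm (f x))"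
      unfolding norm_mult using norm_monom_fn_le[OF assms(2)]
      by (intro mult_left_mono mult_right_mono) auto
    also have "\<dots> \<le> C"
      using C[of x] by (simp add: power_add mult_ac)
    finally show ?thesis .
  qed
  then show "\<exists>C. \<forall>x. (1 + norm x) ^ N * norm (monom_fn bs x * f x) \<le> C" by blast
qed

text \<open>Multiplication by a coordinate is, up to a constant, differentiation on the Fourier
  side, and derivatives of a function vanishing on an open ball vanish there. Each induction step
  realises one derivative as a limit of difference quotients, dominated through the Lipschitz bound
  for characters.\<close>

lemma fourier_monom_fn_eq_zero:
  fixes f :: "'a::euclidean_space \<Rightarrow> complex"
  assumes f: "rapid f" and [measurable]: "f \<in> borel_measurable borel"
    and zero: "\<And>\<xi>. norm \<xi> < \<epsilon> \<Longrightarrow> fourier f \<xi> = 0"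
  shows "set bs \<subseteq> Basis \<Longrightarrow> norm \<xi> < \<epsilon> \<Longrightarrow> fourier (\<lambda>x. monom_fn bs x * f x) \<xi> = 0"
proof (induction bs arbitrary: \<xi>)
  case (Cons b bs)
  define g where "g x = monom_fn bs x * f x" for x
  have b: "set bs \<subseteq> Basis" "b \<in> Basis" using Cons.prems by auto
  have [measurable]: "g \<in> borel_measurable borel"
    unfolding g_def[abs_def] by measurable
  have g: "integrable lborel g"
    using rapid_monom_fn_mult[OF f b(1)] unfolding g_def[abs_def] by (intro integrable_rapid) auto
  have bg: "(\<lambda>x. complex_of_real (x \<bullet> b) * g x) = (\<lambda>x. monom_fn (b # bs) x * f x)"
    by (simp add: g_def monom_fn_def fun_eq_iff)
  have ig: "integrable lborel (\<lambda>x. complex_of_real (x \<bullet> b) * g x)"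
    unfolding bg using rapid_monom_fn_mult[OF f Cons.prems(1)] by (intro integrable_rapid) auto
  define t where "t n = 1 / real (Suc n)" for n
  have t: "0 < t n" for n by (simp add: t_def)
  let ?q = "\<lambda>n x. real (Suc n) *\<^sub>R (character (- x) (\<xi> + t n *\<^sub>R b) - character (- x) \<xi>)"
  have "(\<lambda>n. LINT x|lborel. g x * ?q n x)
     \<longlonglongrightarrow> (LINT x|lborel. g x * (complex_of_real (2 * pi * ((- x) \<bullet> b)) * \<i> * character (- x) \<xi>))"
  proof (rule integral_dominated_convergence[where w="\<lambda>x. 2 * pi * norm (complex_of_real (x \<bullet> b) * g x)"])
    show "AE x in lborel. (\<lambda>n. g x * ?q n x)
        \<longlonglongrightarrow> g x * (complex_of_real (2 * pi * ((- x) \<bullet> b)) * \<i> * character (- x) \<xi>)"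
      unfolding t_def
      by (intro AE_I2 tendsto_mult tendsto_const difference_quotient_LIMSEQ[OF character_has_derivative])
    show "integrable lborel (\<lambda>x. 2 * pi * norm (complex_of_real (x \<bullet> b) * g x))"
      by (intro integrable_mult_right integrable_norm ig)
    show "AE x in lborel. norm (g x * ?q n x) \<le> 2 * pi * norm (complex_of_real (x \<bullet> b) * g x)" for n
    proof (intro AE_I2)
      fix x
      have "norm (?q n x) \<le> real (Suc n) * (2 * pi * \<bar>(- x) \<bullet> (t n *\<^sub>R b)\<bar>)"
        unfolding norm_scaleR using norm_character_diff_le[of "- x" "\<xi> + t n *\<^sub>R b" \<xi>]
        by (intro mult_mono) auto
      also have "\<dots> = 2 * pi * \<bar>x \<bullet> b\<bar>"
        by (simp add: t_def abs_mult)
      finally have "norm (g x) * norm (?q n x) \<le> norm (g x) * (2 * pi * \<bar>x \<bullet> b\<bar>)"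
        by (intro mult_left_mono) auto
      then show "norm (g x * ?q n x) \<le> 2 * pi * norm (complex_of_real (x \<bullet> b) * g x)"
        unfolding norm_mult by (simp add: mult_ac)
    qed
  qed auto
  \<comment> \<open>The ball is open: for large \<open>n\<close> the shifted frequency still lies in
    it, and both terms of the quotient vanish by induction.\<close>
  moreover have "eventually (\<lambda>n. (LINT x|lborel. g x * ?q n x) = 0) sequentially"
  proof -
    have "t \<longlonglongrightarrow> 0"
      unfolding t_def by (rule LIMSEQ_Suc[OF lim_1_over_n])
    then have "(\<lambda>n. norm (\<xi> + t n *\<^sub>R b)) \<longlonglongrightarrow> norm (\<xi> + 0 *\<^sub>R b)"
      by (intro tendsto_intros)
    then have "eventually (\<lambda>n. norm (\<xi> + t n *\<^sub>R b) < \<epsilon>) sequentially"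
      using Cons.prems(2) by (intro order_tendstoD) auto
    then show ?thesis
    proof eventually_elim
      case (elim n)
      have i: "integrable lborel (\<lambda>x. g x * character (- x) \<zeta>)" for \<zeta>
        by (intro integrable_mult_character g) auto
      have "(LINT x|lborel. g x * ?q n x) = real (Suc n) *\<^sub>R
          ((LINT x|lborel. g x * character (- x) (\<xi> + t n *\<^sub>R b)) - (LINT x|lborel. g x * character (- x) \<xi>))"
        by (simp add: right_diff_distrib i del: of_nat_Suc)
      also have "\<dots> = 0"
        using Cons.IH[OF b(1) elim] Cons.IH[OF b(1) Cons.prems(2)]
        unfolding g_def[symmetric] fourier_eq by simp
      finally show ?case .
    qed
  qed
  ultimately have "(LINT x|lborel. g x * (complex_of_real (2 * pi * ((- x) \<bullet> b)) * \<i> * character (- x) \<xi>)) = 0"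
    by (rule LIMSEQ_unique[OF _ tendsto_eventually])
  also have "(\<lambda>x. g x * (complex_of_real (2 * pi * ((- x) \<bullet> b)) * \<i> * character (- x) \<xi>))
      = (\<lambda>x. (- 2 * pi * \<i>) * ((complex_of_real (x \<bullet> b) * g x) * character (- x) \<xi>))"
    by (simp add: fun_eq_iff)
  finally show ?case
    unfolding fourier_eq bg[symmetric] by simp
qed (simp add: monom_fn_def zero)

text \<open>A moment is the Fourier transform at 0 of a monomial times \<open>f\<close>.\<close>

lemma S_infinityI:
  fixes f :: "'a::euclidean_space \<Rightarrow> complex"
  assumes f: "f \<in> Schwartz" and \<epsilon>: "0 < \<epsilon>" and zero: "\<And>\<xi>. norm \<xi> < \<epsilon> \<Longrightarrow> fourier f \<xi> = 0"
  shows "f \<in> S_infinity"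
proof -
  have "(LINT x|lborel. complex_of_real (\<Prod>b\<in>Basis. (x \<bullet> b) ^ \<alpha> b) * f x) = 0" for \<alpha> :: "'a \<Rightarrow> nat"
  proof -
    \<comment> \<open>Turns the exponents \<open>\<alpha>\<close> into a list, one coordinate at a
      time.\<close>
    have "\<exists>bs. set bs \<subseteq> B \<and> (\<forall>x. complex_of_real (\<Prod>b\<in>B. (x \<bullet> b) ^ \<alpha> b) = monom_fn bs x)"
      if "finite B" for B :: "'a set"
      using that
    proof (induction B)
      case empty
      show ?case by (rule exI[of _ "[]"]) (simp add: monom_fn_def)
    next
      case (insert b B)
      then obtain bs where bs: "set bs \<subseteq> B" "\<And>x. complex_of_real (\<Prod>b\<in>B. (x \<bullet> b) ^ \<alpha> b) = monom_fn bs x"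
        by auto
      have "complex_of_real ((x \<bullet> b) ^ n) = monom_fn (replicate n b) x" for n x
        by (induction n) (simp_all add: monom_fn_def)
      then have "complex_of_real (\<Prod>b\<in>insert b B. (x \<bullet> b) ^ \<alpha> b) = monom_fn (replicate (\<alpha> b) b @ bs) x" for x
        using insert.hyps bs(2)[of x] by (simp add: monom_fn_def)
      then show ?case
        using bs(1) by (intro exI[of _ "replicate (\<alpha> b) b @ bs"]) auto
    qed
    from this[OF finite_Basis] obtain bs where bs: "set bs \<subseteq> (Basis::'a set)"
      "\<And>x. complex_of_real (\<Prod>b\<in>Basis. (x \<bullet> b) ^ \<alpha> b) = monom_fn bs x" by auto
    have "fourier (\<lambda>x. monom_fn bs x * f x) 0 = 0"
      by (rule fourier_monom_fn_eq_zero[OF Schwartz_rapid[OF f] Schwartz_borel_measurable[OF f] zero bs(1)])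
        (use \<epsilon> in auto)
    then show ?thesis
      unfolding bs(2) by (simp add: fourier_eq)
  qed
  then show ?thesis
    using f by (simp add: S_infinity_def)
qed

section \<open>The logarithmic weight\<close>

text \<open>This is \<open>W\<close> to the power \<open>-r\<close>. Keeping \<open>r\<close> out of
  it makes slow variation and divergence statements about one function, to which
  \<open>weight\<close> only adds an outer power.\<close>

definition logweight :: "real \<Rightarrow> 'a::euclidean_space \<Rightarrow> real" where
  "logweight \<delta> x = (1 + \<delta> * norm x) ^ DIM('a) * (1 + ln (1 + \<delta> * norm x))"

lemma logweight_ge_1: "0 \<le> \<delta> \<Longrightarrow> 1 \<le> logweight \<delta> x"
  unfolding logweight_def using mult_mono[of 1 "(1 + \<delta> * norm x) ^ DIM('a)" 1 "1 + ln (1 + \<delta> * norm x)"]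
  by (simp add: one_le_power)

lemma borel_measurable_logweight [measurable]: "logweight \<delta> \<in> borel_measurable borel"
  unfolding logweight_def[abs_def] by measurable

text \<open>Slow variation. With \<open>a\<close>, \<open>b\<close>, \<open>c\<close> the values of
  \<open>1 + \<delta> |.|\<close> at \<open>x\<close>, \<open>y\<close>, \<open>x - y\<close>, one
  has \<open>a \<le> b * c\<close>. Since \<open>1 + ln\<close> is submultiplicative on arguments at
  least 1 and \<open>1 + ln c \<le> c\<close>, the logarithm costs a single extra power of
  \<open>c\<close>.\<close>

lemma logweight_le:
  fixes x y :: "'a::euclidean_space"
  assumes "0 \<le> \<delta>"
  shows "logweight \<delta> x \<le> logweight \<delta> y * (1 + \<delta> * norm (x - y)) ^ (DIM('a) + 1)"
proof -
  define a b c where "a = 1 + \<delta> * norm x" and "b = 1 + \<delta> * norm y" and "c = 1 + \<delta> * norm (x - y)"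
  have ge: "1 \<le> a" "1 \<le> b" "1 \<le> c"
    using assms by (auto simp: a_def b_def c_def)
  have "1 + norm (\<delta> *\<^sub>R x) \<le> (1 + norm (\<delta> *\<^sub>R y)) * (1 + norm (\<delta> *\<^sub>R x - \<delta> *\<^sub>R y))"
    by (rule peetre)
  then have abc: "a \<le> b * c"
    using assms unfolding a_def b_def c_def scaleR_diff_right[symmetric] by simp
  have "ln a \<le> ln (b * c)"
    using abc ge by (intro ln_mono) auto
  then have "ln a \<le> ln b + ln c"
    using ge by (subst (asm) ln_mult) auto
  moreover have "0 \<le> ln b * ln c"
    using ge by simp
  ultimately have "1 + ln a \<le> (1 + ln b) * (1 + ln c)"
    by (simp add: algebra_simps)
  also have "\<dots> \<le> (1 + ln b) * c"
    using ge ln_add_one_self_le_self2[of "c - 1"] by (intro mult_left_mono) auto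
  finally have "a ^ DIM('a) * (1 + ln a) \<le> (b * c) ^ DIM('a) * ((1 + ln b) * c)"
    using abc ge by (intro mult_mono power_mono) auto
  then show ?thesis
    unfolding logweight_def a_def[symmetric] b_def[symmetric] c_def[symmetric]
    by (simp add: power_mult_distrib mult_ac)
qed

text \<open>The same two estimates, with the dilation factor \<open>\<Lambda>\<close> in the place
  of \<open>c\<close>.\<close>

lemma logweight_scale_le:
  fixes x :: "'a::euclidean_space"
  assumes "0 \<le> \<delta>" and "1 \<le> \<Lambda>" and "\<bar>\<kappa>\<bar> \<le> \<Lambda>"
  shows "logweight \<delta> (\<kappa> *\<^sub>R x) \<le> \<Lambda> ^ (DIM('a) + 1) * logweight \<delta> x"
proof -
  define a b where "a = 1 + \<delta> * norm (\<kappa> *\<^sub>R x)" and "b = 1 + \<delta> * norm x"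
  have ge: "1 \<le> a" "1 \<le> b"
    using assms by (auto simp: a_def b_def)
  have "\<delta> * (\<bar>\<kappa>\<bar> * norm x) \<le> \<delta> * (\<Lambda> * norm x)"
    using assms by (intro mult_left_mono mult_right_mono) auto
  then have ab: "a \<le> \<Lambda> * b"
    using assms by (simp add: a_def b_def algebra_simps)
  have "ln a \<le> ln (\<Lambda> * b)"
    using ab ge assms by (intro ln_mono) auto
  then have "ln a \<le> ln \<Lambda> + ln b"
    using ge assms by (subst (asm) ln_mult) auto
  moreover have "0 \<le> ln \<Lambda> * ln b"
    using ge assms by simp
  ultimately have "1 + ln a \<le> (1 + ln \<Lambda>) * (1 + ln b)"
    by (simp add: algebra_simps)
  also have "\<dots> \<le> \<Lambda> * (1 + ln b)"
    using ge assms ln_add_one_self_le_self2[of "\<Lambda> - 1"] by (intro mult_right_mono) auto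
  finally have "a ^ DIM('a) * (1 + ln a) \<le> (\<Lambda> * b) ^ DIM('a) * (\<Lambda> * (1 + ln b))"
    using ab ge by (intro mult_mono power_mono) auto
  then show ?thesis
    unfolding logweight_def a_def[symmetric] b_def[symmetric]
    by (simp add: power_mult_distrib mult_ac)
qed

definition weight :: "real \<Rightarrow> real \<Rightarrow> 'a::euclidean_space \<Rightarrow> real" where
  "weight r \<delta> x = logweight \<delta> x powr (- 1 / r)"

lemma weight_pos: "0 \<le> \<delta> \<Longrightarrow> 0 < weight r \<delta> x"
  unfolding weight_def using logweight_ge_1[of \<delta> x] by simp

lemma borel_measurable_weight [measurable]: "weight r \<delta> \<in> borel_measurable borel"
  unfolding weight_def[abs_def] by measurable

text \<open>Passes a comparison of \<open>logweight\<close> to the power \<open>-1/r\<close>, which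
  reverses it. The exponent \<open>(d + 1)/r\<close> is rounded up to a natural number
  \<open>B\<close> so that later bounds are ordinary powers.\<close>

lemma weight_antimono:
  assumes r: "0 < r" and \<delta>: "0 \<le> \<delta>" and K: "0 \<le> K" and le: "logweight \<delta> x \<le> K ^ (DIM('a::euclidean_space) + 1) * logweight \<delta>' (y :: 'a)"
    and B: "(real DIM('a) + 1) / r \<le> real B" and "1 \<le> K" and \<delta>': "0 \<le> \<delta>'"
  shows "weight r \<delta>' y \<le> K ^ B * weight r \<delta> (x :: 'a)"
proof -
  have "(logweight \<delta> x) powr (1 / r) \<le> (K ^ (DIM('a) + 1) * logweight \<delta>' y) powr (1 / r)"
    using r logweight_ge_1[OF \<delta>, of x] by (intro powr_mono2 le) auto
  also have "\<dots> = K powr ((real DIM('a) + 1) / r) * logweight \<delta>' y powr (1 / r)"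
    using \<open>1 \<le> K\<close> logweight_ge_1[OF \<delta>', of y]
    by (simp add: powr_mult powr_realpow[symmetric] powr_powr add.commute del: power_Suc)
  also have "\<dots> \<le> K powr (real B) * logweight \<delta>' y powr (1 / r)"
    using \<open>1 \<le> K\<close> B by (intro mult_right_mono powr_mono) auto
  also have "K powr (real B) = K ^ B"
    using \<open>1 \<le> K\<close> by (simp add: powr_realpow)
  finally show ?thesis
    using logweight_ge_1[OF \<delta>, of x] logweight_ge_1[OF \<delta>', of y]
    unfolding weight_def by (simp add: powr_minus field_simps)
qed

lemma weight_le:
  fixes x y :: "'a::euclidean_space"
  assumes "0 < r" "0 \<le> \<delta>" "(real DIM('a) + 1) / r \<le> real B"
  shows "weight r \<delta> y \<le> (1 + \<delta> * norm (x - y)) ^ B * weight r \<delta> x"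
  using logweight_le[OF assms(2), of x y] assms
  by (intro weight_antimono) (auto simp: mult.commute)

lemma weight_le_scale:
  fixes y :: "'a::euclidean_space"
  assumes "0 < r" "0 \<le> \<delta>" "(real DIM('a) + 1) / r \<le> real B" "1 \<le> \<Lambda>" "\<bar>\<kappa>\<bar> \<le> \<Lambda>"
  shows "weight r \<delta> y \<le> \<Lambda> ^ B * weight r \<delta> (\<kappa> *\<^sub>R y)"
  using logweight_scale_le[OF assms(2,4,5), of y] assms
  by (intro weight_antimono) auto

text \<open>Dropping the logarithm leaves decay of order \<open>d/r\<close>, and
  \<open>d/r > d\<close> because \<open>r < 1\<close>.\<close>

lemma integrable_weight:
  assumes r: "0 < r" "r < 1" and \<delta>: "0 < \<delta>"
  shows "integrable lborel (weight r \<delta> :: 'a::euclidean_space \<Rightarrow> real)"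
proof -
  let ?D = "real DIM('a) / r"
  have D: "real DIM('a) < ?D"
    using r by (simp add: field_simps)
  have "integrable lborel (\<lambda>x::'a. decay ?D (0 + \<delta> *\<^sub>R x))"
    using integrable_lborel_affine[OF integrable_decay[OF D], of \<delta> 0] \<delta> by simp
  then show ?thesis
  proof (rule Bochner_Integration.integrable_bound)
    have "weight r \<delta> x \<le> (1 + \<delta> * norm x) powr (- ?D)" for x :: 'a
    proof -
      have "(1 + \<delta> * norm x) ^ DIM('a) \<le> logweight \<delta> x"
        unfolding logweight_def using \<delta>
          mult_left_mono[of 1 "1 + ln (1 + \<delta> * norm x)" "(1 + \<delta> * norm x) ^ DIM('a)"] by simp
      then have "weight r \<delta> x \<le> ((1 + \<delta> * norm x) ^ DIM('a)) powr (- 1 / r)"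
        unfolding weight_def using r \<delta> by (intro powr_mono2') (auto intro!: zero_less_power add_pos_nonneg)
      also have "\<dots> = (1 + \<delta> * norm x) powr (- ?D)"
        using \<delta> by (simp add: powr_realpow[symmetric] powr_powr add_pos_nonneg)
      finally show ?thesis .
    qed
    then show "AE x::'a in lborel. norm (weight r \<delta> x) \<le> norm (decay ?D (0 + \<delta> *\<^sub>R x))"
      using \<delta> less_imp_le[OF weight_pos[of \<delta> r "x :: 'a" for x]] by (intro AE_I2) simp
  qed simp
qed

text \<open>Shell \<open>k\<close> has volume at least a constant times \<open>2^(kd)\<close>, while
  \<open>logweight\<close> there is at most a constant times \<open>2^(kd) (k + 3)\<close>: the
  integral dominates a harmonic series. Both counterexamples draw their divergence from
  here.\<close>

lemma nn_integral_inverse_logweight: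
  assumes \<delta>: "0 \<le> \<delta>" "\<delta> \<le> 1"
  shows "(\<integral>\<^sup>+x. ennreal (inverse (logweight \<delta> (x :: 'a::euclidean_space))) \<partial>lborel) = \<infinity>"
proof -
  let ?d = "DIM('a)" and ?v = "unit_ball_vol (real DIM('a))"
  have v: "0 < ?v" by (simp add: unit_ball_vol_pos)
  let ?c = "?v * (1 / 4) ^ ?d"
  have b: "ennreal (?c * inverse (real (k + 3)))
      \<le> (\<integral>\<^sup>+x\<in>herz_shell k. ennreal (inverse (logweight \<delta> x)) \<partial>(lborel :: 'a measure))" for k
  proof -
    \<comment> \<open>\<open>\<delta> \<le> 1\<close> gives
      \<open>1 + \<delta> |x| \<le> 2^(k+2)\<close> on the shell, hence a logarithm of at most
      \<open>k + 2\<close>.\<close>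
    have L: "logweight \<delta> x \<le> (2 ^ (k + 2)) ^ ?d * real (k + 3)" if "x \<in> herz_shell k" for x :: 'a
    proof -
      have "\<delta> * norm x \<le> 1 * 2 ^ (k + 1)"
        using \<delta> herz_shell_bounds(2)[OF that] by (intro mult_mono) auto
      moreover have "(1::real) \<le> 2 ^ (k + 1)"
        by (rule one_le_power) simp
      ultimately have 1: "1 + \<delta> * norm x \<le> 2 ^ (k + 2)"
        by simp
      then have "ln (1 + \<delta> * norm x) \<le> ln (2 ^ (k + 2))"
        using \<delta> by (intro ln_mono) (auto intro!: add_pos_nonneg)
      also have "\<dots> = real (k + 2) * ln 2"
        by (subst ln_realpow) auto
      also have "\<dots> \<le> real (k + 2) * 1"
        using ln_2_less_1 by (intro mult_left_mono) auto
      finally have "1 + ln (1 + \<delta> * norm x) \<le> real (k + 3)" by simp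
      with 1 show ?thesis
        unfolding logweight_def using \<delta> by (intro mult_mono power_mono) auto
    qed
    have vol: "ennreal (?v * 2 ^ (k * ?d)) \<le> emeasure lborel (herz_shell k :: 'a set)"
    proof (cases "k = 0")
      case True
      have "(herz_shell 0 :: 'a set) = cball 0 2"
        by (auto simp: herz_shell_def)
      moreover have "?v * 1 \<le> ?v * 2 ^ ?d"
        using v by (intro mult_left_mono one_le_power) auto
      ultimately show ?thesis
        using True by (simp add: emeasure_cball ennreal_leI)
    next
      case False
      then have "(herz_shell k :: 'a set) = cball 0 (2 ^ (k + 1)) - cball 0 (2 ^ k)"
        by (auto simp: herz_shell_def)
      moreover have "emeasure lborel (cball (0::'a) (2 ^ (k + 1)) - cball 0 (2 ^ k))
          = emeasure lborel (cball (0::'a) (2 ^ (k + 1))) - emeasure lborel (cball (0::'a) (2 ^ k))"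
      proof (rule emeasure_Diff)
        show "cball (0::'a) (2 ^ k) \<subseteq> cball 0 (2 ^ (k + 1))"
          by (rule subset_cball) simp
        show "emeasure lborel (cball (0::'a) (2 ^ k)) \<noteq> \<infinity>"
          by (subst emeasure_cball) auto
      qed auto
      ultimately have "emeasure lborel (herz_shell k :: 'a set)
          = emeasure lborel (cball (0::'a) (2 ^ (k + 1))) - emeasure lborel (cball (0::'a) (2 ^ k))"
        by simp
      also have "\<dots> = ennreal (?v * (2 ^ (k + 1)) ^ ?d - ?v * (2 ^ k) ^ ?d)"
        using v by (simp add: emeasure_cball ennreal_minus del: power_Suc)
      also have "\<dots> \<ge> ennreal (?v * 2 ^ (k * ?d))"
      proof (rule ennreal_leI)
        have "(2::real) * 2 ^ (k * ?d) \<le> 2 ^ ?d * 2 ^ (k * ?d)"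
          using self_le_power[of "2::real" ?d] by (intro mult_right_mono) auto
        also have "\<dots> = (2 ^ (k + 1)) ^ ?d"
          by (simp add: power_mult power_mult_distrib)
        finally have "(2::real) ^ (k * ?d) \<le> (2 ^ (k + 1)) ^ ?d - (2 ^ k) ^ ?d"
          by (simp add: power_mult)
        then show "?v * 2 ^ (k * ?d) \<le> ?v * (2 ^ (k + 1)) ^ ?d - ?v * (2 ^ k) ^ ?d"
          using v by (simp add: right_diff_distrib[symmetric] del: power_Suc)
      qed
      finally show ?thesis .
    qed
    let ?e = "inverse ((2 ^ (k + 2)) ^ ?d * real (k + 3))"
    have "?c * inverse (real (k + 3)) = ?e * (?v * 2 ^ (k * ?d))"
    proof -
      have "(2 ^ (k + 2)) ^ ?d = (4::real) ^ ?d * 2 ^ (k * ?d)"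
        by (simp add: power_mult power_mult_distrib)
      note e = this
      define p q j where "p = (4::real) ^ ?d" and "q = (2::real) ^ (k * ?d)" and "j = real (k + 3)"
      have "p \<noteq> 0" "q \<noteq> 0" "j \<noteq> 0"
        by (auto simp: p_def q_def j_def)
      then have "?v * (1 / p) * inverse j = inverse (p * q * j) * (?v * q)"
        by (simp add: field_simps)
      then show ?thesis
        unfolding e p_def q_def j_def by (simp add: power_one_over)
    qed
    then have "ennreal (?c * inverse (real (k + 3))) = ennreal ?e * ennreal (?v * 2 ^ (k * ?d))"
      using v by (subst ennreal_mult[symmetric]) auto
    also have "\<dots> \<le> ennreal ?e * emeasure lborel (herz_shell k :: 'a set)"
      by (intro mult_left_mono vol) auto
    also have "\<dots> = (\<integral>\<^sup>+x\<in>herz_shell k. ennreal ?e \<partial>(lborel :: 'a measure))"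
      by (subst nn_integral_cmult_indicator) auto
    also have "\<dots> \<le> (\<integral>\<^sup>+x\<in>herz_shell k. ennreal (inverse (logweight \<delta> x)) \<partial>(lborel :: 'a measure))"
    proof (intro nn_integral_mono)
      fix x :: 'a
      have "?e \<le> inverse (logweight \<delta> x)" if "x \<in> herz_shell k"
        using logweight_ge_1[OF \<delta>(1), of x] by (intro le_imp_inverse_le L that) linarith
      then show "ennreal ?e * indicator (herz_shell k) x
          \<le> ennreal (inverse (logweight \<delta> x)) * indicator (herz_shell k) x"
        unfolding indicator_def by (simp add: ennreal_leI del: inverse_mult_distrib)
    qed
    finally show ?thesis .
  qed
  have inf: "(\<Sum>k. ennreal (?c * inverse (real (k + 3)))) = \<infinity>"
  proof (rule ccontr)
    assume "(\<Sum>k. ennreal (?c * inverse (real (k + 3)))) \<noteq> \<infinity>"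
    then have fin: "(\<Sum>k. ennreal (?c * inverse (real (k + 3)))) \<noteq> top"
      unfolding infinity_ennreal_def .
    have "0 \<le> ?c * inverse (real (k + 3))" for k
      using v by (intro mult_nonneg_nonneg) (auto simp del: of_nat_add)
    then have "summable (\<lambda>k. ?c * inverse (real (k + 3)))"
      using fin by (rule summable_suminf_not_top)
    moreover have "?c \<noteq> 0"
      using v by (metis mult_pos_pos order_less_irrefl zero_less_divide_1_iff zero_less_numeral zero_less_power)
    ultimately have "summable (\<lambda>k. inverse (real (k + 3)))"
      by (simp only: summable_cmult_iff simp_thms)
    then have "summable (\<lambda>k. inverse (real k))"
      by (subst (asm) summable_iff_shift)
    then show False
      using not_summable_harmonic[where 'a=real] by (simp add: inverse_eq_divide)
  qed
  have "(\<Sum>k. ennreal (?c * inverse (real (k + 3))))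
      \<le> (\<Sum>k. \<integral>\<^sup>+x\<in>herz_shell k. ennreal (inverse (logweight \<delta> x)) \<partial>(lborel :: 'a measure))"
    by (intro suminf_le b summableI)
  also have "\<dots> = (\<integral>\<^sup>+x. ennreal (inverse (logweight \<delta> (x :: 'a))) \<partial>lborel)"
    by (rule nn_integral_herz_shells[symmetric]) measurable
  finally show ?thesis
    unfolding inf by (simp only: infinity_ennreal_def top_unique)
qed

lemma weight_powr_r:
  assumes "0 < r" "0 \<le> \<delta>"
  shows "weight r \<delta> x powr r = inverse (logweight \<delta> x)"
  using logweight_ge_1[OF assms(2), of x] assms
  by (simp only: weight_def powr_powr) (simp add: powr_minus)

text \<open>Averaging a slowly varying weight against a rapidly decreasing kernel returns at most a
  multiple of it. The weight is first compared at \<open>y\<close> and \<open>\<kappa> y\<close>,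
  then moved from \<open>\<kappa> y\<close> to \<open>x\<close>, and the kernel absorbs the
  polynomial loss.\<close>

lemma weight_convolution_bound:
  fixes w h :: "'a::euclidean_space \<Rightarrow> complex"
  assumes r: "0 < r" and \<delta>: "0 \<le> \<delta>" "\<delta> \<le> 1" and w: "\<And>y. norm (w y) = weight r \<delta> y"
    and h: "rapid h" and \<kappa>: "\<kappa> \<noteq> 0"
  shows "\<exists>C>0. \<forall>x. norm (LINT y|lborel. w y * h (x - \<kappa> *\<^sub>R y)) \<le> C * weight r \<delta> x"
proof -
  obtain B where B: "(real DIM('a) + 1) / r \<le> real B"
    using real_arch_simple by blast
  let ?N = "DIM('a) + 1"
  obtain C where C: "0 < C" "\<And>x. norm (h x) \<le> C * inverse ((1 + norm x) ^ (B + ?N))"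
    using rapidE[OF h] by metis
  define \<Lambda> where "\<Lambda> = max 1 \<bar>\<kappa>\<bar>"
  have \<Lambda>: "1 \<le> \<Lambda>" "\<bar>\<kappa>\<bar> \<le> \<Lambda>" by (auto simp: \<Lambda>_def)
  define J where "J = (LINT y|lborel. inverse ((1 + norm (y::'a)) ^ ?N))"
  have i: "integrable lborel (\<lambda>y::'a. inverse ((1 + norm y) ^ ?N))"
    by (rule integrable_inverse_power) simp
  have J0: "0 \<le> J"
    unfolding J_def by (intro integral_nonneg_AE AE_I2) (auto intro!: zero_le_power)
  let ?K = "\<Lambda> ^ B * C * (1 / \<bar>\<kappa>\<bar> ^ DIM('a) * J)"
  have "norm (LINT y|lborel. w y * h (x - \<kappa> *\<^sub>R y)) \<le> ?K * weight r \<delta> x" for x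
  proof -
    have le: "norm (w y * h (x - \<kappa> *\<^sub>R y))
        \<le> (\<Lambda> ^ B * C * weight r \<delta> x) * inverse ((1 + norm (x + (- \<kappa>) *\<^sub>R y)) ^ ?N)" for y
    proof -
      let ?n = "1 + norm (x - \<kappa> *\<^sub>R y)"
      have n: "1 \<le> ?n" by simp
      have "weight r \<delta> y \<le> \<Lambda> ^ B * weight r \<delta> (\<kappa> *\<^sub>R y)"
        by (rule weight_le_scale[OF r \<delta>(1) B \<Lambda>])
      also have "\<dots> \<le> \<Lambda> ^ B * ((1 + \<delta> * norm (x - \<kappa> *\<^sub>R y)) ^ B * weight r \<delta> x)"
        using \<Lambda> by (intro mult_left_mono weight_le[OF r \<delta>(1) B]) auto
      also have "\<dots> \<le> \<Lambda> ^ B * (?n ^ B * weight r \<delta> x)"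
        using \<Lambda> \<delta> less_imp_le[OF weight_pos[OF \<delta>(1)]]
        by (intro mult_left_mono mult_right_mono power_mono) (auto simp: mult_left_le_one_le)
      finally have "norm (w y * h (x - \<kappa> *\<^sub>R y))
        \<le> (\<Lambda> ^ B * (?n ^ B * weight r \<delta> x)) * (C * inverse (?n ^ (B + ?N)))"
        unfolding norm_mult w using \<Lambda> C less_imp_le[OF weight_pos[OF \<delta>(1)]]
        by (intro mult_mono) (auto intro!: mult_nonneg_nonneg)
      also have "\<dots> = (\<Lambda> ^ B * C * weight r \<delta> x) * inverse (?n ^ ?N)"
      proof -
        define n where "n = ?n"
        have "n \<noteq> 0" using n unfolding n_def by linarith
        then show ?thesis
          unfolding n_def[symmetric] power_add by (simp add: field_simps)
      qed
      finally show ?thesis by simp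
    qed
    have "norm (LINT y|lborel. w y * h (x - \<kappa> *\<^sub>R y))
       \<le> (LINT y|lborel. (\<Lambda> ^ B * C * weight r \<delta> x) * inverse ((1 + norm (x + (- \<kappa>) *\<^sub>R y)) ^ ?N))"
      using \<kappa> by (intro norm_integral_le[OF _ le] integrable_mult_right integrable_lborel_affine[OF i]) auto
    also have "\<dots> = (\<Lambda> ^ B * C * weight r \<delta> x) * (1 / \<bar>\<kappa>\<bar> ^ DIM('a) * J)"
      using integral_lborel_affine[OF i, of "- \<kappa>" x] \<kappa> unfolding J_def
      by (simp del: power_Suc add: divide_inverse)
    finally show ?thesis by (simp add: mult_ac)
  qed
  \<comment> \<open>Adding 1 makes the constant strictly positive, as only \<open>0 \<le> J\<close>
    is known.\<close>
  then have "norm (LINT y|lborel. w y * h (x - \<kappa> *\<^sub>R y)) \<le> (?K + 1) * weight r \<delta> x" for x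
    using less_imp_le[OF weight_pos[OF \<delta>(1), of r x]] by (simp add: ring_distribs add_increasing2)
  moreover have "0 < ?K + 1"
    using \<Lambda> C J0 by (intro add_nonneg_pos mult_nonneg_nonneg) auto
  ultimately show ?thesis by blast
qed

text \<open>The left side is convex in \<open>\<delta>\<close>, and the right side is its chord over
  the interval from 0 to 1. The factor \<open>\<delta>\<close> in front is what makes the weight
  almost constant for small \<open>\<delta>\<close>.\<close>

lemma power_one_plus_convex:
  fixes \<delta> t :: real
  assumes "0 \<le> \<delta>" "\<delta> \<le> 1" "0 \<le> t"
  shows "(1 + \<delta> * t) ^ n \<le> 1 + \<delta> * ((1 + t) ^ n - 1)"
proof (induction n)
  case (Suc n)
  let ?A = "(1 + t) ^ n"
  have A: "0 \<le> ?A - 1"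
    using assms by (simp add: one_le_power)
  have "(1 + \<delta> * t) ^ Suc n \<le> (1 + \<delta> * t) * (1 + \<delta> * (?A - 1))"
    using assms Suc.IH by (simp add: mult_left_mono)
  also have "\<dots> = 1 + \<delta> * (?A - 1) + \<delta> * t + \<delta> * (\<delta> * (t * (?A - 1)))"
    by (simp add: algebra_simps)
  also have "\<dots> \<le> 1 + \<delta> * (?A - 1) + \<delta> * t + \<delta> * (t * (?A - 1))"
    using assms A by (intro add_left_mono mult_left_mono) (auto intro!: mult_left_le_one_le)
  also have "\<dots> = 1 + \<delta> * ((1 + t) ^ Suc n - 1)"
    by (simp add: algebra_simps)
  finally show ?case .
qed simp

text \<open>Both ratios of the two weights are at most \<open>a = (1 + \<delta> |z|)^B\<close>, and
  \<open>a - 1\<close> is of order \<open>\<delta>\<close>.\<close>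

lemma weight_diff_le:
  fixes x z :: "'a::euclidean_space"
  assumes r: "0 < r" and \<delta>: "0 \<le> \<delta>" "\<delta> \<le> 1" and B: "(real DIM('a) + 1) / r \<le> real B"
  shows "\<bar>weight r \<delta> (x - z) - weight r \<delta> x\<bar> \<le> \<delta> * (1 + norm z) ^ B * weight r \<delta> x"
proof -
  define a where "a = (1 + \<delta> * norm z) ^ B"
  have a1: "1 \<le> a"
    unfolding a_def using \<delta> by (simp add: one_le_power)
  have pos: "0 < weight r \<delta> x" "0 < weight r \<delta> (x - z)"
    using weight_pos[OF \<delta>(1)] by auto
  have u: "weight r \<delta> (x - z) \<le> a * weight r \<delta> x"
    using weight_le[OF r \<delta>(1) B, of "x - z" x] by (simp add: a_def)
  have l: "weight r \<delta> x \<le> a * weight r \<delta> (x - z)"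
    using weight_le[OF r \<delta>(1) B, of x "x - z"] by (simp add: a_def norm_minus_commute)
  \<comment> \<open>The inequality \<open>1/a \<ge> 2 - a\<close> in multiplied-out form; it makes
    the lower estimate symmetric to the upper one.\<close>
  have "(2 - a) * weight r \<delta> x \<le> weight r \<delta> (x - z)"
  proof (cases "a \<le> 2")
    case True
    then have "(2 - a) * weight r \<delta> x \<le> (2 - a) * (a * weight r \<delta> (x - z))"
      by (intro mult_left_mono l) auto
    also have "\<dots> = (1 - (a - 1)\<^sup>2) * weight r \<delta> (x - z)"
      by (simp add: algebra_simps power2_eq_square)
    also have "\<dots> \<le> 1 * weight r \<delta> (x - z)"
      using pos by (intro mult_right_mono) auto
    finally show ?thesis by simp
  next
    case False
    then have "(2 - a) * weight r \<delta> x \<le> 0"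
      using pos by (intro mult_nonpos_nonneg) auto
    then show ?thesis using pos by linarith
  qed
  with u have "\<bar>weight r \<delta> (x - z) - weight r \<delta> x\<bar> \<le> (a - 1) * weight r \<delta> x"
    by (simp add: algebra_simps abs_le_iff)
  also have "\<dots> \<le> (\<delta> * (1 + norm z) ^ B) * weight r \<delta> x"
  proof (intro mult_right_mono)
    have "a - 1 \<le> \<delta> * ((1 + norm z) ^ B - 1)"
      using power_one_plus_convex[OF \<delta>, of "norm z" B] by (simp add: a_def)
    also have "\<dots> \<le> \<delta> * (1 + norm z) ^ B"
      using \<delta> by (intro mult_left_mono) auto
    finally show "a - 1 \<le> \<delta> * (1 + norm z) ^ B" .
  qed (use pos in simp)
  finally show ?thesis .
qed

lemma abs_one_plus_norm: "\<bar>1 + norm x\<bar> = 1 + norm x"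
  by simp

text \<open>
  For small \<open>\<delta>\<close> the weight is almost constant at unit scale, so that convolving it with a rapidly
  decreasing function of integral \<open>1\<close> changes it only by a small factor.
\<close>

lemma weight_modulated_convolution_ge:
  fixes h :: "'a::euclidean_space \<Rightarrow> complex"
  assumes r: "0 < r" "r < 1" and h: "rapid h" and [measurable]: "h \<in> borel_measurable borel"
    and b: "fourier h b = 1"
  shows "\<exists>\<delta>>0. \<delta> \<le> 1 \<and> (\<forall>x. weight r \<delta> x / 2 \<le>
    Re (character (- x) b * (LINT y|lborel. (complex_of_real (weight r \<delta> y) * character y b) * h (x - y))))"
proof -
  obtain B where B: "(real DIM('a) + 1) / r \<le> real B"
    using real_arch_simple by blast
  define K where "K = (LINT z|lborel. (1 + norm z) ^ B * norm (h z))"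
  have iK: "integrable lborel (\<lambda>z. (1 + norm z) ^ B * norm (h z))"
  proof -
    have "rapid (\<lambda>z. complex_of_real ((1 + norm z) ^ B) * h z)"
      unfolding rapid_def
    proof
      fix N
      obtain C where "\<And>x. (1 + norm x) ^ (N + B) * norm (h x) \<le> C"
        using h unfolding rapid_def by metis
      then show "\<exists>C. \<forall>x. (1 + norm x) ^ N * norm (complex_of_real ((1 + norm x) ^ B) * h x) \<le> C"
        by (intro exI[of _ C]) (simp only: norm_mult norm_of_real power_abs abs_one_plus_norm power_add mult.assoc simp_thms)
    qed
    then have "integrable lborel (\<lambda>z. complex_of_real ((1 + norm z) ^ B) * h z)"
      by (rule integrable_rapid) measurable
    from integrable_norm[OF this] show ?thesis
      by (simp only: norm_mult norm_of_real power_abs abs_one_plus_norm)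
  qed
  have K0: "0 \<le> K"
    unfolding K_def by (intro integral_nonneg_AE AE_I2) auto
  \<comment> \<open>Chosen so that \<open>\<delta> * K \<le> 1/2\<close>, where \<open>K\<close> is
    the weighted mass of \<open>h\<close>: the relative error below is then at most one
    half.\<close>
  define \<delta> where "\<delta> = 1 / (2 * K + 1)"
  have \<delta>: "0 < \<delta>" "0 \<le> \<delta>" "\<delta> \<le> 1" "\<delta> * K \<le> 1 / 2"
    using K0 by (auto simp: \<delta>_def field_simps)
  have hi: "integrable lborel h"
    by (rule integrable_rapid[OF h]) measurable
  have "weight r \<delta> x / 2 \<le>
    Re (character (- x) b * (LINT y|lborel. (complex_of_real (weight r \<delta> y) * character y b) * h (x - y)))" for x
  proof -
    \<comment> \<open>The character of the kernel is moved onto \<open>h\<close>. The demodulated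
      \<open>g\<close> has integral \<open>fourier h b = 1\<close>, so the convolution differs from
      \<open>weight r \<delta> x\<close> only through the variation of the weight.\<close>
    define g where "g z = h z * character (- z) b" for z
    have gi: "integrable lborel g"
      unfolding g_def by (intro integrable_mult_character hi) auto
    have g1: "(LINT z|lborel. g z) = 1"
      using b by (simp add: g_def fourier_eq)
    have [measurable]: "g \<in> borel_measurable borel"
      using gi by auto
    have Wb: "norm (complex_of_real (weight r \<delta> y)) \<le> 1" for y :: 'a
      using logweight_ge_1[OF \<delta>(2), of y] r powr_mono[of "- 1 / r" 0 "logweight \<delta> y"]
      by (simp add: weight_def)
    have wgi: "integrable lborel (\<lambda>z. complex_of_real (weight r \<delta> (x - z)) * g z)"
      by (rule Bochner_Integration.integrable_bound[OF gi])
        (use Wb in \<open>auto simp: norm_mult intro!: AE_I2 mult_left_le_one_le simp del: norm_of_real\<close>)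
    have "character (- x) b * (LINT y|lborel. (complex_of_real (weight r \<delta> y) * character y b) * h (x - y))
        = (LINT y|lborel. complex_of_real (weight r \<delta> (x - (x - y))) * g (x - y))"
    proof -
      have pt: "character (- x) b * ((complex_of_real (weight r \<delta> y) * character y b) * h (x - y))
          = complex_of_real (weight r \<delta> (x - (x - y))) * g (x - y)" for y
        using character_add[of "- x" y b] by (simp add: g_def)
      then show ?thesis
        by (subst integral_mult_right_zero[symmetric]) (simp only: pt)
    qed
    also have "\<dots> = (LINT z|lborel. complex_of_real (weight r \<delta> (x - z)) * g z)"
      by (rule integral_lborel_reflect[OF wgi, of x])
    finally have eq: "character (- x) b * (LINT y|lborel. (complex_of_real (weight r \<delta> y) * character y b) * h (x - y))
       = (LINT z|lborel. complex_of_real (weight r \<delta> (x - z)) * g z)" (is "?I = _") .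
    have "?I - complex_of_real (weight r \<delta> x)
        = (LINT z|lborel. complex_of_real (weight r \<delta> (x - z)) * g z - complex_of_real (weight r \<delta> x) * g z)"
      unfolding eq using wgi gi g1 by simp
    also have "norm \<dots> \<le> (LINT z|lborel. (\<delta> * weight r \<delta> x) * ((1 + norm z) ^ B * norm (h z)))"
    proof (rule norm_integral_le)
      show "integrable lborel (\<lambda>z. (\<delta> * weight r \<delta> x) * ((1 + norm z) ^ B * norm (h z)))"
        by (intro integrable_mult_right iK)
      fix z
      have "norm (complex_of_real (weight r \<delta> (x - z)) * g z - complex_of_real (weight r \<delta> x) * g z)
          = \<bar>weight r \<delta> (x - z) - weight r \<delta> x\<bar> * norm (h z)"
        by (simp add: left_diff_distrib[symmetric] norm_mult g_def flip: of_real_diff)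
      also have "\<dots> \<le> (\<delta> * (1 + norm z) ^ B * weight r \<delta> x) * norm (h z)"
        by (intro mult_right_mono weight_diff_le r \<delta> B) auto
      finally show "norm (complex_of_real (weight r \<delta> (x - z)) * g z - complex_of_real (weight r \<delta> x) * g z)
          \<le> (\<delta> * weight r \<delta> x) * ((1 + norm z) ^ B * norm (h z))"
        by (simp add: mult_ac)
    qed
    also have "\<dots> = (\<delta> * K) * weight r \<delta> x"
      by (simp add: K_def)
    also have "\<dots> \<le> (1 / 2) * weight r \<delta> x"
      using \<delta> weight_pos[OF \<delta>(2), of r x] by (intro mult_right_mono) auto
    finally have "norm (?I - complex_of_real (weight r \<delta> x)) \<le> weight r \<delta> x / 2" by simp
    moreover have "Re (complex_of_real (weight r \<delta> x) - ?I) \<le> norm (complex_of_real (weight r \<delta> x) - ?I)"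
      by (rule complex_Re_le_cmod)
    ultimately show ?thesis
      by (simp add: norm_minus_commute)
  qed
  with \<delta> show ?thesis by blast
qed

section \<open>Herz norms\<close>

lemma epowr_ennreal: "0 \<le> x \<Longrightarrow> epowr (ennreal x) a = ennreal (x powr a)"
  by (simp add: epowr_def)

lemma epowr_mono: "0 \<le> a \<Longrightarrow> x \<le> y \<Longrightarrow> epowr x a \<le> epowr y a"
  unfolding epowr_def
  by (auto simp: top_unique less_top intro!: ennreal_leI powr_mono2 enn2real_mono)

lemma epowr_lt_top: "x < \<infinity> \<Longrightarrow> epowr x a < \<infinity>"
  by (simp add: epowr_def less_top[symmetric])

lemma enn2real_one_divide:
  assumes "0 < p"
  shows "enn2real (1 / p) = 1 / enn2real p"
proof (cases p)
  case (real x)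
  with assms have "0 < x" by simp
  then have "1 / ennreal x = ennreal (1 / x)"
    using divide_ennreal[of 1 x] by simp
  then show ?thesis using real \<open>0 < x\<close> by simp
qed simp

lemma nn_integral_restrict_lborel:
  assumes "S \<in> sets borel"
  shows "(\<integral>\<^sup>+x. f x \<partial>restrict_space lborel S) = (\<integral>\<^sup>+x\<in>S. f x \<partial>lborel)"
  by (rule nn_integral_restrict_space) (use assms in simp)

text \<open>For infinite \<open>u\<close> the exponent \<open>enn2real (1 / u)\<close> is 0 and the
  volume factor is 1, so both cases share one formula.\<close>

lemma Lp_norm_restrict_le:
  fixes f :: "'a::euclidean_space \<Rightarrow> ennreal"
  assumes u: "0 < u" and [measurable]: "S \<in> sets borel" "f \<in> borel_measurable borel"
    and le: "\<And>x. x \<in> S \<Longrightarrow> f x \<le> ennreal c" and c: "0 \<le> c"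
    and vol: "emeasure lborel S \<le> ennreal v" and v: "0 < v"
  shows "Lp_norm u (restrict_space lborel S) f \<le> ennreal (c * v powr enn2real (1 / u))"
proof (cases "u = \<infinity>")
  case True
  have "esssup (restrict_space lborel S) f \<le> ennreal c"
  proof (rule esssup_I)
    show "f \<in> borel_measurable (restrict_space lborel S)"
      by (intro measurable_restrict_space1) simp
    show "AE x in restrict_space lborel S. f x \<le> ennreal c"
      using le by (intro AE_I2) (simp add: space_restrict_space)
  qed
  then show ?thesis
    using True v by (simp add: Lp_norm_def)
next
  case False
  then obtain U where U: "u = ennreal U" "0 < U"
    using u by (cases u) auto
  have "(\<integral>\<^sup>+x. epowr (f x) U \<partial>restrict_space lborel S) \<le> (\<integral>\<^sup>+x\<in>S. ennreal (c powr U) \<partial>lborel)"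
    unfolding nn_integral_restrict_lborel[OF assms(2)]
  proof (intro nn_integral_mono)
    fix x
    have "epowr (f x) U \<le> ennreal (c powr U)" if "x \<in> S"
      using epowr_mono[OF less_imp_le[OF U(2)] le[OF that]] c by (simp add: epowr_ennreal)
    then show "epowr (f x) U * indicator S x \<le> ennreal (c powr U) * indicator S x"
      by (auto simp: indicator_def)
  qed
  also have "\<dots> = ennreal (c powr U) * emeasure lborel S"
    by (subst nn_integral_cmult_indicator) auto
  also have "\<dots> \<le> ennreal (c powr U) * ennreal v"
    by (intro mult_left_mono vol) auto
  also have "\<dots> = ennreal (c powr U * v)"
    using v by (simp add: ennreal_mult)
  finally have "epowr (\<integral>\<^sup>+x. epowr (f x) U \<partial>restrict_space lborel S) (1 / U) \<le> epowr (ennreal (c powr U * v)) (1 / U)"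
    using U by (intro epowr_mono) auto
  also have "\<dots> = ennreal ((c powr U * v) powr (1 / U))"
    using v by (intro epowr_ennreal) auto
  also have "(c powr U * v) powr (1 / U) = c * v powr (1 / U)"
    using c v U by (simp add: powr_mult powr_powr)
  finally show ?thesis
    using U enn2real_one_divide[OF u] by (simp add: Lp_norm_def)
qed

lemma lq_norm_lt_top:
  fixes a :: "nat \<Rightarrow> ennreal"
  assumes t: "0 < t" and le: "\<And>k. a k \<le> ennreal (c k)" and c: "\<And>k. 0 \<le> c k"
    and bdd: "\<And>k. c k \<le> M" and sm: "t < \<infinity> \<Longrightarrow> summable (\<lambda>k. c k powr enn2real t)"
  shows "lq_norm t UNIV a < \<infinity>"
proof (cases "t = \<infinity>")
  case True
  have "(SUP i. a i) \<le> ennreal M"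
    by (intro SUP_least order.trans[OF le] ennreal_leI bdd)
  also have "\<dots> < \<infinity>" by simp
  finally show ?thesis
    using True by (simp add: lq_norm_def)
next
  case False
  then have t': "t < \<infinity>" by (simp add: less_top)
  let ?T = "enn2real t"
  have "(\<Sum>\<^sub>\<infinity>k. epowr (a k) ?T) \<le> (\<Sum>\<^sub>\<infinity>k. ennreal (c k powr ?T))"
    using epowr_mono[OF enn2real_nonneg le] c
    by (intro infsum_mono nonneg_summable_on_complete) (auto simp: epowr_ennreal)
  also have "\<dots> = (\<Sum>k. ennreal (c k powr ?T))"
    by (intro sums_unique has_sum_imp_sums has_sum_infsum nonneg_summable_on_complete) auto
  also have "\<dots> < \<infinity>"
    using sm[OF t'] by (subst suminf_ennreal2) auto
  finally show ?thesis
    unfolding lq_norm_def if_not_P[OF False] by (rule epowr_lt_top)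
qed

text \<open>Each shell is bounded by the supremum there times a power of the volume, which reduces
  the norm to the explicit sequence \<open>c\<close>.\<close>

lemma herz_norm_lt_top:
  fixes f :: "'a::euclidean_space \<Rightarrow> complex"
  assumes r: "0 < r" and \<delta>: "0 < \<delta>" "\<delta> \<le> 1" and [measurable]: "f \<in> borel_measurable borel"
    and f: "\<And>x. norm (f x) \<le> C * weight r \<delta> x" and C: "0 < C"
    and u: "0 < u" and t: "0 < t"
    and s: "s < real DIM('a) * (1 / r) - real DIM('a) * enn2real (1 / u) \<or>
         (s = real DIM('a) * (1 / r) - real DIM('a) * enn2real (1 / u) \<and> ennreal r < t)"
  shows "herz_norm u s t f < \<infinity>"
proof -
  let ?d = "real DIM('a)" and ?v = "unit_ball_vol (real DIM('a))" and ?u = "enn2real (1 / u)"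
  have v: "0 < ?v" by (simp add: unit_ball_vol_pos)
  obtain B where B: "(?d + 1) / r \<le> real B"
    using real_arch_simple by blast
  \<comment> \<open>Dilation by \<open>1/\<delta>\<close> compares the weight with the one for
    \<open>\<delta> = 1\<close> at the cost of a constant, so the shells need not be
    dilated.\<close>
  have W: "weight r \<delta> x \<le> (1 / \<delta>) ^ B * weight r 1 x" for x :: 'a
  proof -
    have "logweight \<delta> ((1 / \<delta>) *\<^sub>R x) = logweight 1 x"
      using \<delta> by (simp add: logweight_def)
    then show ?thesis
      using weight_le_scale[OF r _ B, of \<delta> "1 / \<delta>" "1 / \<delta>" x] \<delta> by (simp add: weight_def)
  qed
  \<comment> \<open>\<open>ln 2 * (1 + k)\<close> bounds \<open>1 + ln (1 + |x|)\<close> from below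
    on shell \<open>k\<close>, because \<open>ln 2 < 1\<close>.\<close>
  define \<beta> where "\<beta> k = (2::real) powr (- (real k * ?d / r)) * (ln 2 * (1 + real k)) powr (- 1 / r)" for k
  have shell: "weight r 1 x \<le> \<beta> k" if x: "x \<in> herz_shell k" for x :: 'a and k
  proof -
    have 1: "2 ^ k \<le> 1 + norm x" by (rule herz_shell_bounds(1)[OF x])
    have "real k * ln 2 \<le> ln (1 + norm x)"
      using ln_mono[of "2 ^ k" "1 + norm x"] 1 by (simp add: ln_realpow add_pos_nonneg)
    moreover have "ln 2 < (1::real)" by (rule ln_2_less_1)
    ultimately have "ln 2 * (1 + real k) \<le> 1 + ln (1 + norm x)"
      by (simp add: algebra_simps)
    then have "(2 ^ k) ^ DIM('a) * (ln 2 * (1 + real k)) \<le> logweight 1 x"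
      unfolding logweight_def using 1 by (intro mult_mono power_mono) auto
    then have "weight r 1 x \<le> ((2 ^ k) ^ DIM('a) * (ln 2 * (1 + real k))) powr (- 1 / r)"
      unfolding weight_def using r by (intro powr_mono2') auto
    also have "\<dots> = \<beta> k"
      by (simp add: \<beta>_def powr_mult powr_realpow[symmetric] powr_powr)
    finally show ?thesis .
  qed
  let ?A = "C * (1 / \<delta>) ^ B"
  have A: "0 < ?A" using C \<delta> by simp
  define c where "c k = 2 powr (s * real k) * ((?A * \<beta> k) * (?v * 2 ^ ((k + 1) * DIM('a))) powr ?u)" for k
  have \<beta>0: "0 < \<beta> k" for k by (simp add: \<beta>_def)
  have c0: "0 \<le> c k" for k
    unfolding c_def using less_imp_le[OF A] less_imp_le[OF \<beta>0[of k]]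
    by (intro mult_nonneg_nonneg[of _ "_ * _"] mult_nonneg_nonneg[of "_ * _"] mult_nonneg_nonneg[of ?A]) auto
  have le: "ennreal (2 powr (s * real k)) * Lp_norm u (restrict_space lborel (herz_shell k)) (\<lambda>x. ennreal (norm (f x)))
      \<le> ennreal (c k)" for k
  proof -
    have "Lp_norm u (restrict_space lborel (herz_shell k)) (\<lambda>x. ennreal (norm (f x)))
        \<le> ennreal ((?A * \<beta> k) * (?v * 2 ^ ((k + 1) * DIM('a))) powr ?u)"
    proof (rule Lp_norm_restrict_le[OF u])
      fix x :: 'a assume x: "x \<in> herz_shell k"
      have "norm (f x) \<le> C * ((1 / \<delta>) ^ B * weight r 1 x)"
        using f[of x] W[of x] C by (meson less_imp_le mult_left_mono order_trans)
      also have "\<dots> \<le> C * ((1 / \<delta>) ^ B * \<beta> k)"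
        using C \<delta> shell[OF x] by (intro mult_left_mono) auto
      finally show "ennreal (norm (f x)) \<le> ennreal (?A * \<beta> k)"
        by (intro ennreal_leI) (simp add: mult.assoc)
    qed (use A less_imp_le[OF \<beta>0[of k]] v emeasure_herz_shell_le in auto)
    then have "ennreal (2 powr (s * real k)) * Lp_norm u (restrict_space lborel (herz_shell k)) (\<lambda>x. ennreal (norm (f x)))
      \<le> ennreal (2 powr (s * real k)) * ennreal ((?A * \<beta> k) * (?v * 2 ^ ((k + 1) * DIM('a))) powr ?u)"
      by (intro mult_left_mono) auto
    also have "\<dots> = ennreal (c k)"
      unfolding c_def by (rule ennreal_mult'[symmetric]) simp
    finally show ?thesis .
  qed
  \<comment> \<open>The distance of \<open>s\<close> from the critical index: the sequence decays
    geometrically if it is positive and like \<open>(1 + k) powr (- 1 / r)\<close> if it is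
    0.\<close>
  define \<epsilon> where "\<epsilon> = ?d * (1 / r) - ?d * ?u - s"
  have \<epsilon>: "0 \<le> \<epsilon>" "\<epsilon> > 0 \<or> ennreal r < t"
    using s by (auto simp: \<epsilon>_def)
  define K where "K = ?A * (?v * 2 powr ?d) powr ?u * ln 2 powr (- 1 / r)"
  have K: "0 < K"
    unfolding K_def using less_imp_neq[OF v, symmetric] by (intro mult_pos_pos[OF mult_pos_pos[OF A]]) simp_all
  have ceq: "c k = K * (2 powr (- \<epsilon> * real k) * (1 + real k) powr (- 1 / r))" for k
  proof -
    have eq1: "(?v * 2 ^ ((k + 1) * DIM('a))) powr ?u = (?v * 2 powr ?d) powr ?u * 2 powr (real k * ?d * ?u)"
      using v by (simp add: powr_mult powr_realpow[symmetric] powr_powr power_add powr_add[symmetric] algebra_simps)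
    have eq2: "2 powr (s * real k) * 2 powr (- (real k * ?d / r)) * 2 powr (real k * ?d * ?u)
      = 2 powr (- \<epsilon> * real k)"
      by (simp add: powr_add[symmetric] \<epsilon>_def algebra_simps)
    have eq3: "(ln 2 * (1 + real k)) powr (- 1 / r) = ln 2 powr (- 1 / r) * (1 + real k) powr (- 1 / r)"
      by (simp add: powr_mult)
    show ?thesis
      unfolding c_def \<beta>_def K_def eq1 eq3 eq2[symmetric] by (simp only: mult_ac)
  qed
  have b1: "2 powr (- \<epsilon> * real k) \<le> 1" "(1 + real k) powr (- 1 / r) \<le> 1" for k
    using \<epsilon> powr_mono[of "- \<epsilon> * real k" 0 2] powr_mono[of "- 1 / r" 0 "1 + real k"] r by auto
  have "c k \<le> K" for k
    unfolding ceq using K b1[of k] mult_mono[OF b1(1)[of k] b1(2)[of k]] by simp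
  moreover have "summable (\<lambda>k. c k powr enn2real t)" if "t < \<infinity>"
  proof -
    obtain T where T: "t = ennreal T" "0 < T"
      using t \<open>t < \<infinity>\<close> by (cases t) auto
    have cT: "c k powr T = K powr T * (2 powr (- \<epsilon> * T * real k) * (1 + real k) powr (- T / r))" for k
      unfolding ceq using K by (simp add: powr_mult powr_powr mult_ac)
    have "summable (\<lambda>k. 2 powr (- \<epsilon> * T * real k) * (1 + real k) powr (- T / r))"
    proof (cases "0 < \<epsilon>")
      case True
      have "summable (\<lambda>k. (2 powr (- \<epsilon> * T)) ^ k)"
        using True T by (intro summable_geometric) (simp add: powr_less_one)
      moreover have "(2 powr (- \<epsilon> * T)) ^ k = 2 powr (- \<epsilon> * T * real k)" for k
        by (simp add: powr_realpow[symmetric] powr_powr)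
      ultimately have "summable (\<lambda>k. 2 powr (- \<epsilon> * T * real k))" by (simp only:)
      then show ?thesis
      proof (rule summable_comparison_test'[where N=0])
        fix k :: nat
        have "(1 + real k) powr (- T / r) \<le> 1"
          using powr_mono[of "- T / r" 0 "1 + real k"] T r by simp
        then show "norm (2 powr (- \<epsilon> * T * real k) * (1 + real k) powr (- T / r)) \<le> 2 powr (- \<epsilon> * T * real k)"
          by (simp add: mult_left_le)
      qed
    next
      case False
      then have 0: "\<epsilon> = 0" and "ennreal r < t" using \<epsilon> by auto
      then have "r < T" using T r by (simp add: ennreal_less_iff)
      then have "summable (\<lambda>k. real k powr (- T / r))"
        using r by (subst summable_real_powr_iff) (simp add: field_simps)
      then have "summable (\<lambda>k. real (k + 1) powr (- T / r))"
        by (subst summable_iff_shift)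
      then show ?thesis by (simp add: 0 add.commute)
    qed
    then show ?thesis
      using T by (simp add: cT summable_mult)
  qed
  ultimately show ?thesis
    unfolding herz_norm_def by (intro lq_norm_lt_top[OF t le c0])
qed

section \<open>Littlewood--Paley pieces of superposed bumps\<close>

lemma inv_fourier_zero: "inv_fourier (\<lambda>_. 0) x = 0"
  by (simp add: inv_fourier_eq)

lemma inv_fourier_sum:
  assumes "\<And>i. i \<in> I \<Longrightarrow> integrable lborel (G i)"
  shows "inv_fourier (\<lambda>\<xi>. \<Sum>i\<in>I. G i \<xi>) x = (\<Sum>i\<in>I. inv_fourier (G i) x)"
  unfolding inv_fourier_eq sum_distrib_right
  using assms by (intro Bochner_Integration.integral_sum integrable_mult_character) auto

lemma fourier_sum:
  assumes "\<And>i. i \<in> I \<Longrightarrow> integrable lborel (f i)"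
  shows "fourier (\<lambda>x. \<Sum>i\<in>I. f i x) \<xi> = (\<Sum>i\<in>I. fourier (f i) \<xi>)"
  unfolding fourier_eq_inv_fourier by (rule inv_fourier_sum[OF assms])

section \<open>Dilated and translated bumps on the Fourier side\<close>

abbreviation octave :: "int \<Rightarrow> real" where
  "octave e \<equiv> 2 powr (8 * real_of_int e)"

text \<open>The transform of \<open>\<lambda>x. g (\<mu> *\<^sub>R (x - c))\<close> when
  \<open>G\<close> is the transform of \<open>g\<close>; stated through \<open>G\<close> so that
  multipliers can be applied to the profile.\<close>

definition atom :: "real \<Rightarrow> 'a::euclidean_space \<Rightarrow> ('a \<Rightarrow> complex) \<Rightarrow> 'a \<Rightarrow> complex" where
  "atom \<mu> c G \<xi> = complex_of_real (1 / \<mu> ^ DIM('a)) * G ((1 / \<mu>) *\<^sub>R \<xi>) * character (- c) \<xi>"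

lemma fourier_affine:
  fixes f :: "'a::euclidean_space \<Rightarrow> complex"
  assumes f: "integrable lborel f" and \<mu>: "0 < \<mu>"
  shows "fourier (\<lambda>x. f (\<mu> *\<^sub>R (x - c))) = atom \<mu> c (fourier f)"
proof
  fix \<xi>
  let ?F = "\<lambda>y. f y * character (- y) ((1 / \<mu>) *\<^sub>R \<xi>) * character (- c) \<xi>"
  have F: "integrable lborel ?F"
    by (intro integrable_mult_left integrable_mult_character f) auto
  have "f (\<mu> *\<^sub>R (x - c)) * character (- x) \<xi> = ?F (- \<mu> *\<^sub>R c + \<mu> *\<^sub>R x)" for x
  proof -
    have "character (- (\<mu> *\<^sub>R (x - c))) ((1 / \<mu>) *\<^sub>R \<xi>) = character (- (x - c)) \<xi>"
      using \<mu> by (simp add: character_def inner_diff_left algebra_simps)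
    moreover have "character (- x) \<xi> = character (- (x - c)) \<xi> * character (- c) \<xi>"
      by (subst character_add[symmetric]) simp
    ultimately show ?thesis
      by (simp add: scaleR_diff_right algebra_simps)
  qed
  then have "fourier (\<lambda>x. f (\<mu> *\<^sub>R (x - c))) \<xi> = (LINT x|lborel. ?F (- \<mu> *\<^sub>R c + \<mu> *\<^sub>R x))"
    by (simp add: fourier_eq)
  also have "\<dots> = (1 / \<bar>\<mu>\<bar> ^ DIM('a)) *\<^sub>R (LINT y|lborel. ?F y)"
    by (rule integral_lborel_affine[OF F]) (use \<mu> in auto)
  also have "\<dots> = atom \<mu> c (fourier f) \<xi>"
    unfolding integral_mult_left_zero using \<mu> by (simp add: atom_def fourier_eq scaleR_conv_of_real mult_ac)
  finally show "fourier (\<lambda>x. f (\<mu> *\<^sub>R (x - c))) \<xi> = atom \<mu> c (fourier f) \<xi>" .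
qed

lemma integrable_atom:
  fixes G :: "'a::euclidean_space \<Rightarrow> complex"
  assumes G: "integrable lborel G" and \<mu>: "0 < \<mu>"
  shows "integrable lborel (atom \<mu> c G)"
proof -
  have "integrable lborel (\<lambda>\<xi>. G (0 + (1 / \<mu>) *\<^sub>R \<xi>))"
    by (rule integrable_lborel_affine[OF G]) (use \<mu> in auto)
  then show ?thesis
    unfolding atom_def mult.assoc by (intro integrable_mult_right integrable_mult_character) auto
qed

lemma inv_fourier_atom:
  fixes G :: "'a::euclidean_space \<Rightarrow> complex"
  assumes G: "integrable lborel G" and \<mu>: "0 < \<mu>"
  shows "inv_fourier (atom \<mu> c G) x = inv_fourier G (\<mu> *\<^sub>R (x - c))"
proof -
  let ?F = "\<lambda>\<zeta>. G \<zeta> * character (\<mu> *\<^sub>R (x - c)) \<zeta>"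
  have F: "integrable lborel ?F"
    by (intro integrable_mult_character G) auto
  have "atom \<mu> c G \<xi> * character x \<xi> = complex_of_real (1 / \<mu> ^ DIM('a)) * ?F (0 + (1 / \<mu>) *\<^sub>R \<xi>)" for \<xi>
  proof -
    have "character (\<mu> *\<^sub>R (x - c)) ((1 / \<mu>) *\<^sub>R \<xi>) = character (x - c) \<xi>"
      using \<mu> by (simp add: character_def)
    moreover have "character (- c) \<xi> * character x \<xi> = character (x - c) \<xi>"
      by (subst character_add[symmetric]) simp
    ultimately show ?thesis
      by (simp add: atom_def mult.assoc)
  qed
  then have "inv_fourier (atom \<mu> c G) x
      = complex_of_real (1 / \<mu> ^ DIM('a)) * (LINT \<xi>|lborel. ?F (0 + (1 / \<mu>) *\<^sub>R \<xi>))"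
    by (simp add: inv_fourier_eq)
  also have "(LINT \<xi>|lborel. ?F (0 + (1 / \<mu>) *\<^sub>R \<xi>)) = (1 / \<bar>1 / \<mu>\<bar> ^ DIM('a)) *\<^sub>R (LINT \<zeta>|lborel. ?F \<zeta>)"
    by (rule integral_lborel_affine[OF F]) (use \<mu> in auto)
  finally show ?thesis
    using \<mu> by (simp add: inv_fourier_eq scaleR_conv_of_real power_one_over)
qed

lemma integrable_mult_bounded:
  fixes f g :: "'a::euclidean_space \<Rightarrow> complex"
  assumes g: "integrable lborel g" and [measurable]: "f \<in> borel_measurable borel" and f: "\<And>x. norm (f x) \<le> C"
  shows "integrable lborel (\<lambda>x. f x * g x)"
proof (rule Bochner_Integration.integrable_bound)
  have [measurable]: "g \<in> borel_measurable borel" using g by auto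
  show "integrable lborel (\<lambda>x. C * norm (g x))"
    by (intro integrable_mult_right integrable_norm g)
  show "(\<lambda>x. f x * g x) \<in> borel_measurable lborel"
    by measurable
qed (auto simp: norm_mult abs_mult intro!: AE_I2 mult_right_mono order.trans[OF f abs_ge_self])

section \<open>The Littlewood-Paley function and the pieces it cuts out\<close>

locale lp_function =
  fixes \<phi> :: "'a::euclidean_space \<Rightarrow> complex"
  assumes lp: "littlewood_paley \<phi>"
begin

lemma Schwartz: "\<phi> \<in> Schwartz"
  using lp by (simp add: littlewood_paley_def)

lemmas cont = Schwartz_continuous[OF Schwartz]
  and int = Schwartz_integrable[OF Schwartz]
  and rapid = Schwartz_rapid[OF Schwartz]

text \<open>The nonvanishing set is open, hence lies in the interior of the annulus, and the
  transform vanishes on the two boundary spheres as well. Dyadic dilates of unit vectors lie exactly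
  on them.\<close>

lemma hat_eq_zero:
  assumes "norm \<xi> \<le> 1 / 2 \<or> 2 \<le> norm \<xi>"
  shows "fourier \<phi> \<xi> = 0"
proof -
  let ?S = "{\<xi>. fourier \<phi> \<xi> \<noteq> 0}"
  have o: "open ?S"
    by (intro open_Collect_neq continuous_on_fourier int continuous_intros)
  have "closure ?S \<subseteq> {\<xi>. 1/2 \<le> norm \<xi> \<and> norm \<xi> \<le> 2}"
    using lp unfolding littlewood_paley_def by (elim conjE)
  then have s: "?S \<subseteq> {\<xi>. 1/2 \<le> norm \<xi> \<and> norm \<xi> \<le> 2}"
    by (rule order_trans[OF closure_subset])
  have "?S \<subseteq> interior (cball 0 2)"
    using o s by (intro interior_maximal) auto
  moreover have "?S \<subseteq> interior (- ball 0 (1/2))"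
    using o s by (intro interior_maximal) auto
  ultimately have "?S \<subseteq> ball 0 2" "?S \<subseteq> - cball 0 (1/2)"
    by (simp_all add: interior_complement)
  then show ?thesis
    using assms by fastforce
qed

lemma int_hat: "integrable lborel (fourier \<phi>)"
  by (rule integrable_continuous_compact_support[OF continuous_on_fourier[OF int], of 2])
    (simp add: hat_eq_zero)

lemma hat_bounded: "norm (fourier \<phi> \<xi>) \<le> (LINT x|lborel. norm (\<phi> x))"
  by (rule norm_fourier_le[OF int])

lemma inversion: "inv_fourier (fourier \<phi>) = \<phi>"
proof
  obtain B where "\<And>x. norm (\<phi> x) \<le> B * inverse ((1 + norm x) ^ 0)"
    using rapidE[OF rapid] by metis
  then have "norm (\<phi> x) \<le> B" for x
    by simp
  then show "inv_fourier (fourier \<phi>) x = \<phi> x" for x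
    by (intro inv_fourier_fourier int cont int_hat)
qed

lemma dilate_eq: "dilate k \<phi> = (\<lambda>x. complex_of_real ((2 powr real_of_int k) ^ DIM('a)) * \<phi> ((2 powr real_of_int k) *\<^sub>R (x - 0)))"
  by (simp add: dilate_def fun_eq_iff powr_realpow[symmetric] powr_powr)

lemma integrable_dilate: "integrable lborel (dilate k \<phi>)"
proof -
  have "integrable lborel (\<lambda>x. \<phi> (0 + (2 powr real_of_int k) *\<^sub>R x))"
    by (rule integrable_lborel_affine[OF int]) simp
  then show ?thesis
    unfolding dilate_eq by (intro integrable_mult_right) simp
qed

lemma fourier_dilate: "fourier (dilate k \<phi>) \<xi> = fourier \<phi> ((2 powr - real_of_int k) *\<^sub>R \<xi>)"
proof -
  let ?\<mu> = "2 powr real_of_int k"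
  have "fourier (dilate k \<phi>) \<xi> = complex_of_real (?\<mu> ^ DIM('a)) * fourier (\<lambda>x. \<phi> (?\<mu> *\<^sub>R (x - 0))) \<xi>"
    unfolding dilate_eq fourier_eq by (simp add: mult.assoc)
  also have "fourier (\<lambda>x. \<phi> (?\<mu> *\<^sub>R (x - 0))) = atom ?\<mu> 0 (fourier \<phi>)"
    by (rule fourier_affine[OF int]) simp
  finally show ?thesis
    by (simp add: atom_def powr_minus divide_inverse)
qed

text \<open>For a unit vector every dilate with \<open>k \<noteq> 0\<close> is evaluated on or
  beyond a boundary sphere, so the partition of unity reduces to its term
  \<open>k = 0\<close>.\<close>

lemma hat_unit:
  assumes "norm \<xi> = 1"
  shows "fourier \<phi> \<xi> = 1"
proof -
  have z: "fourier (dilate k \<phi>) \<xi> = 0" if "k \<noteq> 0" for k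
  proof -
    have "norm ((2 powr - real_of_int k) *\<^sub>R \<xi>) = 2 powr - real_of_int k"
      using assms by simp
    moreover have "2 powr - real_of_int k \<le> 1 / 2 \<or> 2 \<le> 2 powr - real_of_int k"
    proof (cases "0 < k")
      case True
      then show ?thesis
        using powr_mono[of "- real_of_int k" "- 1" 2] by (simp add: powr_minus)
    next
      case False
      then have "1 \<le> - real_of_int k"
        using that by linarith
      then show ?thesis
        using powr_mono[of 1 "- real_of_int k" 2] by simp
    qed
    ultimately show ?thesis
      unfolding fourier_dilate by (intro hat_eq_zero) auto
  qed
  have "\<xi> \<noteq> 0" using assms by auto
  then have "((\<lambda>k. fourier (dilate k \<phi>) \<xi>) has_sum 1) UNIV"
    using lp by (simp add: littlewood_paley_def)
  then have "infsum (\<lambda>k. fourier (dilate k \<phi>) \<xi>) UNIV = 1"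
    by (rule infsumI)
  also have "infsum (\<lambda>k. fourier (dilate k \<phi>) \<xi>) UNIV = infsum (\<lambda>k. fourier (dilate k \<phi>) \<xi>) {0}"
    by (rule infsum_cong_neutral) (auto simp: z)
  finally have "fourier (dilate 0 \<phi>) \<xi> = 1"
    by simp
  then show ?thesis
    by (simp add: fourier_dilate)
qed

lemma LP_piece_inv_fourier:
  assumes G: "integrable lborel G"
  shows "LP_piece \<phi> j (distribution_of (inv_fourier G)) x
    = inv_fourier (\<lambda>\<xi>. fourier \<phi> ((2 powr - real_of_int j) *\<^sub>R \<xi>) * G \<xi>) x"
proof -
  have i: "integrable lborel (\<lambda>y. inv_fourier G (x - y) * dilate j \<phi> y)"
    using G by (intro integrable_mult_bounded[OF integrable_dilate _ norm_inv_fourier_le])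
      (auto intro!: measurable_compose[OF _ borel_measurable_inv_fourier[OF G]])
  have "LP_piece \<phi> j (distribution_of (inv_fourier G)) x
     = (LINT y|lborel. inv_fourier G (x - (x - y)) * dilate j \<phi> (x - y))"
    by (simp add: LP_piece_def convolve_dist_def distribution_of_def)
  also have "\<dots> = (LINT y|lborel. inv_fourier G (x - y) * dilate j \<phi> y)"
    by (rule integral_lborel_reflect[OF i])
  also have "\<dots> = (LINT y|lborel. dilate j \<phi> y * inv_fourier G (x - 1 *\<^sub>R y))"
    by (simp add: mult.commute)
  also have "\<dots> = inv_fourier (\<lambda>\<xi>. fourier (dilate j \<phi>) (1 *\<^sub>R \<xi>) * G \<xi>) x"
    by (rule inv_fourier_fourier_times[OF integrable_dilate G, symmetric])
  finally show ?thesis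
    by (simp add: fourier_dilate)
qed

definition superpose :: "('a \<Rightarrow> complex) \<Rightarrow> (int \<times> 'a) set \<Rightarrow> 'a \<Rightarrow> complex" where
  "superpose g I x = (\<Sum>(e, c)\<in>I. g (octave e *\<^sub>R (x - c)))"

text \<open>The \<open>i\<close>-th Littlewood-Paley piece of the profile with transform
  \<open>G\<close>, to which scaling reduces all pieces of a superposition.\<close>

definition piece :: "('a \<Rightarrow> complex) \<Rightarrow> int \<Rightarrow> 'a \<Rightarrow> complex" where
  "piece G i = inv_fourier (\<lambda>\<xi>. fourier \<phi> ((2 powr - real_of_int i) *\<^sub>R \<xi>) * G \<xi>)"

lemma integrable_hat_scaled_mult:
  assumes G: "integrable lborel G"
  shows "integrable lborel (\<lambda>\<xi>. fourier \<phi> (c *\<^sub>R \<xi>) * G \<xi>)"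
  by (rule integrable_mult_bounded[OF G _ hat_bounded])
    (auto intro!: measurable_compose[OF _ borel_measurable_fourier[OF int]])

lemma superpose_inv_fourier:
  assumes G: "integrable lborel G"
  shows "superpose (inv_fourier G) I = inv_fourier (\<lambda>\<xi>. \<Sum>(e, c)\<in>I. atom (octave e) c G \<xi>)"
proof
  fix x
  have "superpose (inv_fourier G) I x = (\<Sum>i\<in>I. inv_fourier (\<lambda>\<xi>. case i of (e, c) \<Rightarrow> atom (octave e) c G \<xi>) x)"
    unfolding superpose_def by (intro sum.cong refl) (auto simp: inv_fourier_atom[OF G])
  also have "\<dots> = inv_fourier (\<lambda>\<xi>. \<Sum>i\<in>I. case i of (e, c) \<Rightarrow> atom (octave e) c G \<xi>) x"
    by (rule inv_fourier_sum[symmetric]) (auto intro!: integrable_atom G)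
  finally show "superpose (inv_fourier G) I x = inv_fourier (\<lambda>\<xi>. \<Sum>(e, c)\<in>I. atom (octave e) c G \<xi>) x" .
qed

text \<open>Dilating a bump by \<open>2^(8e)\<close> shifts the index of its pieces by
  \<open>8e\<close>, so each summand is a piece of the undilated profile.\<close>

lemma LP_piece_superpose:
  assumes G: "integrable lborel G"
  shows "LP_piece \<phi> j (distribution_of (superpose (inv_fourier G) I)) x
    = (\<Sum>(e, c)\<in>I. piece G (j - 8 * e) (octave e *\<^sub>R (x - c)))"
proof -
  let ?\<mu> = "\<lambda>e. octave e"
  have A: "integrable lborel (\<lambda>\<xi>. \<Sum>(e, c)\<in>I. atom (?\<mu> e) c G \<xi>)"
    by (intro Bochner_Integration.integrable_sum) (auto intro!: integrable_atom G)
  have eq: "fourier \<phi> ((2 powr - real_of_int j) *\<^sub>R \<xi>) * atom (?\<mu> e) c G \<xi>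
     = atom (?\<mu> e) c (\<lambda>\<xi>. fourier \<phi> ((2 powr - real_of_int (j - 8 * e)) *\<^sub>R \<xi>) * G \<xi>) \<xi>" for e c \<xi>
  proof -
    have "2 powr - real_of_int (j - 8 * e) * (1 / ?\<mu> e) = 2 powr - real_of_int j"
      by (simp add: powr_diff[symmetric] divide_inverse powr_minus[symmetric] powr_add[symmetric])
    then show ?thesis by (simp add: atom_def)
  qed
  have "LP_piece \<phi> j (distribution_of (superpose (inv_fourier G) I)) x
    = inv_fourier (\<lambda>\<xi>. \<Sum>i\<in>I. case i of (e, c) \<Rightarrow>
        atom (?\<mu> e) c (\<lambda>\<xi>. fourier \<phi> ((2 powr - real_of_int (j - 8 * e)) *\<^sub>R \<xi>) * G \<xi>) \<xi>) x"
    unfolding superpose_inv_fourier[OF G] LP_piece_inv_fourier[OF A] sum_distrib_left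
    by (rule arg_cong[where f="\<lambda>G. inv_fourier G x"], rule ext, intro sum.cong refl) (auto simp: eq)
  also have "\<dots> = (\<Sum>i\<in>I. inv_fourier (\<lambda>\<xi>. case i of (e, c) \<Rightarrow>
        atom (?\<mu> e) c (\<lambda>\<xi>. fourier \<phi> ((2 powr - real_of_int (j - 8 * e)) *\<^sub>R \<xi>) * G \<xi>) \<xi>) x)"
    by (rule inv_fourier_sum) (auto intro!: integrable_atom integrable_hat_scaled_mult G)
  also have "\<dots> = (\<Sum>(e, c)\<in>I. piece G (j - 8 * e) (octave e *\<^sub>R (x - c)))"
    by (intro sum.cong refl)
      (auto simp: piece_def inv_fourier_atom[OF integrable_hat_scaled_mult[OF G]])
  finally show ?thesis .
qed

text \<open>The annulus of \<phi> and its dilate by \<open>2^i\<close> meet at most in a boundary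
  sphere once \<open>|i| \<ge> 2\<close>.\<close>

lemma piece_hat_eq_zero:
  assumes "2 \<le> \<bar>i\<bar>"
  shows "piece (\<lambda>\<xi>. K \<xi> * fourier \<phi> \<xi>) i x = 0"
proof -
  have "fourier \<phi> ((2 powr - real_of_int i) *\<^sub>R \<xi>) * (K \<xi> * fourier \<phi> \<xi>) = 0" for \<xi>
  proof (cases "norm \<xi> \<le> 1 / 2 \<or> 2 \<le> norm \<xi>")
    case False
    have "2 powr - real_of_int i \<le> 1 / 4 \<or> 4 \<le> 2 powr - real_of_int i"
    proof (cases "0 \<le> i")
      case True
      then show ?thesis
        using assms powr_mono[of "- real_of_int i" "- 2" 2] by (simp add: powr_minus)
    next
      case False
      then have "2 \<le> - real_of_int i"
        using assms by linarith
      then show ?thesis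
        using powr_mono[of 2 "- real_of_int i" 2] by simp
    qed
    then have "2 powr - real_of_int i * norm \<xi> \<le> 1 / 4 * 2 \<or> 4 * (1 / 2) \<le> 2 powr - real_of_int i * norm \<xi>"
    proof
      assume "2 powr - real_of_int i \<le> 1 / 4"
      then show ?thesis
        using False by (intro disjI1 mult_mono) auto
    next
      assume "4 \<le> 2 powr - real_of_int i"
      then show ?thesis
        using False by (intro disjI2 mult_mono) auto
    qed
    then show ?thesis by (simp add: hat_eq_zero)
  qed (simp add: hat_eq_zero)
  then show ?thesis unfolding piece_def by (simp only: inv_fourier_zero)
qed

lemma superpose_Schwartz: "finite I \<Longrightarrow> superpose \<phi> I \<in> Schwartz"
  unfolding superpose_def[abs_def] case_prod_unfold by (intro Schwartz_sum Schwartz_affine Schwartz) auto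

lemma fourier_superpose:
  "fourier (superpose \<phi> I) \<xi> = (\<Sum>(e, c)\<in>I. atom (octave e) c (fourier \<phi>) \<xi>)"
proof -
  have "fourier (superpose \<phi> I) \<xi>
      = (\<Sum>i\<in>I. fourier (\<lambda>x. \<phi> (octave (fst i) *\<^sub>R (x - snd i))) \<xi>)"
    unfolding superpose_def[abs_def] case_prod_unfold
    by (rule fourier_sum) (intro Schwartz_integrable Schwartz_affine Schwartz, simp)
  then show ?thesis
    by (simp add: fourier_affine[OF int] case_prod_unfold)
qed

text \<open>The lowest octave leaves a ball around the origin on which the transform
  vanishes.\<close>

lemma superpose_S_infinity:
  assumes "finite I"
  shows "superpose \<phi> I \<in> S_infinity"
proof -
  obtain e0 where e0: "\<And>e c. (e, c) \<in> I \<Longrightarrow> e0 \<le> e"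
  proof -
    have "finite (fst ` I)" using assms by simp
    then obtain e0 where "\<forall>e\<in>fst ` I. e0 \<le> e"
      by (meson bdd_below.E bdd_below_finite)
    then show thesis by (intro that[of e0]) force
  qed
  show ?thesis
  proof (rule S_infinityI[OF superpose_Schwartz[OF assms]])
    show "0 < octave e0 / 2" by simp
    fix \<xi> :: 'a assume \<xi>: "norm \<xi> < octave e0 / 2"
    have "fourier \<phi> ((1 / octave e) *\<^sub>R \<xi>) = 0" if "(e, c) \<in> I" for e c
    proof (rule hat_eq_zero, rule disjI1)
      have "octave e0 \<le> octave e"
        using e0[OF that] by (intro powr_mono) auto
      then have "norm \<xi> * 2 \<le> octave e"
        using \<xi> by linarith
      then show "norm ((1 / octave e) *\<^sub>R \<xi>) \<le> 1 / 2"
        by (simp add: field_simps)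
    qed
    then show "fourier (superpose \<phi> I) \<xi> = 0"
      unfolding fourier_superpose by (intro sum.neutral) (auto simp: atom_def)
  qed
qed

end

section \<open>The multiplier\<close>

text \<open>Inversion in the other order, by reflection in the origin.\<close>

lemma fourier_inv_fourier:
  fixes G :: "'a::euclidean_space \<Rightarrow> complex"
  assumes G: "integrable lborel G" "continuous_on UNIV G" "\<And>x. norm (G x) \<le> B"
    and iG: "integrable lborel (inv_fourier G)"
  shows "fourier (inv_fourier G) \<xi> = G \<xi>"
proof -
  have eq: "fourier G = (\<lambda>x. inv_fourier G (0 - x))"
    by (simp add: fourier_eq_inv_fourier fun_eq_iff)
  have "integrable lborel (fourier G)"
    unfolding eq by (rule integrable_lborel_reflect[OF iG])
  then have "G \<xi> = inv_fourier (fourier G) \<xi>"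
    using inv_fourier_fourier[OF G] by simp
  also have "\<dots> = (LINT x|lborel. fourier G x * character \<xi> x)"
    by (rule inv_fourier_eq)
  also have "\<dots> = (LINT x|lborel. inv_fourier G (0 - x) * character (- (0 - x)) \<xi>)"
    unfolding eq by (simp add: character_commute[of \<xi>])
  also have "\<dots> = (LINT x|lborel. inv_fourier G x * character (- x) \<xi>)"
    by (rule integral_lborel_reflect) (intro integrable_mult_character iG, auto)
  finally show ?thesis
    by (simp add: fourier_eq)
qed

lemma rapid_cong: "rapid f \<Longrightarrow> (\<And>x. g x = f x) \<Longrightarrow> rapid g"
  by (simp add: rapid_def)

section \<open>The kernel, its symbol and the action on bumps\<close>

definition modulated_weight :: "real \<Rightarrow> real \<Rightarrow> 'a::euclidean_space \<Rightarrow> 'a \<Rightarrow> complex" where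
  "modulated_weight r \<delta> b y = complex_of_real (weight r \<delta> y) * character y b"

lemma norm_modulated_weight: "0 \<le> \<delta> \<Longrightarrow> norm (modulated_weight r \<delta> b y) = weight r \<delta> y"
  using weight_pos[of \<delta> r y] by (simp add: modulated_weight_def norm_mult)

lemma integrable_modulated_weight:
  assumes "0 < r" "r < 1" "0 < \<delta>"
  shows "integrable lborel (modulated_weight r \<delta> b)"
  unfolding modulated_weight_def[abs_def]
  by (intro integrable_mult_character integrable_of_real integrable_weight assms) auto

context lp_function
begin

lemma rapid_inv_fourier_hat_mult:
  assumes "integrable lborel G" "rapid (inv_fourier G)"
  shows "rapid (inv_fourier (\<lambda>\<xi>. fourier \<phi> (c *\<^sub>R \<xi>) * G \<xi>))"
  using rapid_convolution[OF rapid assms(2), of c]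
  by (rule rapid_cong) (rule inv_fourier_fourier_times[OF int assms(1)])

lemma rapid_piece: "rapid (piece (fourier \<phi>) i)"
  unfolding piece_def by (rule rapid_inv_fourier_hat_mult[OF int_hat]) (simp add: inversion rapid)

text \<open>The three factors come from the symbol of the multiplier, from the bump and from the
  Littlewood-Paley projection; convolving the kernel with this function gives the piece of the
  image.\<close>

definition triple :: "'a \<Rightarrow> complex" where
  "triple = inv_fourier (\<lambda>\<xi>. fourier \<phi> \<xi> * (fourier \<phi> \<xi> * fourier \<phi> \<xi>))"

lemma
  shows integrable_hat_square: "integrable lborel (\<lambda>\<xi>. fourier \<phi> \<xi> * fourier \<phi> \<xi>)"
    and integrable_hat_cube: "integrable lborel (\<lambda>\<xi>. fourier \<phi> \<xi> * (fourier \<phi> \<xi> * fourier \<phi> \<xi>))"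
  using integrable_hat_scaled_mult[OF int_hat, of 1]
    integrable_hat_scaled_mult[OF integrable_hat_scaled_mult[OF int_hat, of 1], of 1] by simp_all

lemma rapid_triple: "rapid triple"
proof -
  have "rapid (inv_fourier (\<lambda>\<xi>. fourier \<phi> (1 *\<^sub>R \<xi>) * fourier \<phi> \<xi>))"
    by (rule rapid_inv_fourier_hat_mult[OF int_hat]) (simp add: inversion rapid)
  then have "rapid (inv_fourier (\<lambda>\<xi>. fourier \<phi> (1 *\<^sub>R \<xi>) * (fourier \<phi> \<xi> * fourier \<phi> \<xi>)))"
    by (intro rapid_inv_fourier_hat_mult integrable_hat_square) simp
  then show ?thesis by (simp add: triple_def)
qed

lemma borel_measurable_triple: "triple \<in> borel_measurable borel"
  unfolding triple_def by (intro borel_measurable_inv_fourier integrable_hat_cube)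

lemma fourier_triple: "norm b = 1 \<Longrightarrow> fourier triple b = 1"
proof -
  let ?B = "LINT x|lborel. norm (\<phi> x)"
  have "fourier triple b = fourier \<phi> b * (fourier \<phi> b * fourier \<phi> b)"
    unfolding triple_def
  proof (rule fourier_inv_fourier[OF integrable_hat_cube])
    show "continuous_on UNIV (\<lambda>\<xi>. fourier \<phi> \<xi> * (fourier \<phi> \<xi> * fourier \<phi> \<xi>))"
      by (intro continuous_intros continuous_on_fourier int)
    show "norm (fourier \<phi> \<xi> * (fourier \<phi> \<xi> * fourier \<phi> \<xi>)) \<le> ?B * (?B * ?B)" for \<xi>
      unfolding norm_mult by (intro mult_mono hat_bounded) (auto intro!: mult_nonneg_nonneg integral_nonneg_AE)
    show "integrable lborel (inv_fourier (\<lambda>\<xi>. fourier \<phi> \<xi> * (fourier \<phi> \<xi> * fourier \<phi> \<xi>)))"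
      using integrable_rapid[OF rapid_triple borel_measurable_triple] by (simp add: triple_def)
  qed
  then show "norm b = 1 \<Longrightarrow> fourier triple b = 1"
    by (simp add: hat_unit)
qed

definition symbol :: "('a \<Rightarrow> complex) \<Rightarrow> 'a \<Rightarrow> complex" where
  "symbol w \<xi> = fourier w \<xi> * fourier \<phi> \<xi>"

text \<open>
  The multiplier is the sum over \<open>a\<close> of the dilates of \<open>symbol w\<close> by \<open>2 powr (8 * a)\<close>; their supports
  are disjoint and the rounding selects the only term that can be nonzero.
\<close>

definition lacunary :: "('a \<Rightarrow> complex) \<Rightarrow> 'a \<Rightarrow> complex" where
  "lacunary w \<xi> = symbol w ((2 powr (- (8 * real_of_int (round (log 2 (norm \<xi>) / 8))))) *\<^sub>R \<xi>)"

text \<open>Towards the ends of the annulus the rounded index may be \<open>-1\<close> or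
  \<open>1\<close> instead of 0; there the symbol vanishes both at \<open>\<zeta>\<close> and at its
  rescaling.\<close>

lemma lacunary_dilate:
  assumes "1 / 64 \<le> norm \<zeta>" "norm \<zeta> \<le> 64"
  shows "lacunary w (octave a *\<^sub>R \<zeta>) = symbol w \<zeta>"
proof -
  define l where "l = log 2 (norm \<zeta>)"
  have pos: "0 < norm \<zeta>" using assms(1) by linarith
  have n: "norm \<zeta> = 2 powr l" using pos by (simp add: l_def)
  have a: "2 powr (- 6) \<le> 2 powr l" "2 powr l \<le> 2 powr 6"
    using assms unfolding n[symmetric] by (simp_all add: powr_minus)
  have l: "- 6 \<le> l" "l \<le> 6"
    by (rule powr_le_cancel_iff[THEN iffD1, OF _ a(1)], simp, rule powr_le_cancel_iff[THEN iffD1, OF _ a(2)], simp)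
  define k where "k = round (l / 8)"
  have "log 2 (norm (octave a *\<^sub>R \<zeta>)) / 8 = l / 8 + real_of_int a"
    using pos by (simp add: log_mult l_def)
  moreover have "round (l / 8 + real_of_int a) = k + a"
    unfolding k_def round_def by linarith
  ultimately have rnd: "round (log 2 (norm (octave a *\<^sub>R \<zeta>)) / 8) = k + a"
    by (simp only:)
  have eq: "lacunary w (octave a *\<^sub>R \<zeta>) = symbol w ((2 powr (- (8 * real_of_int k))) *\<^sub>R \<zeta>)"
    unfolding lacunary_def rnd scaleR_scaleR powr_add[symmetric] by (simp add: algebra_simps)
  show ?thesis
  proof (cases "k = 0")
    case False
    have r: "real_of_int k \<le> l / 8 + 1 / 2" "l / 8 - 1 / 2 \<le> real_of_int k"
      unfolding k_def round_def by linarith+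
    have "fourier \<phi> \<zeta> = 0 \<and> fourier \<phi> ((2 powr (- (8 * real_of_int k))) *\<^sub>R \<zeta>) = 0"
    proof (cases "0 < k")
      case True
      then have k1: "1 \<le> real_of_int k" by linarith
      then have "4 \<le> l" using r by linarith
      then have "2 powr 4 \<le> norm \<zeta>"
        unfolding n by (intro powr_mono) auto
      moreover have "norm ((2 powr (- (8 * real_of_int k))) *\<^sub>R \<zeta>) = 2 powr (l - 8 * real_of_int k)"
        by (simp add: n powr_add[symmetric])
      moreover have "2 powr (l - 8 * real_of_int k) \<le> 2 powr (- 1)"
        using l k1 by (intro powr_mono) auto
      ultimately show ?thesis
        by (intro conjI hat_eq_zero) (auto simp: powr_minus)
    next
      case f: False
      then have "k \<le> - 1" using False by linarith
      then have k1: "real_of_int k \<le> - 1" by linarith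
      then have "l \<le> - 4" using r by linarith
      then have "norm \<zeta> \<le> 2 powr (- 4)"
        unfolding n by (intro powr_mono) auto
      moreover have "norm ((2 powr (- (8 * real_of_int k))) *\<^sub>R \<zeta>) = 2 powr (l - 8 * real_of_int k)"
        by (simp add: n powr_add[symmetric])
      moreover have "2 powr 1 \<le> 2 powr (l - 8 * real_of_int k)"
        using l k1 by (intro powr_mono) auto
      ultimately show ?thesis
        by (intro conjI hat_eq_zero) (auto simp: powr_minus)
    qed
    then show ?thesis
      unfolding eq by (simp add: symbol_def)
  qed (simp add: eq)
qed

lemma norm_symbol_le:
  assumes "integrable lborel w"
  shows "norm (symbol w \<xi>) \<le> (LINT x|lborel. norm (w x)) * (LINT x|lborel. norm (\<phi> x))"
  unfolding symbol_def norm_mult using norm_fourier_le[OF assms] hat_bounded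
  by (intro mult_mono) (auto intro!: integral_nonneg_AE)

lemma borel_measurable_symbol:
  "integrable lborel w \<Longrightarrow> symbol w \<in> borel_measurable borel"
  unfolding symbol_def[abs_def] by (intro borel_measurable_times borel_measurable_fourier int)

lemma borel_measurable_lacunary:
  assumes "integrable lborel w"
  shows "lacunary w \<in> borel_measurable borel"
proof -
  note [measurable] = borel_measurable_symbol[OF assms]
  show ?thesis
    unfolding lacunary_def[abs_def] round_def by measurable
qed

lemma lacunary_L_infinity:
  assumes "integrable lborel w"
  shows "lacunary w \<in> L_infinity"
  unfolding L_infinity_def using borel_measurable_lacunary[OF assms] norm_symbol_le[OF assms]
  by (auto simp: lacunary_def)

lemma integrable_symbol_hat:
  assumes "integrable lborel w"
  shows "integrable lborel (\<lambda>\<xi>. symbol w \<xi> * fourier \<phi> \<xi>)"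
  by (rule integrable_mult_bounded[OF int_hat borel_measurable_symbol[OF assms] norm_symbol_le[OF assms]])

text \<open>On the spectrum of a bump of octave \<open>e\<close> the multiplier is the
  \<open>e\<close>-th dilate of the symbol, so the operator only replaces the common profile and
  keeps octaves and centres.\<close>

lemma multiplier_op_superpose:
  assumes w: "integrable lborel w"
  shows "multiplier_op (lacunary w) (superpose \<phi> I) = superpose (inv_fourier (\<lambda>\<xi>. symbol w \<xi> * fourier \<phi> \<xi>)) I"
proof -
  have "lacunary w \<xi> * atom (octave e) c (fourier \<phi>) \<xi>
      = atom (octave e) c (\<lambda>\<xi>. symbol w \<xi> * fourier \<phi> \<xi>) \<xi>" for e c \<xi>
  proof (cases "fourier \<phi> ((1 / octave e) *\<^sub>R \<xi>) = 0")
    case False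
    let ?\<zeta> = "(1 / octave e) *\<^sub>R \<xi>"
    have "1 / 2 < norm ?\<zeta>" "norm ?\<zeta> < 2"
      using False hat_eq_zero[of ?\<zeta>] by (meson not_le)+
    then have "lacunary w (octave e *\<^sub>R ?\<zeta>) = symbol w ?\<zeta>"
      by (intro lacunary_dilate) linarith+
    then show ?thesis by (simp add: atom_def)
  qed (simp add: atom_def)
  then show ?thesis
    unfolding superpose_inv_fourier[OF integrable_symbol_hat[OF w]] multiplier_op_def fourier_superpose
    by (intro arg_cong[where f=inv_fourier] ext) (simp add: sum_distrib_left case_prod_unfold)
qed

text \<open>For any other octave \<open>e\<close> the index \<open>8 * e0\<close> differs from
  \<open>8 * e\<close> by a nonzero multiple of 8, so only bumps of octave \<open>e0\<close>
  contribute, each through the kernel convolved with \<open>triple\<close>.\<close>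

lemma LP_piece_multiplier_op:
  assumes w: "integrable lborel w" and I: "finite I"
  shows "LP_piece \<phi> (8 * e0) (distribution_of (multiplier_op (lacunary w) (superpose \<phi> I))) x
    = (\<Sum>(e, c)\<in>{i \<in> I. fst i = e0}.
        (LINT y|lborel. w y * triple (octave e *\<^sub>R (x - c) - 1 *\<^sub>R y)))"
proof -
  have 0: "piece (\<lambda>\<xi>. symbol w \<xi> * fourier \<phi> \<xi>) 0 z = (LINT y|lborel. w y * triple (z - 1 *\<^sub>R y))" for z
  proof -
    have "piece (\<lambda>\<xi>. symbol w \<xi> * fourier \<phi> \<xi>) 0
        = inv_fourier (\<lambda>\<xi>. fourier w (1 *\<^sub>R \<xi>) * (fourier \<phi> \<xi> * (fourier \<phi> \<xi> * fourier \<phi> \<xi>)))"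
      by (simp add: piece_def symbol_def mult_ac)
    then show ?thesis
      unfolding triple_def by (simp only: inv_fourier_fourier_times[OF w integrable_hat_cube])
  qed
  have "LP_piece \<phi> (8 * e0) (distribution_of (multiplier_op (lacunary w) (superpose \<phi> I))) x
    = (\<Sum>i\<in>I. piece (\<lambda>\<xi>. symbol w \<xi> * fourier \<phi> \<xi>) (8 * e0 - 8 * fst i) (octave (fst i) *\<^sub>R (x - snd i)))"
    unfolding multiplier_op_superpose[OF w] LP_piece_superpose[OF integrable_symbol_hat[OF w]]
    by (simp add: case_prod_unfold)
  also have "\<dots> = (\<Sum>i\<in>{i \<in> I. fst i = e0}. piece (\<lambda>\<xi>. symbol w \<xi> * fourier \<phi> \<xi>) (8 * e0 - 8 * fst i)
      (octave (fst i) *\<^sub>R (x - snd i)))"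
    by (intro sum.mono_neutral_right I) (auto intro!: piece_hat_eq_zero)
  also have "\<dots> = (\<Sum>(e, c)\<in>{i \<in> I. fst i = e0}.
        (LINT y|lborel. w y * triple (octave e *\<^sub>R (x - c) - 1 *\<^sub>R y)))"
    by (intro sum.cong refl) (auto simp: 0)
  finally show ?thesis .
qed

text \<open>By the phase hypothesis one unimodular factor makes the real part of every term
  nonnegative. Hence bumps of one scale do not cancel, and a single term bounds the sum from
  below.\<close>

lemma norm_LP_piece_multiplier_op_ge:
  assumes r: "0 < r" "r < 1" and \<delta>: "0 < \<delta>"
    and lower: "\<And>x. weight r \<delta> x / 2 \<le>
      Re (character (- x) b * (LINT y|lborel. (complex_of_real (weight r \<delta> y) * character y b) * triple (x - y)))"
    and I: "finite I" "(e0, c0) \<in> I"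
    and phase: "\<And>c. (e0, c) \<in> I \<Longrightarrow> character (octave e0 *\<^sub>R (c0 - c)) b = 1"
  shows "weight r \<delta> (octave e0 *\<^sub>R (x - c0)) / 2
    \<le> norm (LP_piece \<phi> (8 * e0) (distribution_of (multiplier_op (lacunary (modulated_weight r \<delta> b)) (superpose \<phi> I))) x)"
proof -
  let ?\<mu> = "octave e0"
  let ?H = "\<lambda>z. LINT y|lborel. modulated_weight r \<delta> b y * triple (z - y)"
  let ?J = "{i \<in> I. fst i = e0}"
  let ?z = "character (- (?\<mu> *\<^sub>R (x - c0))) b"
  have low: "weight r \<delta> (?\<mu> *\<^sub>R (x - c)) / 2 \<le> Re (?z * ?H (?\<mu> *\<^sub>R (x - c)))" if "(e0, c) \<in> I" for c
  proof -
    \<comment> \<open>The phases at \<open>c\<close> and at \<open>c0\<close> differ by the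
      character of \<open>octave e0 *\<^sub>R (c0 - c)\<close>, which is 1.\<close>
    have "- (?\<mu> *\<^sub>R (x - c0)) = ?\<mu> *\<^sub>R (c0 - c) + - (?\<mu> *\<^sub>R (x - c))"
      by (simp add: scaleR_diff_right)
    then have "?z = character (- (?\<mu> *\<^sub>R (x - c))) b"
      using phase[OF that] by (simp only: character_add mult_1_left)
    then show ?thesis
      using lower[of "?\<mu> *\<^sub>R (x - c)"] by (simp add: modulated_weight_def)
  qed
  have w0: "0 \<le> weight r \<delta> z / 2" for z :: 'a
    using weight_pos[of \<delta> r z] \<delta> by simp
  define t where "t i = Re (?z * ?H (?\<mu> *\<^sub>R (x - snd i)))" for i :: "int \<times> 'a"
  have "0 \<le> t i" if "i \<in> ?J" for i
    using low[of "snd i"] w0[of "?\<mu> *\<^sub>R (x - snd i)"] that unfolding t_def by force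
  then have "t (e0, c0) \<le> (\<Sum>i\<in>?J. t i)"
    using I by (intro member_le_sum) auto
  moreover have "weight r \<delta> (?\<mu> *\<^sub>R (x - c0)) / 2 \<le> t (e0, c0)"
    unfolding t_def snd_conv by (rule low[OF I(2)])
  ultimately have "weight r \<delta> (?\<mu> *\<^sub>R (x - c0)) / 2 \<le> (\<Sum>i\<in>?J. Re (?z * ?H (?\<mu> *\<^sub>R (x - snd i))))"
    unfolding t_def by linarith
  also have "\<dots> = Re (?z * (\<Sum>i\<in>?J. ?H (?\<mu> *\<^sub>R (x - snd i))))"
    unfolding sum_distrib_left by (rule Re_sum[symmetric])
  also have "\<dots> \<le> norm (?z * (\<Sum>i\<in>?J. ?H (?\<mu> *\<^sub>R (x - snd i))))"
    by (rule complex_Re_le_cmod)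
  also have "\<dots> = norm (\<Sum>i\<in>?J. ?H (?\<mu> *\<^sub>R (x - snd i)))"
    by (simp add: norm_mult)
  also have "(\<Sum>i\<in>?J. ?H (?\<mu> *\<^sub>R (x - snd i)))
      = LP_piece \<phi> (8 * e0) (distribution_of (multiplier_op (lacunary (modulated_weight r \<delta> b)) (superpose \<phi> I))) x"
    unfolding LP_piece_multiplier_op[OF integrable_modulated_weight[OF r \<delta>] I(1)]
    by (intro sum.cong refl) auto
  finally show ?thesis .
qed

section \<open>Upper bounds: pieces of the test functions, Herz norm of the multiplier\<close>

abbreviation bump_piece :: "int \<Rightarrow> (int \<times> 'a) set \<Rightarrow> 'a \<Rightarrow> complex" where
  "bump_piece j I \<equiv> LP_piece \<phi> j (distribution_of (superpose \<phi> I))"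

text \<open>Only the relative indices \<open>-1\<close>, \<open>0\<close>, \<open>1\<close> give
  nonzero pieces, each rapidly decreasing; the sum of their three constants serves every set of
  bumps.\<close>

lemma norm_LP_piece_superpose_le:
  "\<exists>C>0. \<forall>I j x. finite I \<longrightarrow> norm (bump_piece j I x)
    \<le> C * (\<Sum>(e, c)\<in>{i \<in> I. \<bar>j - 8 * fst i\<bar> \<le> 1}. inverse ((1 + norm (octave e *\<^sub>R (x - c))) ^ A))"
proof -
  let ?V = "\<lambda>y::'a. inverse ((1 + norm y) ^ A)"
  have "\<exists>C. \<forall>i. 0 < C i \<and> (\<forall>y. norm (piece (fourier \<phi>) i y) \<le> C i * ?V y)"
    by (intro choice allI) (metis rapidE[OF rapid_piece])
  then obtain C where C: "\<And>i. 0 < C i" "\<And>i y. norm (piece (fourier \<phi>) i y) \<le> C i * ?V y"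
    by auto
  define K where "K = C (- 1) + C 0 + C 1"
  have K: "0 < K" using C(1) by (simp add: K_def add_pos_pos)
  have V: "0 \<le> ?V y" for y by (auto intro!: zero_le_power add_nonneg_nonneg)
  have b: "norm (piece (fourier \<phi>) i y) \<le> K * ?V y" if "\<bar>i\<bar> \<le> 1" for i y
  proof -
    have "i = - 1 \<or> i = 0 \<or> i = 1" using that by linarith
    then have "C i \<le> K"
      using C(1)[of "- 1"] C(1)[of 0] C(1)[of 1] by (auto simp: K_def)
    then show ?thesis
      using C(2)[of i y] V[of y] by (meson mult_right_mono order_trans)
  qed
  have z: "piece (fourier \<phi>) i y = 0" if "\<not> \<bar>i\<bar> \<le> 1" for i y
    using piece_hat_eq_zero[of i "\<lambda>_. 1"] that by simp
  have "norm (bump_piece j I x)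
    \<le> K * (\<Sum>(e, c)\<in>{i \<in> I. \<bar>j - 8 * fst i\<bar> \<le> 1}. ?V (octave e *\<^sub>R (x - c)))"
    if I: "finite I" for I j x
  proof -
    let ?t = "\<lambda>i. piece (fourier \<phi>) (j - 8 * fst i) (octave (fst i) *\<^sub>R (x - snd i))"
    have "bump_piece j I x = (\<Sum>i\<in>I. ?t i)"
      using LP_piece_superpose[OF int_hat, of j I x] by (simp add: inversion case_prod_unfold)
    also have "\<dots> = (\<Sum>i\<in>{i \<in> I. \<bar>j - 8 * fst i\<bar> \<le> 1}. ?t i)"
      by (intro sum.mono_neutral_right I) (auto simp: z)
    also have "norm \<dots> \<le> (\<Sum>i\<in>{i \<in> I. \<bar>j - 8 * fst i\<bar> \<le> 1}. K * ?V (octave (fst i) *\<^sub>R (x - snd i)))"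
      by (intro sum_norm_le b) simp
    finally show ?thesis
      by (simp add: sum_distrib_left case_prod_unfold)
  qed
  with K show ?thesis by blast
qed

text \<open>The multiplier is invariant under dilation by \<open>2^8\<close>, so the supremum over
  \<open>k\<close> runs over eight functions. Each is the kernel convolved with a rapidly decreasing
  function, hence bounded by a multiple of the weight.\<close>

lemma herz_multiplier_norm_lacunary:
  assumes \<eta>: "cutoff \<eta>" and r: "0 < r" "r < 1" and \<delta>: "0 < \<delta>" "\<delta> \<le> 1" and u: "0 < u" and t: "0 < t"
    and s: "s < real DIM('a) * (1 / r) - real DIM('a) * enn2real (1 / u) \<or>
         (s = real DIM('a) * (1 / r) - real DIM('a) * enn2real (1 / u) \<and> ennreal r < t)"
  shows "herz_multiplier_norm \<eta> u s t (lacunary (modulated_weight r \<delta> b)) < \<infinity>"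
proof -
  let ?w = "modulated_weight r \<delta> b" and ?\<eta> = "\<lambda>\<xi>. complex_of_real (\<eta> \<xi>)"
  note w = integrable_modulated_weight[OF r \<delta>(1), of b]
  have supp: "1 / 4 \<le> norm \<xi> \<and> norm \<xi> \<le> 4" if "\<eta> \<xi> \<noteq> 0" for \<xi>
    using \<eta> that closure_subset[of "{\<xi>. \<eta> \<xi> \<noteq> 0}"] unfolding cutoff_def by blast
  have sm: "smooth ?\<eta>"
    using \<eta> unfolding cutoff_def by (intro smooth_of_real) simp
  have z: "?\<eta> \<xi> = 0" if "4 < norm \<xi>" for \<xi>
    using supp[of \<xi>] that by fastforce
  have \<eta>i: "integrable lborel ?\<eta>"
    using smooth_continuous[OF sm, of "[]"] z by (intro integrable_continuous_compact_support[of _ 4]) auto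
  have \<eta>r: "rapid (inv_fourier ?\<eta>)"
    by (rule rapid_inv_fourier[OF sm z])
  define E where "E i = inv_fourier (\<lambda>\<xi>. symbol ?w ((2 powr real_of_int i) *\<^sub>R \<xi>) * ?\<eta> \<xi>)" for i :: int
  have E: "herz_norm u s t (E i) < \<infinity>" for i
  proof -
    let ?c = "2 powr real_of_int i"
    let ?h = "inv_fourier (\<lambda>\<xi>. fourier \<phi> (?c *\<^sub>R \<xi>) * ?\<eta> \<xi>)"
    have h: "rapid ?h"
      by (rule rapid_inv_fourier_hat_mult[OF \<eta>i \<eta>r])
    have eq: "E i x = (LINT y|lborel. ?w y * ?h (x - ?c *\<^sub>R y))" for x
      unfolding E_def symbol_def mult.assoc
      by (rule inv_fourier_fourier_times[OF w integrable_hat_scaled_mult[OF \<eta>i]])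
    obtain C where C: "0 < C" "\<And>x. norm (E i x) \<le> C * weight r \<delta> x"
      unfolding eq using weight_convolution_bound[of r \<delta> ?w ?h ?c] r \<delta> h norm_modulated_weight[of \<delta> r b] by auto
    have "integrable lborel (\<lambda>\<xi>. fourier ?w (?c *\<^sub>R \<xi>) * (fourier \<phi> (?c *\<^sub>R \<xi>) * ?\<eta> \<xi>))"
      by (rule integrable_mult_bounded[OF integrable_hat_scaled_mult[OF \<eta>i] _ norm_fourier_le[OF w]])
        (auto intro!: measurable_compose[OF _ borel_measurable_fourier[OF w]])
    then have "E i \<in> borel_measurable borel"
      unfolding E_def symbol_def mult.assoc by (rule borel_measurable_inv_fourier)
    then show ?thesis
      by (rule herz_norm_lt_top[OF r(1) \<delta> _ C(2) C(1) u t s])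
  qed
  have "herz_norm u s t (inv_fourier (\<lambda>\<xi>. lacunary ?w ((2 powr real_of_int k) *\<^sub>R \<xi>) * ?\<eta> \<xi>))
      \<le> (\<Sum>i\<in>{- 4..3}. herz_norm u s t (E i))" for k :: int
  proof -
    \<comment> \<open>The shift by 4 centres the remainder \<open>i\<close> in
      \<open>{- 4..3}\<close>, so that the cutoff support dilated by \<open>2^i\<close> stays inside
      the annulus from \<open>1/64\<close> to \<open>64\<close>.\<close>
    define a where "a = (k + 4) div 8"
    define i where "i = k - 8 * a"
    have i: "i \<in> {- 4..3}"
      unfolding i_def a_def by auto
    have "lacunary ?w ((2 powr real_of_int k) *\<^sub>R \<xi>) * ?\<eta> \<xi> = symbol ?w ((2 powr real_of_int i) *\<^sub>R \<xi>) * ?\<eta> \<xi>" for \<xi>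
    proof (cases "\<eta> \<xi> = 0")
      case False
      have "1 / 16 \<le> 2 powr real_of_int i" "2 powr real_of_int i \<le> 8"
        using i powr_mono[of "- 4" "real_of_int i" 2] powr_mono[of "real_of_int i" 3 2]
        by (simp_all add: powr_minus)
      then have "1 / 16 * (1 / 4) \<le> 2 powr real_of_int i * norm \<xi>" "2 powr real_of_int i * norm \<xi> \<le> 8 * 4"
        using supp[OF False] by - (rule mult_mono; simp)+
      then have "1 / 64 \<le> norm ((2 powr real_of_int i) *\<^sub>R \<xi>)" "norm ((2 powr real_of_int i) *\<^sub>R \<xi>) \<le> 64"
        by simp_all
      then have "lacunary ?w (octave a *\<^sub>R ((2 powr real_of_int i) *\<^sub>R \<xi>)) = symbol ?w ((2 powr real_of_int i) *\<^sub>R \<xi>)"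
        by (rule lacunary_dilate)
      moreover have "octave a * 2 powr real_of_int i = 2 powr real_of_int k"
        by (simp add: powr_add[symmetric] i_def)
      ultimately show ?thesis by simp
    qed simp
    then have "inv_fourier (\<lambda>\<xi>. lacunary ?w ((2 powr real_of_int k) *\<^sub>R \<xi>) * ?\<eta> \<xi>) = E i"
      unfolding E_def by (simp only:)
    then show ?thesis
      using i by (simp only:) (intro member_le_sum, auto)
  qed
  then have "herz_multiplier_norm \<eta> u s t (lacunary ?w) \<le> (\<Sum>i\<in>{- 4..3}. herz_norm u s t (E i))"
    unfolding herz_multiplier_norm_def by (rule SUP_least)
  also have "\<dots> < \<infinity>"
    using E by (simp add: less_top)
  finally show ?thesis .
qed

end

section \<open>Grids and digits\<close>

text \<open>Half-open, so that its integer translates partition space and integer parts are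
  unique.\<close>

definition unit_cube :: "'a::euclidean_space set" where
  "unit_cube = {x. \<forall>b\<in>Basis. 0 \<le> x \<bullet> b \<and> x \<bullet> b < 1}"

definition floor_vec :: "'a::euclidean_space \<Rightarrow> 'a" where
  "floor_vec x = (\<Sum>b\<in>Basis. real_of_int \<lfloor>x \<bullet> b\<rfloor> *\<^sub>R b)"

definition frac_vec :: "'a::euclidean_space \<Rightarrow> 'a" where
  "frac_vec x = x - floor_vec x"

definition int_vec :: "'a::euclidean_space \<Rightarrow> bool" where
  "int_vec x \<longleftrightarrow> (\<forall>b\<in>Basis. x \<bullet> b \<in> \<int>)"

text \<open>Given as the image of a function space, from which its cardinality is read off;
  \<open>grid_iff\<close> is the working description.\<close>

definition grid :: "nat \<Rightarrow> 'a::euclidean_space set" where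
  "grid R = (\<lambda>f. \<Sum>b\<in>Basis. real (f b) *\<^sub>R b) ` (Basis \<rightarrow>\<^sub>E {..<R})"

definition half_vec :: "'a::euclidean_space" where
  "half_vec = (\<Sum>b\<in>Basis. (1 / 2) *\<^sub>R b)"

lemma inner_sum_scaleR_Basis [simp]:
  "b \<in> Basis \<Longrightarrow> (\<Sum>c\<in>Basis. g c *\<^sub>R c) \<bullet> (b::'a::euclidean_space) = g b"
  by simp

lemma floor_vec_inner [simp]: "b \<in> Basis \<Longrightarrow> floor_vec x \<bullet> b = real_of_int \<lfloor>x \<bullet> b\<rfloor>"
  unfolding floor_vec_def by simp

lemma frac_vec_inner [simp]: "b \<in> Basis \<Longrightarrow> frac_vec x \<bullet> b = frac (x \<bullet> b)"
  unfolding frac_vec_def frac_def by (simp add: inner_diff_left)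

lemma half_vec_inner [simp]: "b \<in> Basis \<Longrightarrow> half_vec \<bullet> b = 1 / 2"
  unfolding half_vec_def by simp

lemma int_vec_floor_vec [simp]: "int_vec (floor_vec x)"
  by (simp add: int_vec_def)

lemma int_vec_diff: "int_vec x \<Longrightarrow> int_vec y \<Longrightarrow> int_vec (x - y)"
  by (simp add: int_vec_def inner_diff_left)

lemma int_vec_scaleR_nat: "int_vec x \<Longrightarrow> int_vec (real k *\<^sub>R x)"
  by (simp add: int_vec_def)

lemma frac_vec_in_unit_cube [simp]: "frac_vec x \<in> unit_cube"
  by (simp add: unit_cube_def frac_lt_1)

lemma frac_vec_add_int: "int_vec n \<Longrightarrow> frac_vec (n + x) = frac_vec x"
proof (rule euclidean_eqI)
  fix b :: 'a assume b: "b \<in> Basis" and n: "int_vec n"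
  then obtain k where "n \<bullet> b = real_of_int k"
    unfolding int_vec_def by (meson Ints_cases)
  then show "frac_vec (n + x) \<bullet> b = frac_vec x \<bullet> b"
    using b by (simp add: inner_add_left frac_def)
qed

lemma frac_vec_eq: "x \<in> unit_cube \<Longrightarrow> frac_vec x = x"
  by (rule euclidean_eqI) (simp add: unit_cube_def frac_eq)

lemma int_vec_unit_cube_unique:
  assumes "int_vec n" "x - n \<in> unit_cube"
  shows "n = floor_vec x"
proof (rule euclidean_eqI)
  fix b :: 'a assume b: "b \<in> Basis"
  then obtain k where k: "n \<bullet> b = real_of_int k"
    using assms(1) unfolding int_vec_def by (meson Ints_cases)
  have "0 \<le> x \<bullet> b - real_of_int k" "x \<bullet> b - real_of_int k < 1"
    using assms(2) b k by (auto simp: unit_cube_def inner_diff_left)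
  then have "\<lfloor>x \<bullet> b\<rfloor> = k" by linarith
  then show "n \<bullet> b = floor_vec x \<bullet> b"
    using b k by simp
qed

lemma grid_iff: "n \<in> grid R \<longleftrightarrow> int_vec n \<and> (\<forall>b\<in>Basis. 0 \<le> n \<bullet> b \<and> n \<bullet> b < real R)"
proof
  assume "n \<in> grid R"
  then obtain f where f: "f \<in> Basis \<rightarrow>\<^sub>E {..<R}" "n = (\<Sum>b\<in>Basis. real (f b) *\<^sub>R b)"
    by (auto simp: grid_def)
  have "n \<bullet> b = real (f b) \<and> f b < R" if "b \<in> Basis" for b
    using f that by auto
  then show "int_vec n \<and> (\<forall>b\<in>Basis. 0 \<le> n \<bullet> b \<and> n \<bullet> b < real R)"
    by (simp add: int_vec_def)
next
  assume n: "int_vec n \<and> (\<forall>b\<in>Basis. 0 \<le> n \<bullet> b \<and> n \<bullet> b < real R)"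
  define f where "f = (\<lambda>b\<in>Basis. nat \<lfloor>n \<bullet> b\<rfloor>)"
  have f: "real (f b) = n \<bullet> b" "f b < R" if "b \<in> Basis" for b
  proof -
    have "n \<bullet> b \<in> \<int>" using n that by (simp add: int_vec_def)
    then obtain k where k: "n \<bullet> b = real_of_int k" by (rule Ints_cases)
    have "0 \<le> n \<bullet> b" "n \<bullet> b < real R"
      using n that by blast+
    then show "real (f b) = n \<bullet> b" "f b < R"
      unfolding f_def using that k by auto
  qed
  have "n = (\<Sum>b\<in>Basis. real (f b) *\<^sub>R b)"
    by (rule euclidean_eqI) (simp add: f)
  moreover have "f \<in> Basis \<rightarrow>\<^sub>E {..<R}"
    using f(2) by (auto simp: f_def)
  ultimately show "n \<in> grid R"
    unfolding grid_def by blast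
qed

lemma finite_grid [simp]: "finite (grid R)"
  unfolding grid_def by (intro finite_imageI finite_PiE) auto

lemma card_grid: "card (grid R :: 'a::euclidean_space set) = R ^ DIM('a)"
proof -
  have "inj_on (\<lambda>f. \<Sum>b\<in>Basis. real (f b) *\<^sub>R b) ((Basis :: 'a set) \<rightarrow>\<^sub>E {..<R})"
  proof (rule inj_onI)
    fix f g assume f: "f \<in> (Basis :: 'a set) \<rightarrow>\<^sub>E {..<R}" and g: "g \<in> (Basis :: 'a set) \<rightarrow>\<^sub>E {..<R}"
      and eq: "(\<Sum>b\<in>Basis. real (f b) *\<^sub>R b) = (\<Sum>b\<in>(Basis::'a set). real (g b) *\<^sub>R b)"
    show "f = g"
    proof (rule PiE_ext[OF f g])
      fix b :: 'a assume b: "b \<in> Basis"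
      have "(\<Sum>b\<in>Basis. real (f b) *\<^sub>R b) \<bullet> b = (\<Sum>b\<in>(Basis::'a set). real (g b) *\<^sub>R b) \<bullet> b"
        by (simp only: eq)
      then show "f b = g b" using b by simp
    qed
  qed
  then show ?thesis
    unfolding grid_def by (simp add: card_image card_PiE)
qed

lemma norm_unit_cube_le: "x \<in> unit_cube \<Longrightarrow> norm (x :: 'a::euclidean_space) \<le> real DIM('a)"
proof -
  assume x: "x \<in> unit_cube"
  have "norm x \<le> (\<Sum>b\<in>Basis. \<bar>x \<bullet> b\<bar>)" by (rule norm_le_l1)
  also have "\<dots> \<le> (\<Sum>b\<in>(Basis::'a set). 1)"
    using x by (intro sum_mono) (auto simp: unit_cube_def)
  finally show ?thesis by simp
qed

lemma borel_measurable_floor_vec [measurable]: "floor_vec \<in> borel_measurable borel"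
  unfolding floor_vec_def[abs_def] by measurable

lemma borel_measurable_frac_vec [measurable]: "frac_vec \<in> borel_measurable borel"
  unfolding frac_vec_def[abs_def] by measurable

lemma sets_unit_cube [measurable]: "unit_cube \<in> sets borel"
proof -
  have "unit_cube = (\<Inter>b\<in>Basis. {x \<in> space borel. 0 \<le> x \<bullet> b \<and> x \<bullet> b < 1})"
    by (auto simp: unit_cube_def)
  also have "\<dots> \<in> sets borel"
    by (intro sets.finite_INT) auto
  finally show ?thesis .
qed

lemma emeasure_unit_cube: "emeasure lborel (unit_cube :: 'a::euclidean_space set) = 1"
proof (rule antisym)
  have "emeasure lborel (unit_cube :: 'a set) \<le> emeasure lborel (cbox 0 (\<Sum>b\<in>Basis. 1 *\<^sub>R b :: 'a))"
    by (intro emeasure_mono) (auto simp: unit_cube_def mem_box less_imp_le)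
  then show "emeasure lborel (unit_cube :: 'a set) \<le> 1"
    by (simp add: emeasure_lborel_cbox_eq)
  have "box 0 (\<Sum>b\<in>Basis. 1 *\<^sub>R b :: 'a) \<subseteq> unit_cube"
  proof
    fix x assume x: "x \<in> box 0 (\<Sum>b\<in>Basis. 1 *\<^sub>R b :: 'a)"
    have "0 \<le> x \<bullet> b \<and> x \<bullet> b < 1" if "b \<in> Basis" for b
      using bspec[OF x[unfolded mem_box] that] that by simp
    then show "x \<in> unit_cube"
      by (simp add: unit_cube_def)
  qed
  then have "emeasure lborel (box 0 (\<Sum>b\<in>Basis. 1 *\<^sub>R b :: 'a)) \<le> emeasure lborel (unit_cube :: 'a set)"
    by (rule emeasure_mono) simp
  then show "1 \<le> emeasure lborel (unit_cube :: 'a set)"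
    by (simp add: emeasure_lborel_box_eq)
qed

section \<open>Tiling the unit cube, and digits as independent variables\<close>

lemma scaled_unit_cube_iff:
  assumes "0 < R"
  shows "(\<exists>n\<in>grid R. real R *\<^sub>R x - n \<in> unit_cube) \<longleftrightarrow> x \<in> unit_cube"
proof
  assume "\<exists>n\<in>grid R. real R *\<^sub>R x - n \<in> unit_cube"
  then obtain n where n: "n \<in> grid R" "real R *\<^sub>R x - n \<in> unit_cube" by blast
  show "x \<in> unit_cube"
    unfolding unit_cube_def
  proof (intro CollectI ballI)
    fix b :: 'a assume b: "b \<in> Basis"
    obtain k where k: "n \<bullet> b = real_of_int k"
      using n(1) b unfolding grid_iff int_vec_def by (meson Ints_cases)
    have 1: "0 \<le> n \<bullet> b" "n \<bullet> b < real R" "0 \<le> real R * (x \<bullet> b) - n \<bullet> b" "real R * (x \<bullet> b) - n \<bullet> b < 1"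
      using n b by (auto simp: grid_iff unit_cube_def inner_diff_left)
    then have "k + 1 \<le> int R"
      unfolding k by linarith
    then have "real_of_int k + 1 \<le> real R"
      by linarith
    then have "0 \<le> real R * (x \<bullet> b)" "real R * (x \<bullet> b) < real R * 1"
      using 1 k by linarith+
    then show "0 \<le> x \<bullet> b \<and> x \<bullet> b < 1"
      using assms by (simp add: zero_le_mult_iff)
  qed
next
  assume x: "x \<in> unit_cube"
  have "floor_vec (real R *\<^sub>R x) \<in> grid R"
    unfolding grid_iff
  proof (intro conjI int_vec_floor_vec ballI)
    fix b :: 'a assume b: "b \<in> Basis"
    have x: "0 \<le> x \<bullet> b" "x \<bullet> b < 1" using x b by (auto simp: unit_cube_def)
    show "0 \<le> floor_vec (real R *\<^sub>R x) \<bullet> b"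
      using x b by simp
    have "real R * (x \<bullet> b) < real R * 1"
      using x assms by (intro mult_strict_left_mono) auto
    then show "floor_vec (real R *\<^sub>R x) \<bullet> b < real R"
      using b by simp linarith
  qed
  moreover have "real R *\<^sub>R x - floor_vec (real R *\<^sub>R x) \<in> unit_cube"
    using frac_vec_in_unit_cube[of "real R *\<^sub>R x"] by (simp only: frac_vec_def)
  ultimately show "\<exists>n\<in>grid R. real R *\<^sub>R x - n \<in> unit_cube" by blast
qed

lemma indicator_unit_cube_sum:
  assumes "0 < R"
  shows "indicator unit_cube x = (\<Sum>n\<in>grid R. indicator unit_cube (real R *\<^sub>R x - n) :: ennreal)"
proof (cases "x \<in> unit_cube")
  case True
  then obtain n where n: "n \<in> grid R" "real R *\<^sub>R x - n \<in> unit_cube"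
    using scaled_unit_cube_iff[OF assms] by blast
  have uniq: "m = n" if "m \<in> grid R" "real R *\<^sub>R x - m \<in> unit_cube" for m
  proof -
    have "m = floor_vec (real R *\<^sub>R x)"
      using that grid_iff[of m R] by (intro int_vec_unit_cube_unique) blast+
    moreover have "n = floor_vec (real R *\<^sub>R x)"
      using n grid_iff[of n R] by (intro int_vec_unit_cube_unique) blast+
    ultimately show ?thesis by (rule trans[OF _ sym])
  qed
  have "(\<Sum>m\<in>grid R. indicator unit_cube (real R *\<^sub>R x - m) :: ennreal)
      = (\<Sum>m\<in>grid R. if m = n then 1 else 0)"
  proof (rule sum.cong[OF refl])
    fix m :: 'a assume m: "m \<in> grid R"
    show "indicator unit_cube (real R *\<^sub>R x - m) = (if m = n then 1 else 0 :: ennreal)"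
    proof (cases "m = n")
      case False
      then have "real R *\<^sub>R x - m \<notin> unit_cube"
        using uniq[OF m] by blast
      then show ?thesis
        unfolding if_not_P[OF False] by (rule indicator_simps(2))
    next
      case eq: True
      show ?thesis
        unfolding eq using indicator_simps(1)[OF n(2)] by (simp only: if_True simp_thms)
    qed
  qed
  then show ?thesis
    using True n(1) by simp
next
  case False
  then have "real R *\<^sub>R x - n \<notin> unit_cube" if "n \<in> grid R" for n
    using scaled_unit_cube_iff[OF assms] that by blast
  then show ?thesis
    using False by simp
qed

lemma nn_integral_unit_cube_split:
  fixes f :: "'a::euclidean_space \<Rightarrow> ennreal"
  assumes [measurable]: "f \<in> borel_measurable borel" and R: "0 < R"
  shows "(\<integral>\<^sup>+x\<in>unit_cube. f x \<partial>lborel)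
    = (\<Sum>n\<in>grid R. ennreal (1 / real R ^ DIM('a)) * (\<integral>\<^sup>+z\<in>unit_cube. f ((1 / real R) *\<^sub>R (n + z)) \<partial>lborel))"
proof -
  have "(\<integral>\<^sup>+x\<in>unit_cube. f x \<partial>lborel)
      = (\<integral>\<^sup>+x. (\<Sum>n\<in>grid R. f x * indicator unit_cube (real R *\<^sub>R x - n)) \<partial>lborel)"
    by (subst (1) indicator_unit_cube_sum[OF R]) (simp add: sum_distrib_left)
  also have "\<dots> = (\<Sum>n\<in>grid R. \<integral>\<^sup>+x. f x * indicator unit_cube (real R *\<^sub>R x - n) \<partial>lborel)"
    by (rule nn_integral_sum) measurable
  also have "\<dots> = (\<Sum>n\<in>grid R. ennreal (1 / real R ^ DIM('a)) * (\<integral>\<^sup>+z\<in>unit_cube. f ((1 / real R) *\<^sub>R (n + z)) \<partial>lborel))"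
  proof (rule sum.cong[OF refl])
    fix n :: 'a
    let ?g = "\<lambda>z. f ((1 / real R) *\<^sub>R (n + z)) * indicator unit_cube z"
    have "(\<integral>\<^sup>+x. ?g (- n + real R *\<^sub>R x) \<partial>lborel) = ennreal (1 / \<bar>real R\<bar> ^ DIM('a)) * (\<integral>\<^sup>+z. ?g z \<partial>lborel)"
      using R by (intro nn_integral_lborel_affine) auto
    moreover have "?g (- n + real R *\<^sub>R x) = f x * indicator unit_cube (real R *\<^sub>R x - n)" for x
      using R by simp
    ultimately show "(\<integral>\<^sup>+x. f x * indicator unit_cube (real R *\<^sub>R x - n) \<partial>lborel)
        = ennreal (1 / real R ^ DIM('a)) * (\<integral>\<^sup>+z\<in>unit_cube. f ((1 / real R) *\<^sub>R (n + z)) \<partial>lborel)"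
      by simp
  qed
  finally show ?thesis .
qed

text \<open>On each of the \<open>M^d\<close> subcells the map is a scaling onto the unit cube, so
  altogether it preserves the measure.\<close>

lemma nn_integral_unit_cube_frac:
  fixes g :: "'a::euclidean_space \<Rightarrow> ennreal"
  assumes [measurable]: "g \<in> borel_measurable borel" and M: "0 < M"
  shows "(\<integral>\<^sup>+x\<in>unit_cube. g (frac_vec (real M *\<^sub>R x)) \<partial>lborel) = (\<integral>\<^sup>+z\<in>unit_cube. g z \<partial>lborel)"
proof -
  have "(\<integral>\<^sup>+z\<in>unit_cube. g (frac_vec (real M *\<^sub>R (1 / real M) *\<^sub>R (n + z))) \<partial>lborel)
      = (\<integral>\<^sup>+z\<in>unit_cube. g z \<partial>lborel)" if "n \<in> grid M" for n :: 'a
    using that M by (intro nn_integral_cong) (auto simp: grid_iff frac_vec_add_int frac_vec_eq indicator_def)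
  then have "(\<integral>\<^sup>+x\<in>unit_cube. g (frac_vec (real M *\<^sub>R x)) \<partial>lborel)
      = (\<Sum>n\<in>(grid M :: 'a set). ennreal (1 / real M ^ DIM('a)) * (\<integral>\<^sup>+z\<in>unit_cube. g z \<partial>lborel))"
    by (subst nn_integral_unit_cube_split[OF _ M]) (auto intro!: sum.cong)
  also have "\<dots> = (ennreal (real M ^ DIM('a)) * ennreal (1 / real M ^ DIM('a))) * (\<integral>\<^sup>+z\<in>unit_cube. g z \<partial>lborel)"
    by (simp add: card_grid mult.assoc ennreal_of_nat_eq_real_of_nat flip: of_nat_power)
  also have "ennreal (real M ^ DIM('a)) * ennreal (1 / real M ^ DIM('a)) = 1"
    using M by (subst ennreal_mult[symmetric]) auto
  finally show ?thesis by simp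
qed

text \<open>The base \<open>R\<close> digits in position \<open>m + 1\<close> after the point,
  coordinate by coordinate.\<close>

definition digit :: "nat \<Rightarrow> nat \<Rightarrow> 'a::euclidean_space \<Rightarrow> 'a" where
  "digit R m x = floor_vec (real R *\<^sub>R frac_vec (real (R ^ m) *\<^sub>R x))"

lemma borel_measurable_digit [measurable]: "digit R m \<in> borel_measurable borel"
  unfolding digit_def[abs_def] by measurable

text \<open>Passing from \<open>z\<close> to \<open>(n + z)/R\<close> puts the digit
  \<open>n\<close> in front of the expansion of \<open>z\<close>.\<close>

lemma digit_split:
  assumes R: "0 < R" and n: "n \<in> grid R" and z: "z \<in> unit_cube"
  shows "digit R 0 ((1 / real R) *\<^sub>R (n + z)) = n"
    and "digit R (Suc m) ((1 / real R) *\<^sub>R (n + z)) = digit R m z"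
proof -
  let ?x = "(1 / real R) *\<^sub>R (n + z)"
  have "real R *\<^sub>R ?x - n \<in> unit_cube"
    using R z by simp
  then have "?x \<in> unit_cube"
    using scaled_unit_cube_iff[OF R, of ?x] n by blast
  then have "digit R 0 ?x = floor_vec (n + z)"
    using R by (simp add: digit_def frac_vec_eq)
  also have "\<dots> = n"
    using int_vec_unit_cube_unique[of n "n + z"] n z by (simp add: grid_iff)
  finally show "digit R 0 ?x = n" .
  have "real (R ^ Suc m) *\<^sub>R ?x = real (R ^ m) *\<^sub>R n + real (R ^ m) *\<^sub>R z"
    using R by (simp add: scaleR_add_right)
  moreover have "int_vec (real (R ^ m) *\<^sub>R n)"
    using n by (intro int_vec_scaleR_nat) (simp add: grid_iff)
  ultimately show "digit R (Suc m) ?x = digit R m z"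
    unfolding digit_def by (simp only: frac_vec_add_int)
qed

text \<open>Independence of the digits under Lebesgue measure: cutting the cube into
  \<open>R^d\<close> cells splits off the first digit, and the remaining ones are the digits of the
  rescaled variable.\<close>

lemma nn_integral_prod_digits:
  fixes v :: "'a::euclidean_space \<Rightarrow> ennreal"
  assumes [measurable]: "v \<in> borel_measurable borel" and R: "0 < R"
  shows "(\<integral>\<^sup>+x\<in>unit_cube. (\<Prod>m<N. v (digit R m x)) \<partial>lborel)
    = (\<Sum>n\<in>grid R. ennreal (1 / real R ^ DIM('a)) * v n) ^ N"
proof (induction N)
  case 0
  show ?case by (simp add: emeasure_unit_cube)
next
  case (Suc N)
  let ?J = "\<integral>\<^sup>+x\<in>unit_cube. (\<Prod>m<N. v (digit R m x)) \<partial>lborel"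
  have "(\<integral>\<^sup>+z\<in>unit_cube. (\<Prod>m<Suc N. v (digit R m ((1 / real R) *\<^sub>R (n + z)))) \<partial>lborel) = v n * ?J"
    if n: "n \<in> grid R" for n :: 'a
  proof -
    have "(\<integral>\<^sup>+z\<in>unit_cube. (\<Prod>m<Suc N. v (digit R m ((1 / real R) *\<^sub>R (n + z)))) \<partial>lborel)
       = (\<integral>\<^sup>+z. v n * ((\<Prod>m<N. v (digit R m z)) * indicator unit_cube z) \<partial>lborel)"
      by (intro nn_integral_cong)
        (auto simp: prod.lessThan_Suc_shift digit_split[OF R n] indicator_def simp del: prod.lessThan_Suc)
    also have "\<dots> = v n * ?J"
      by (rule nn_integral_cmult) measurable
    finally show ?thesis .
  qed
  then have "(\<integral>\<^sup>+x\<in>unit_cube. (\<Prod>m<Suc N. v (digit R m x)) \<partial>lborel)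
     = (\<Sum>n\<in>grid R. ennreal (1 / real R ^ DIM('a)) * (v n * ?J))"
    by (subst nn_integral_unit_cube_split[OF _ R])
      (auto intro!: sum.cong borel_measurable_prod_ennreal simp del: prod.lessThan_Suc)
  also have "\<dots> = (\<Sum>n\<in>grid R. ennreal (1 / real R ^ DIM('a)) * v n) * ?J"
    by (simp add: sum_distrib_right mult.assoc)
  finally show ?case
    by (simp add: Suc.IH)
qed

lemma decay_mono:
  fixes x y :: "'a::euclidean_space"
  assumes D: "0 \<le> D" and K: "0 < K" and le: "1 + norm x \<le> K * (1 + norm y)"
  shows "decay D y \<le> K powr D * decay D x"
proof -
  have pos: "0 < 1 + norm x" "0 < 1 + norm y" by (simp_all add: add_pos_nonneg)
  have "(1 + norm x) powr D \<le> K powr D * (1 + norm y) powr D"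
    using powr_mono2[OF D _ le] K pos by (simp add: powr_mult)
  moreover define a b where "a = (1 + norm x) powr D" and "b = (1 + norm y) powr D"
  moreover have "0 < a" "0 < b"
    using pos by (auto simp: a_def b_def)
  ultimately have "1 / b \<le> K powr D * (1 / a)"
    by (simp add: field_simps)
  then show ?thesis
    by (simp add: a_def b_def powr_minus_divide)
qed

text \<open>Comparison with an integral: up to \<open>(1 + d) powr D\<close>, the value at a lattice
  point is at most the mean over the unit cube attached to it, and these cubes are disjoint.\<close>

lemma lattice_sum_bounded:
  assumes D: "real DIM('a::euclidean_space) < D"
  shows "\<exists>C>0. \<forall>(x::'a) S. finite S \<longrightarrow> (\<forall>n\<in>S. int_vec n) \<longrightarrow> (\<Sum>n\<in>S. decay D (x - n)) \<le> C"
proof -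
  let ?d = "real DIM('a)"
  let ?k = "\<lambda>y::'a. decay D y"
  define J where "J = (LINT y|lborel. ?k y)"
  have Ji: "(\<integral>\<^sup>+y. ennreal (?k y) \<partial>lborel) = ennreal J"
    unfolding J_def by (rule nn_integral_eq_integral[OF integrable_decay[OF D]]) simp
  have J0: "0 \<le> J" unfolding J_def by (intro integral_nonneg_AE) simp
  let ?K = "(1 + ?d) powr D"
  have "(\<Sum>n\<in>S. ?k (x - n)) \<le> ?K * J" if S: "finite S" "\<And>n. n \<in> S \<Longrightarrow> int_vec n" for x S
  proof -
    have le: "ennreal (?k (x - n)) \<le> (\<integral>\<^sup>+y. ennreal (?K * ?k (x - y)) * indicator unit_cube (y - n) \<partial>lborel)" for n
    proof -
      have "ennreal (?k (x - n)) = ennreal (?k (x - n)) * (\<integral>\<^sup>+y. indicator unit_cube (- n + 1 *\<^sub>R y) \<partial>lborel)"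
        by (subst nn_integral_lborel_affine) (auto simp: emeasure_unit_cube)
      also have "\<dots> = (\<integral>\<^sup>+y. ennreal (?k (x - n)) * indicator unit_cube (- n + 1 *\<^sub>R y) \<partial>lborel)"
        by (rule nn_integral_cmult[symmetric]) measurable
      also have "\<dots> \<le> (\<integral>\<^sup>+y. ennreal (?K * ?k (x - y)) * indicator unit_cube (y - n) \<partial>lborel)"
      proof (intro nn_integral_mono)
        fix y
        have "?k (x - n) \<le> ?K * ?k (x - y)" if u: "y - n \<in> unit_cube"
        proof (rule decay_mono)
          have "1 + norm (x - y) \<le> (1 + norm (x - n)) * (1 + norm (n - y))"
            using peetre[of "x - y" "x - n"] by simp
          also have "\<dots> \<le> (1 + norm (x - n)) * (1 + ?d)"
            using norm_unit_cube_le[OF u] by (intro mult_left_mono) (auto simp: norm_minus_commute)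
          finally show "1 + norm (x - y) \<le> (1 + ?d) * (1 + norm (x - n))"
            by (simp add: mult.commute)
        qed (use D in auto)
        then show "ennreal (?k (x - n)) * indicator unit_cube (- n + 1 *\<^sub>R y) \<le> ennreal (?K * ?k (x - y)) * indicator unit_cube (y - n)"
          by (auto simp: indicator_def intro!: ennreal_leI)
      qed
      finally show ?thesis .
    qed
    have one: "(\<Sum>n\<in>S. indicator unit_cube (y - n) :: ennreal) \<le> 1" for y
    proof (cases "floor_vec y \<in> S")
      case True
      have "(\<Sum>n\<in>S. indicator unit_cube (y - n) :: ennreal) \<le> (\<Sum>n\<in>S. if n = floor_vec y then 1 else 0)"
        using int_vec_unit_cube_unique[OF S(2)] by (intro sum_mono) (auto simp: indicator_def)
      then show ?thesis
        using S(1) True by simp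
    next
      case False
      have "(\<Sum>n\<in>S. indicator unit_cube (y - n) :: ennreal) = 0"
        using int_vec_unit_cube_unique[OF S(2)] False by (intro sum.neutral) (auto simp: indicator_def)
      then show ?thesis by simp
    qed
    have "ennreal (\<Sum>n\<in>S. ?k (x - n)) = (\<Sum>n\<in>S. ennreal (?k (x - n)))"
      by simp
    also have "\<dots> \<le> (\<Sum>n\<in>S. \<integral>\<^sup>+y. ennreal (?K * ?k (x - y)) * indicator unit_cube (y - n) \<partial>lborel)"
      by (intro sum_mono le)
    also have "\<dots> = (\<integral>\<^sup>+y. (\<Sum>n\<in>S. ennreal (?K * ?k (x - y)) * indicator unit_cube (y - n)) \<partial>lborel)"
      by (rule nn_integral_sum[symmetric]) measurable
    also have "\<dots> \<le> (\<integral>\<^sup>+y. ennreal (?K * ?k (x - y)) \<partial>lborel)"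
      using one by (intro nn_integral_mono) (simp add: sum_distrib_left[symmetric] mult_left_le)
    also have "\<dots> = (\<integral>\<^sup>+y. ennreal ?K * ennreal (?k y) \<partial>lborel)"
      by (subst nn_integral_lborel_reflect[where f="\<lambda>y. ennreal (?K * ?k y)"]) (auto simp: ennreal_mult)
    also have "\<dots> = ennreal (?K * J)"
      using J0 by (subst nn_integral_cmult) (auto simp: Ji ennreal_mult)
    finally show ?thesis
      using J0 by (subst (asm) ennreal_le_iff) auto
  qed
  moreover have "?K * J \<le> ?K * J + 1" "0 < ?K * J + 1"
    using J0 by (auto intro!: add_nonneg_pos mult_nonneg_nonneg)
  ultimately show ?thesis
    by (intro exI[of _ "?K * J + 1"]) (meson order_trans)
qed

section \<open>Moments of superpositions\<close>

lemma powr_add_le: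
  fixes a b Q :: real
  assumes "0 \<le> a" "0 \<le> b" "0 < Q" "Q \<le> 1"
  shows "(a + b) powr Q \<le> a powr Q + b powr Q"
proof (cases "a + b = 0")
  case False
  then have s: "0 < a + b" using assms by linarith
  have *: "x \<le> x powr Q" if "0 \<le> x" "x \<le> 1" for x :: real
    using powr_mono'[of Q 1 x] that assms by (cases "x = 0") auto
  have "1 = a / (a + b) + b / (a + b)"
    using s by (simp add: add_divide_distrib[symmetric])
  also have "\<dots> \<le> (a / (a + b)) powr Q + (b / (a + b)) powr Q"
    using assms s by (intro add_mono *) auto
  also have "\<dots> = (a powr Q + b powr Q) / (a + b) powr Q"
    using assms s by (simp add: powr_divide add_divide_distrib)
  finally show ?thesis
    using s by (simp add: field_simps)
qed (use assms in auto)

lemma powr_add_le_2: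
  fixes a b T :: real
  assumes "0 \<le> a" "0 \<le> b" "0 \<le> T"
  shows "(a + b) powr T \<le> 2 powr T * (a powr T + b powr T)"
proof -
  have "(a + b) powr T \<le> (2 * max a b) powr T"
    using assms by (intro powr_mono2) auto
  also have "\<dots> = 2 powr T * max a b powr T"
    using assms by (simp add: powr_mult)
  also have "\<dots> \<le> 2 powr T * (a powr T + b powr T)"
    by (intro mult_left_mono) (auto simp: max_def)
  finally show ?thesis .
qed

text \<open>From \<open>x/T \<le> exp (x/T)\<close>; it lets one exponential moment control power
  moments of any order.\<close>

lemma powr_le_exp:
  fixes x T :: real
  assumes "0 \<le> x" "0 < T"
  shows "x powr T \<le> T powr T * exp x"
proof (cases "x = 0")
  case False
  then have x: "0 < x" using assms by simp
  have "x / T \<le> exp (x / T)"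
    using exp_ge_add_one_self[of "x / T"] by linarith
  then have "(x / T) powr T \<le> exp (x / T) powr T"
    using assms x by (intro powr_mono2) auto
  also have "\<dots> = exp x"
    using assms by (simp add: powr_def)
  finally show ?thesis
    using assms x by (simp add: powr_divide field_simps)
qed (use assms in auto)

text \<open>The position of \<open>x\<close> relative to the centre of its cell of side \<open>1 / M\<close>, in the scale \<open>R * M\<close>.\<close>

abbreviation cell_pos :: "nat \<Rightarrow> nat \<Rightarrow> 'a::euclidean_space \<Rightarrow> 'a" where
  "cell_pos R M x \<equiv> real R *\<^sub>R (frac_vec (real M *\<^sub>R x) - half_vec)"

text \<open>
  The contribution of the cell containing \<open>x\<close> is separated from all the others, which are at
  distance at least \<open>R / 2\<close> in the scaled coordinates.
\<close>

lemma cell_sum_le: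
  assumes A: "2 * real DIM('a::euclidean_space) < A"
  shows "\<exists>C>0. \<forall>(R::nat) (M::nat) x::'a. 1 \<le> R \<longrightarrow> 1 \<le> M \<longrightarrow>
    (\<Sum>n\<in>grid M. decay A (real R *\<^sub>R (real M *\<^sub>R x - n - half_vec)))
    \<le> indicator unit_cube x * decay A (cell_pos R M x)
      + C * real R powr (- A) * decay (A / 2) x"
proof -
  let ?d = "real DIM('a)"
  have d: "1 \<le> ?d" using DIM_positive[where 'a='a] by linarith
  have A2: "?d < A / 2" using A by simp
  obtain L where L: "0 < L" "\<And>(x::'a) S. finite S \<Longrightarrow> (\<And>n. n \<in> S \<Longrightarrow> int_vec n) \<Longrightarrow>
      (\<Sum>n\<in>S. decay (A / 2) (x - n)) \<le> L"
    using lattice_sum_bounded[OF A2] by metis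
  \<comment> \<open>The first factor compares the distance from a far cell with the distance from
    its centre, the second turns decay in the grid into decay in \<open>x\<close>.\<close>
  define K where "K = (3 * (1 + ?d)) powr A * (1 + ?d) powr (A / 2)"
  have K: "0 < K" unfolding K_def using d by simp
  show ?thesis
  proof (intro exI[of _ "K * L"] conjI allI impI)
    show "0 < K * L" using K L by simp
    fix R M :: nat and x :: 'a assume R: "1 \<le> R" and M: "1 \<le> M"
    let ?y = "real M *\<^sub>R x"
    let ?t = "\<lambda>n. decay A (real R *\<^sub>R (?y - n - half_vec))"
    let ?B = "{n \<in> grid M. ?y - n \<in> unit_cube}"
    have far: "?t n \<le> (K * real R powr (- A) * decay (A / 2) x) * decay (A / 2) (?y - n)"
      if n: "n \<in> grid M" "?y - n \<notin> unit_cube" for n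
    proof -
      \<comment> \<open>Outside the cell some coordinate is at least 1/2 away from the centre; this
        is the source of the factor \<open>R powr (- A)\<close>.\<close>
      obtain b where b: "b \<in> Basis" "(?y - n) \<bullet> b < 0 \<or> 1 \<le> (?y - n) \<bullet> b"
        using n(2) by (auto simp: unit_cube_def not_less not_le)
      have "1 / 2 \<le> \<bar>(?y - n - half_vec) \<bullet> b\<bar>"
        using b by (auto simp: inner_diff_left)
      also have "\<dots> \<le> norm (?y - n - half_vec)"
        by (rule Basis_le_norm[OF b(1)])
      finally have h: "1 / 2 \<le> norm (?y - n - half_vec)" .
      have "norm (half_vec :: 'a) \<le> ?d"
        by (rule norm_unit_cube_le) (simp add: unit_cube_def)
      then have "1 + norm (?y - n) \<le> 1 + norm (?y - n - half_vec) + ?d"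
        using norm_triangle_ineq[of "?y - n - half_vec" half_vec] by simp
      also have "\<dots> \<le> 3 * (1 + ?d) * norm (?y - n - half_vec)"
      proof -
        define N e where "N = norm (?y - n - half_vec)" and "e = (1 + ?d) * N"
        have "(1 + ?d) * (1 / 2) \<le> e" "1 * N \<le> e"
          unfolding e_def using h mult_right_mono[of 1 "1 + ?d" N] by (auto simp: N_def intro!: mult_left_mono)
        moreover have "1 + N + t \<le> 3 * e" if "(1 + t) * (1 / 2) \<le> e" "1 * N \<le> e" for t
          using that by (simp add: field_simps)
        ultimately have "1 + N + ?d \<le> 3 * e" by blast
        then show ?thesis
          by (simp only: N_def e_def mult.assoc)
      qed
      finally have "1 + norm (?y - n) \<le> 3 * (1 + ?d) * norm (?y - n - half_vec)" .
      then have "real R * (1 + norm (?y - n)) \<le> real R * (3 * (1 + ?d) * norm (?y - n - half_vec))"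
        by (intro mult_left_mono) auto
      also have "\<dots> = 3 * (1 + ?d) * norm (real R *\<^sub>R (?y - n - half_vec))"
        unfolding norm_scaleR by simp
      also have "\<dots> \<le> 3 * (1 + ?d) * (1 + norm (real R *\<^sub>R (?y - n - half_vec)))"
        by (intro mult_left_mono) auto
      finally have 1: "real R * (1 + norm (?y - n)) \<le> 3 * (1 + ?d) * (1 + norm (real R *\<^sub>R (?y - n - half_vec)))" .
      have pos: "0 < 1 + norm (?y - n)" by (simp add: add_pos_nonneg)
      have "(real R * (1 + norm (?y - n))) powr A
          \<le> (3 * (1 + ?d)) powr A * (1 + norm (real R *\<^sub>R (?y - n - half_vec))) powr A"
        using powr_mono2[OF _ _ 1, of A] A d by (simp add: powr_mult)
      then have "?t n \<le> (3 * (1 + ?d)) powr A * (real R * (1 + norm (?y - n))) powr (- A)"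
      proof -
        define p q where "p = (real R * (1 + norm (?y - n))) powr A"
          and "q = (1 + norm (real R *\<^sub>R (?y - n - half_vec))) powr A"
        have "0 < real R * (1 + norm (?y - n))"
          using R pos by (intro mult_pos_pos) auto
        moreover have "0 < 1 + norm (real R *\<^sub>R (?y - n - half_vec))"
          by (intro add_pos_nonneg) auto
        ultimately have "0 < p" "0 < q"
          unfolding p_def q_def powr_gt_zero by (metis less_irrefl)+
        moreover assume "(real R * (1 + norm (?y - n))) powr A
          \<le> (3 * (1 + ?d)) powr A * (1 + norm (real R *\<^sub>R (?y - n - half_vec))) powr A"
        then have "p \<le> (3 * (1 + ?d)) powr A * q"
          by (simp only: p_def q_def)
        ultimately have "1 / q \<le> (3 * (1 + ?d)) powr A * (1 / p)"
          by (simp add: field_simps)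
        then show ?thesis
          by (simp only: p_def q_def powr_minus_divide)
      qed
      \<comment> \<open>The exponent is split into halves: one is summed over the lattice, the other
        is traded for decay in \<open>x\<close>.\<close>
      also have "\<dots> = (3 * (1 + ?d)) powr A * (real R powr (- A) * (decay (A / 2) (?y - n) * decay (A / 2) (?y - n)))"
        using R pos by (simp add: powr_mult powr_add[symmetric])
      also have "\<dots> \<le> (3 * (1 + ?d)) powr A * (real R powr (- A) * (decay (A / 2) (?y - n) *
          ((1 + ?d) powr (A / 2) * decay (A / 2) x)))"
      proof (intro mult_left_mono)
        show "decay (A / 2) (?y - n) \<le> (1 + ?d) powr (A / 2) * decay (A / 2) x"
        proof (rule decay_mono)
          have "norm n \<le> (\<Sum>b\<in>Basis. \<bar>n \<bullet> b\<bar>)" by (rule norm_le_l1)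
          also have "\<dots> \<le> (\<Sum>b\<in>(Basis::'a set). real M)"
            using n(1) by (intro sum_mono) (auto simp: grid_iff intro: less_imp_le)
          finally have "norm n \<le> ?d * real M" by simp
          moreover have "norm ?y \<le> norm (?y - n) + norm n"
            using norm_triangle_ineq[of "?y - n" n] by simp
          ultimately have "real M * norm x \<le> norm (?y - n) + ?d * real M"
            by simp
          also have "\<dots> \<le> real M * norm (?y - n) + ?d * real M"
            using M mult_right_mono[of 1 "real M" "norm (?y - n)"] by simp
          finally have "real M * norm x \<le> real M * (norm (?y - n) + ?d)"
            by (simp add: algebra_simps)
          then have "norm x \<le> norm (?y - n) + ?d"
            using M by (simp only: mult_le_cancel_left_pos of_nat_0_less_iff)
          moreover have "0 \<le> ?d * norm (?y - n)" by simp
          ultimately have "1 + norm x \<le> 1 + norm (?y - n) + ?d + ?d * norm (?y - n)"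
            by linarith
          also have "\<dots> = (1 + ?d) * (1 + norm (?y - n))"
            by (simp add: algebra_simps)
          finally show "1 + norm x \<le> (1 + ?d) * (1 + norm (?y - n))" .
        qed (use A d in auto)
      qed auto
      finally show ?thesis
        unfolding K_def by (simp only: mult_ac)
    qed
    have near: "(\<Sum>n\<in>?B. ?t n) \<le> indicator unit_cube x * decay A (real R *\<^sub>R (frac_vec ?y - half_vec))"
    proof (cases "?B = {}")
      case False
      then obtain n where n: "n \<in> grid M" "?y - n \<in> unit_cube" by blast
      have x: "x \<in> unit_cube"
        using scaled_unit_cube_iff[of M x] M n by auto
      have "?B \<subseteq> {floor_vec ?y}"
        using int_vec_unit_cube_unique[of _ ?y] grid_iff[of _ M] by blast
      then have "(\<Sum>n\<in>?B. ?t n) \<le> (\<Sum>n\<in>{floor_vec ?y}. ?t n)"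
        by (intro sum_mono2) auto
      also have "\<dots> = decay A (real R *\<^sub>R (frac_vec ?y - half_vec))"
        by (simp add: frac_vec_def)
      finally show ?thesis using x by simp
    next
      case True
      show ?thesis unfolding True by simp
    qed
    have "(\<Sum>n\<in>grid M. ?t n) = (\<Sum>n\<in>?B. ?t n) + (\<Sum>n\<in>grid M - ?B. ?t n)"
      by (subst add.commute, rule sum.subset_diff) auto
    also have "\<dots> \<le> (\<Sum>n\<in>?B. ?t n) + (\<Sum>n\<in>grid M - ?B. (K * real R powr (- A) * decay (A / 2) x) * decay (A / 2) (?y - n))"
      using far by (intro add_left_mono sum_mono) auto
    also have "\<dots> \<le> (\<Sum>n\<in>?B. ?t n) + (K * real R powr (- A) * decay (A / 2) x) * L"
      unfolding sum_distrib_left[symmetric] using K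
      by (intro add_left_mono mult_left_mono L) (auto simp: grid_iff)
    finally show "(\<Sum>n\<in>grid M. ?t n)
      \<le> indicator unit_cube x * decay A (real R *\<^sub>R (frac_vec ?y - half_vec))
        + K * L * real R powr (- A) * decay (A / 2) x"
      using near by (simp add: mult_ac)
  qed
qed

text \<open>
  The digits are independent, so the exponential moment factorises into \<open>N = R ^ DIM('a)\<close> equal
  factors of the form \<open>1 + O (1 / N)\<close>.
\<close>

lemma exp_moment_bounded:
  assumes D: "real DIM('a::euclidean_space) < D"
  shows "\<exists>E. \<forall>R::nat. 1 \<le> R \<longrightarrow>
    (\<integral>\<^sup>+x\<in>unit_cube. ennreal (exp (\<Sum>m<R ^ DIM('a).
        decay D (cell_pos R (R ^ m) x))) \<partial>(lborel :: 'a measure))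
    \<le> ennreal E"
proof -
  let ?d = "real DIM('a)"
  obtain L where L: "0 < L" "\<And>(x::'a) S. finite S \<Longrightarrow> (\<And>n. n \<in> S \<Longrightarrow> int_vec n) \<Longrightarrow>
      (\<Sum>n\<in>S. decay D (x - n)) \<le> L"
    using lattice_sum_bounded[OF D] by metis
  define \<kappa> where "\<kappa> = (1 + ?d) powr D"
  have \<kappa>: "0 < \<kappa>" by (simp add: \<kappa>_def)
  show ?thesis
  proof (intro exI[of _ "exp (\<kappa> * exp \<kappa> * L)"] allI impI)
    fix R :: nat assume R: "1 \<le> R"
    let ?N = "R ^ DIM('a)"
    define v where "v n = exp (\<kappa> * decay D (real R *\<^sub>R half_vec - n))" for n :: 'a
    \<comment> \<open>Linearises the exponential for \<open>t \<le> 1\<close>, so that the excess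
      over 1 can be summed over the lattice.\<close>
    have v_le: "v n \<le> 1 + \<kappa> * exp \<kappa> * decay D (real R *\<^sub>R half_vec - n)" for n
    proof -
      define t where "t = decay D (real R *\<^sub>R half_vec - n)"
      have "t \<le> 1 powr (- D)"
        unfolding t_def using D by (intro powr_mono2') auto
      then have t: "0 \<le> t" "t \<le> 1"
        by (auto simp: t_def)
      have "1 - \<kappa> * t \<le> exp (- (\<kappa> * t))"
        using exp_ge_add_one_self[of "- (\<kappa> * t)"] by linarith
      then have "(1 - \<kappa> * t) * exp (\<kappa> * t) \<le> exp (- (\<kappa> * t)) * exp (\<kappa> * t)"
        by (intro mult_right_mono) auto
      then have "exp (\<kappa> * t) \<le> 1 + \<kappa> * t * exp (\<kappa> * t)"
        by (simp add: exp_minus algebra_simps)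
      also have "\<dots> \<le> 1 + \<kappa> * t * exp \<kappa>"
        using \<kappa> t by (intro add_left_mono mult_left_mono) (auto simp: mult_left_le)
      finally show ?thesis
        by (simp add: v_def t_def mult_ac)
    qed
    \<comment> \<open>Replacing the exact position by the digit moves the point by at most
      \<open>d\<close>, at the cost of the factor \<open>\<kappa>\<close>.\<close>
    have pw: "decay D (real R *\<^sub>R (frac_vec z - half_vec))
        \<le> \<kappa> * decay D (real R *\<^sub>R half_vec - floor_vec (real R *\<^sub>R frac_vec z))" for z :: 'a
      unfolding \<kappa>_def
    proof (rule decay_mono)
      let ?a = "real R *\<^sub>R frac_vec z"
      have "norm (frac_vec ?a) \<le> ?d"
        by (rule norm_unit_cube_le) simp
      have "1 + norm (real R *\<^sub>R half_vec - floor_vec ?a)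
          \<le> (1 + norm (?a - real R *\<^sub>R half_vec)) * (1 + norm (frac_vec ?a))"
      proof -
        have "1 + norm (floor_vec ?a - real R *\<^sub>R half_vec)
           \<le> (1 + norm (?a - real R *\<^sub>R half_vec)) * (1 + norm (floor_vec ?a - ?a))"
          using peetre[of "floor_vec ?a - real R *\<^sub>R half_vec" "?a - real R *\<^sub>R half_vec"] by simp
        then show ?thesis
          by (simp add: norm_minus_commute frac_vec_def)
      qed
      also have "\<dots> \<le> (1 + norm (?a - real R *\<^sub>R half_vec)) * (1 + ?d)"
        using \<open>norm (frac_vec ?a) \<le> ?d\<close> by (intro mult_left_mono) auto
      finally show "1 + norm (real R *\<^sub>R half_vec - floor_vec ?a)
          \<le> (1 + ?d) * (1 + norm (real R *\<^sub>R (frac_vec z - half_vec)))"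
        by (simp add: scaleR_diff_right mult.commute)
    qed (use D in auto)
    have vm [measurable]: "(\<lambda>n. ennreal (v n)) \<in> borel_measurable borel"
      unfolding v_def by measurable
    have "(\<integral>\<^sup>+x\<in>unit_cube. ennreal (exp (\<Sum>m<?N.
        decay D (cell_pos R (R ^ m) x))) \<partial>(lborel :: 'a measure))
      \<le> (\<integral>\<^sup>+x\<in>unit_cube. (\<Prod>m<?N. ennreal (v (digit R m x))) \<partial>lborel)"
    proof (intro nn_integral_mono mult_right_mono)
      fix x :: 'a
      have "exp (\<Sum>m<?N. decay D (cell_pos R (R ^ m) x))
          = (\<Prod>m<?N. exp (decay D (cell_pos R (R ^ m) x)))"
        by (rule exp_sum) simp
      also have "\<dots> \<le> (\<Prod>m<?N. v (digit R m x))"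
        unfolding v_def digit_def using pw by (intro prod_mono) auto
      finally have "ennreal (exp (\<Sum>m<?N. decay D (cell_pos R (R ^ m) x)))
          \<le> ennreal (\<Prod>m<?N. v (digit R m x))"
        by (rule ennreal_leI)
      also have "\<dots> = (\<Prod>m<?N. ennreal (v (digit R m x)))"
        by (rule prod_ennreal[symmetric]) (simp add: v_def)
      finally show "ennreal (exp (\<Sum>m<?N. decay D (cell_pos R (R ^ m) x)))
          \<le> (\<Prod>m<?N. ennreal (v (digit R m x)))" .
    qed auto
    also have "\<dots> = (\<Sum>n\<in>grid R. ennreal (1 / real R ^ DIM('a)) * ennreal (v n)) ^ ?N"
      by (rule nn_integral_prod_digits[OF vm]) (use R in simp)
    also have "\<dots> = ennreal ((\<Sum>n\<in>grid R. 1 / real R ^ DIM('a) * v n) ^ ?N)"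
      by (simp add: v_def ennreal_power sum_nonneg flip: ennreal_mult)
    also have "\<dots> \<le> ennreal (exp (\<kappa> * exp \<kappa> * L))"
    proof (rule ennreal_leI)
      \<comment> \<open>The mean over the \<open>N\<close> digits is at most \<open>1 + c/N\<close>
        with \<open>c\<close> independent of \<open>R\<close>, and
        \<open>(1 + c/N)^N \<le> exp c\<close>.\<close>
      define N where "N = real R ^ DIM('a)"
      have N: "0 < N" using R by (simp add: N_def)
      have "(\<Sum>n\<in>grid R. 1 / N * v n)
          \<le> (\<Sum>n\<in>(grid R::'a set). 1 / N * (1 + \<kappa> * exp \<kappa> * decay D (real R *\<^sub>R half_vec - n)))"
        using N by (intro sum_mono mult_left_mono v_le) auto
      also have "\<dots> = 1 / N * (N + \<kappa> * exp \<kappa> * (\<Sum>n\<in>(grid R::'a set). decay D (real R *\<^sub>R half_vec - n)))"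
        unfolding sum_distrib_left[symmetric] sum.distrib by (simp add: card_grid N_def)
      also have "\<dots> \<le> 1 / N * (N + \<kappa> * exp \<kappa> * L)"
        using N \<kappa> by (intro mult_left_mono add_left_mono L) (auto simp: grid_iff)
      also have "\<dots> = 1 + \<kappa> * exp \<kappa> * L / N"
        using N by (simp add: field_simps)
      also have "\<dots> \<le> exp (\<kappa> * exp \<kappa> * L / N)"
        by (rule exp_ge_add_one_self)
      finally have "(\<Sum>n\<in>grid R. 1 / N * v n) ^ ?N \<le> exp (\<kappa> * exp \<kappa> * L / N) ^ ?N"
        using N by (intro power_mono sum_nonneg) (auto simp: v_def)
      also have "\<dots> = exp (\<kappa> * exp \<kappa> * L)"
        using N R by (simp add: exp_of_nat_mult[symmetric] N_def)
      finally show "(\<Sum>n\<in>grid R. 1 / real R ^ DIM('a) * v n) ^ ?N \<le> exp (\<kappa> * exp \<kappa> * L)"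
        by (simp add: N_def)
    qed
    finally show "(\<integral>\<^sup>+x\<in>unit_cube. ennreal (exp (\<Sum>m<?N.
        decay D (cell_pos R (R ^ m) x))) \<partial>(lborel :: 'a measure))
      \<le> ennreal (exp (\<kappa> * exp \<kappa> * L))" .
  qed
qed

text \<open>Since \<open>Q < 1\<close>, the power \<open>Q\<close> is subadditive and separates,
  level by level, the cell of \<open>x\<close> from the tail. The tails of all levels sum to at most
  one fixed decaying function; the cells of \<open>x\<close> are controlled by the exponential
  moment, which dominates the power \<open>P/Q\<close>.\<close>

lemma superposition_moment_bounded:
  assumes Q: "0 < Q" "Q < 1" and P: "Q \<le> P" and A: "2 * real DIM('a::euclidean_space) < A * Q"
  shows "\<exists>E. \<forall>R::nat. 1 \<le> R \<longrightarrow>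
    (\<integral>\<^sup>+x. ennreal ((\<Sum>m<R ^ DIM('a). (\<Sum>n\<in>grid (R ^ m).
        decay A (real R *\<^sub>R (real (R ^ m) *\<^sub>R x - n - half_vec))) powr Q) powr (P / Q)) \<partial>(lborel :: 'a measure))
    \<le> ennreal E"
proof -
  let ?d = "real DIM('a)" and ?T = "P / Q"
  have d: "1 \<le> ?d" using DIM_positive[where 'a='a] by linarith
  have T: "0 < ?T" "1 \<le> ?T" using P Q by auto
  have A0: "0 < A"
    using A Q d by (smt (verit) mult_nonpos_nonneg)
  have AQ: "A * Q < A" using A0 Q by simp
  have A': "2 * ?d < A" using A AQ by linarith
  have AP: "?d < A / 2 * P"
  proof -
    have "A * Q \<le> A * P" using P A0 by (intro mult_left_mono) auto
    then show ?thesis using A by (simp add: field_simps)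
  qed
  obtain C where C: "0 < C" "\<And>(R::nat) (M::nat) x::'a. 1 \<le> R \<Longrightarrow> 1 \<le> M \<Longrightarrow>
    (\<Sum>n\<in>grid M. decay A (real R *\<^sub>R (real M *\<^sub>R x - n - half_vec)))
    \<le> indicator unit_cube x * decay A (cell_pos R M x)
      + C * real R powr (- A) * decay (A / 2) x"
    using cell_sum_le[OF A'] by metis
  have D: "?d < A * Q" using A d by linarith
  obtain E where "\<forall>R::nat. 1 \<le> R \<longrightarrow>
    (\<integral>\<^sup>+x\<in>unit_cube. ennreal (exp (\<Sum>m<R ^ DIM('a).
        decay (A * Q) (cell_pos R (R ^ m) x))) \<partial>(lborel :: 'a measure))
    \<le> ennreal E"
    using exp_moment_bounded[OF D] by (rule exE)
  note E = this[rule_format]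
  define J where "J = (LINT x::'a|lborel. decay (A / 2 * P) x)"
  have Ji: "(\<integral>\<^sup>+x. ennreal (decay (A / 2 * P) x) \<partial>(lborel :: 'a measure)) = ennreal J"
    unfolding J_def by (rule nn_integral_eq_integral[OF integrable_decay[OF AP]]) simp
  have J0: "0 \<le> J" unfolding J_def by (intro integral_nonneg_AE) simp
  define K1 K2 where "K1 = 2 powr ?T * ?T powr ?T" and "K2 = 2 powr ?T * (C powr Q) powr ?T"
  have K: "0 \<le> K1" "0 \<le> K2" by (auto simp: K1_def K2_def)
  show ?thesis
  proof (intro exI[of _ "K1 * max E 0 + K2 * J"] allI impI)
    fix R :: nat assume R: "1 \<le> R"
    let ?N = "R ^ DIM('a)"
    let ?S = "\<lambda>m x::'a. \<Sum>n\<in>grid (R ^ m). decay A (real R *\<^sub>R (real (R ^ m) *\<^sub>R x - n - half_vec))"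
    let ?w = "\<lambda>m x::'a. decay (A * Q) (cell_pos R (R ^ m) x)"
    have S: "?S m x powr Q \<le> indicator unit_cube x * ?w m x + C powr Q * real R powr (- (A * Q)) * decay (A * Q / 2) x" for m x
    proof -
      have M: "1 \<le> R ^ m" using R by simp
      let ?a = "indicator unit_cube x * decay A (cell_pos R (R ^ m) x)"
      let ?b = "C * real R powr (- A) * decay (A / 2) x"
      have "?S m x powr Q \<le> (?a + ?b) powr Q"
        using C(2)[OF R M, of x] Q by (intro powr_mono2 sum_nonneg) auto
      also have "\<dots> \<le> ?a powr Q + ?b powr Q"
        using Q C(1) by (intro powr_add_le) auto
      also have "?a powr Q = indicator unit_cube x * ?w m x"
        by (cases "x \<in> unit_cube") (auto simp: powr_powr)
      also have "?b powr Q = C powr Q * real R powr (- (A * Q)) * decay (A * Q / 2) x"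
        using C(1) by (simp add: powr_mult powr_powr)
      finally show ?thesis .
    qed
    have sumS: "(\<Sum>m<?N. ?S m x powr Q) \<le> indicator unit_cube x * (\<Sum>m<?N. ?w m x) + C powr Q * decay (A * Q / 2) x" for x
    proof -
      have "(\<Sum>m<?N. ?S m x powr Q)
         \<le> (\<Sum>m<?N. indicator unit_cube x * ?w m x + C powr Q * real R powr (- (A * Q)) * decay (A * Q / 2) x)"
        by (intro sum_mono S)
      also have "\<dots> = indicator unit_cube x * (\<Sum>m<?N. ?w m x)
          + (real ?N * real R powr (- (A * Q))) * (C powr Q * decay (A * Q / 2) x)"
        by (simp add: sum.distrib sum_distrib_left mult_ac)
      also have "\<dots> \<le> indicator unit_cube x * (\<Sum>m<?N. ?w m x) + 1 * (C powr Q * decay (A * Q / 2) x)"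
      proof (intro add_left_mono mult_right_mono)
        \<comment> \<open>There are \<open>R^d\<close> levels and each tail carries the factor
          \<open>R powr (- (A * Q))\<close>; by the hypothesis on \<open>A\<close> one has
          \<open>A * Q > d\<close>.\<close>
        have "real ?N * real R powr (- (A * Q)) = real R powr (?d - A * Q)"
          using R by (simp add: powr_realpow[symmetric] powr_add[symmetric])
        also have "\<dots> \<le> real R powr 0"
          using R D by (intro powr_mono) auto
        finally show "real ?N * real R powr (- (A * Q)) \<le> 1"
          using R by simp
      qed auto
      finally show ?thesis by simp
    qed
    have pt: "(\<Sum>m<?N. ?S m x powr Q) powr ?T
       \<le> K1 * (indicator unit_cube x * exp (\<Sum>m<?N. ?w m x)) + K2 * decay (A / 2 * P) x" for x
    proof -
      let ?a = "indicator unit_cube x * (\<Sum>m<?N. ?w m x)" and ?b = "C powr Q * decay (A * Q / 2) x"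
      have w0: "0 \<le> (\<Sum>m<?N. ?w m x)" by (intro sum_nonneg) auto
      have "(\<Sum>m<?N. ?S m x powr Q) powr ?T \<le> (?a + ?b) powr ?T"
        using T by (intro powr_mono2 sumS sum_nonneg) auto
      also have "\<dots> \<le> 2 powr ?T * (?a powr ?T + ?b powr ?T)"
        using T w0 by (intro powr_add_le_2 mult_nonneg_nonneg) auto
      also have "?a powr ?T \<le> ?T powr ?T * (indicator unit_cube x * exp (\<Sum>m<?N. ?w m x))"
        using powr_le_exp[OF w0 T(1)] by (cases "x \<in> unit_cube") auto
      also have "?b powr ?T = (C powr Q) powr ?T * decay (A / 2 * P) x"
        using C(1) Q by (simp add: powr_mult powr_powr)
      finally show ?thesis
        by (simp add: K1_def K2_def algebra_simps)
    qed
    have "(\<integral>\<^sup>+x. ennreal ((\<Sum>m<?N. ?S m x powr Q) powr ?T) \<partial>lborel)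
      \<le> (\<integral>\<^sup>+x. ennreal K1 * (ennreal (exp (\<Sum>m<?N. ?w m x)) * indicator unit_cube x) + ennreal K2 * ennreal (decay (A / 2 * P) x) \<partial>lborel)"
    proof (intro nn_integral_mono)
      fix x :: 'a
      have "ennreal ((\<Sum>m<?N. ?S m x powr Q) powr ?T)
         \<le> ennreal (K1 * (indicator unit_cube x * exp (\<Sum>m<?N. ?w m x)) + K2 * decay (A / 2 * P) x)"
        by (intro ennreal_leI pt)
      also have "\<dots> = ennreal K1 * (ennreal (exp (\<Sum>m<?N. ?w m x)) * indicator unit_cube x) + ennreal K2 * ennreal (decay (A / 2 * P) x)"
        using K by (cases "x \<in> unit_cube") (auto simp: ennreal_mult)
      finally show "ennreal ((\<Sum>m<?N. ?S m x powr Q) powr ?T)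
         \<le> ennreal K1 * (ennreal (exp (\<Sum>m<?N. ?w m x)) * indicator unit_cube x) + ennreal K2 * ennreal (decay (A / 2 * P) x)" .
    qed
    also have "\<dots> = ennreal K1 * (\<integral>\<^sup>+x\<in>unit_cube. ennreal (exp (\<Sum>m<?N. ?w m x)) \<partial>lborel)
        + ennreal K2 * (\<integral>\<^sup>+x. ennreal (decay (A / 2 * P) x) \<partial>(lborel :: 'a measure))"
      by (subst nn_integral_add, measurable, measurable) (simp add: nn_integral_cmult)
    also have "\<dots> \<le> ennreal K1 * ennreal E + ennreal K2 * ennreal J"
      unfolding Ji by (intro add_right_mono mult_left_mono E R) auto
    also have "\<dots> \<le> ennreal K1 * ennreal (max E 0) + ennreal K2 * ennreal J"
      by (intro add_right_mono mult_left_mono ennreal_leI) auto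
    also have "\<dots> = ennreal (K1 * max E 0 + K2 * J)"
      using K J0 by (simp add: ennreal_mult)
    finally show "(\<integral>\<^sup>+x. ennreal ((\<Sum>m<?N. ?S m x powr Q) powr ?T) \<partial>lborel) \<le> ennreal (K1 * max E 0 + K2 * J)" .
  qed
qed

text \<open>At each level the position in the cell is uniformly distributed, and rescaling by
  \<open>R\<close> contributes \<open>R^(-d)\<close>, which the number of levels compensates
  exactly.\<close>

lemma superposition_average:
  fixes g :: "'a::euclidean_space \<Rightarrow> ennreal"
  assumes [measurable]: "g \<in> borel_measurable borel" and R: "1 \<le> R"
  shows "(\<integral>\<^sup>+x\<in>unit_cube. (\<Sum>m<R ^ DIM('a). g (cell_pos R (R ^ m) x)) \<partial>lborel)
    = (\<integral>\<^sup>+y. g y * indicator unit_cube (half_vec + (1 / real R) *\<^sub>R y) \<partial>lborel)"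
proof -
  have "(\<integral>\<^sup>+x\<in>unit_cube. g (cell_pos R (R ^ m) x) \<partial>lborel)
     = ennreal (1 / real R ^ DIM('a)) * (\<integral>\<^sup>+y. g y * indicator unit_cube (half_vec + (1 / real R) *\<^sub>R y) \<partial>lborel)" for m
  proof -
    have "(\<integral>\<^sup>+x\<in>unit_cube. g (cell_pos R (R ^ m) x) \<partial>lborel)
        = (\<integral>\<^sup>+z\<in>unit_cube. g (real R *\<^sub>R (z - half_vec)) \<partial>lborel)"
      using R by (intro nn_integral_unit_cube_frac[where g="\<lambda>z. g (real R *\<^sub>R (z - half_vec))"]) auto
    also have "\<dots> = (\<integral>\<^sup>+z. (\<lambda>y. g y * indicator unit_cube (half_vec + (1 / real R) *\<^sub>R y)) (- real R *\<^sub>R half_vec + real R *\<^sub>R z) \<partial>lborel)"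
      using R by (intro nn_integral_cong) (simp add: algebra_simps)
    also have "\<dots> = ennreal (1 / \<bar>real R\<bar> ^ DIM('a)) * (\<integral>\<^sup>+y. g y * indicator unit_cube (half_vec + (1 / real R) *\<^sub>R y) \<partial>lborel)"
      using R by (intro nn_integral_lborel_affine) auto
    finally show ?thesis by simp
  qed
  note eq = this
  have "(\<integral>\<^sup>+x\<in>unit_cube. (\<Sum>m<R ^ DIM('a). g (cell_pos R (R ^ m) x)) \<partial>lborel)
     = (\<Sum>m<R ^ DIM('a). \<integral>\<^sup>+x\<in>unit_cube. g (cell_pos R (R ^ m) x) \<partial>lborel)"
    unfolding sum_distrib_right by (rule nn_integral_sum) measurable
  also have "\<dots> = (ennreal (real R ^ DIM('a)) * ennreal (1 / real R ^ DIM('a))) * (\<integral>\<^sup>+y. g y * indicator unit_cube (half_vec + (1 / real R) *\<^sub>R y) \<partial>lborel)"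
    unfolding eq by (simp add: mult.assoc ennreal_of_nat_eq_real_of_nat flip: of_nat_power)
  also have "ennreal (real R ^ DIM('a)) * ennreal (1 / real R ^ DIM('a)) = 1"
    using R by (subst ennreal_mult[symmetric]) auto
  finally show ?thesis by simp
qed

text \<open>The truncation regions are the cubes of side \<open>2^(8(l+1))\<close> centred at the
  origin; they increase to the whole space.\<close>

lemma SUP_truncated_integral:
  fixes g :: "'a::euclidean_space \<Rightarrow> ennreal"
  assumes [measurable]: "g \<in> borel_measurable borel"
  shows "(SUP l. \<integral>\<^sup>+y. g y * indicator unit_cube (half_vec + (1 / real (2 ^ (8 * Suc l))) *\<^sub>R y) \<partial>lborel)
    = (\<integral>\<^sup>+y. g y \<partial>lborel)"
proof -
  define S where "S l = {y::'a. half_vec + (1 / real (2 ^ (8 * Suc l))) *\<^sub>R y \<in> unit_cube}" for l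
  have S: "y \<in> S l \<longleftrightarrow> (\<forall>b\<in>Basis. - (2 ^ (8 * Suc l)) \<le> 2 * (y \<bullet> b) \<and> 2 * (y \<bullet> b) < 2 ^ (8 * Suc l))" for y l
    unfolding S_def unit_cube_def by (auto simp: inner_add_left field_simps)
  have "incseq S"
  proof (rule incseq_SucI, rule subsetI)
    fix l and y :: 'a assume y: "y \<in> S l"
    have "(2::real) ^ (8 * Suc l) \<le> 2 ^ (8 * Suc (Suc l))"
      by (rule power_increasing) auto
    note mono = this
    show "y \<in> S (Suc l)"
      unfolding S
    proof
      fix b :: 'a assume "b \<in> Basis"
      then show "- (2 ^ (8 * Suc (Suc l))) \<le> 2 * (y \<bullet> b) \<and> 2 * (y \<bullet> b) < 2 ^ (8 * Suc (Suc l))"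
        using y mono unfolding S by (meson neg_le_iff_le order_trans order_less_le_trans)
    qed
  qed
  have "(\<integral>\<^sup>+y. g y \<partial>lborel) = (\<integral>\<^sup>+y. (SUP l. g y * indicator (S l) y) \<partial>lborel)"
  proof (intro nn_integral_cong)
    fix y :: 'a
    obtain l where l: "2 * norm y < 2 ^ l"
      using real_arch_pow[of 2 "2 * norm y"] by auto
    have "(2::real) ^ l \<le> 2 ^ (8 * Suc l)"
      by (rule power_increasing) auto
    then have "y \<in> S l"
      unfolding S using l Basis_le_norm[of _ y] by (smt (verit, best))
    then have "g y \<le> (SUP l. g y * indicator (S l) y)"
      by (intro SUP_upper2[of l]) auto
    moreover have "(SUP l. g y * indicator (S l) y) \<le> g y"
      by (intro SUP_least) (auto simp: indicator_def)
    ultimately show "g y = (SUP l. g y * indicator (S l) y)" by (rule antisym)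
  qed
  also have "\<dots> = (SUP l. \<integral>\<^sup>+y. g y * indicator (S l) y \<partial>lborel)"
  proof (rule nn_integral_monotone_convergence_SUP)
    show "incseq (\<lambda>l y. g y * indicator (S l) y)"
      using \<open>incseq S\<close> unfolding incseq_def le_fun_def
      by (auto simp: indicator_def)
    show "(\<lambda>y. g y * indicator (S l) y) \<in> borel_measurable lborel" for l
    proof -
      have "S l \<in> sets borel"
        unfolding S_def using measurable_sets[of "\<lambda>y::'a. half_vec + (1 / real (2 ^ (8 * Suc l))) *\<^sub>R y" borel borel unit_cube]
        by (simp add: vimage_def)
      then show ?thesis by measurable
    qed
  qed
  also have "\<dots> = (SUP l. \<integral>\<^sup>+y. g y * indicator unit_cube (half_vec + (1 / real (2 ^ (8 * Suc l))) *\<^sub>R y) \<partial>lborel)"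
    unfolding S_def by (simp add: indicator_def)
  finally show ?thesis by simp
qed

section \<open>Triebel--Lizorkin norms\<close>

lemma epowr_epowr: "0 < a \<Longrightarrow> 0 < b \<Longrightarrow> epowr (epowr x a) b = epowr x (a * b)"
  by (simp add: epowr_def powr_powr)

lemma epowr_one: "epowr x 1 = x"
  by (simp add: epowr_def less_top[symmetric])

lemma sum_le_infsum_ennreal:
  fixes f :: "'i \<Rightarrow> ennreal"
  assumes "finite F"
  shows "(\<Sum>i\<in>F. f i) \<le> (\<Sum>\<^sub>\<infinity>i. f i)"
proof -
  have "infsum f F \<le> infsum f UNIV"
    by (intro infsum_mono_neutral nonneg_summable_on_complete) auto
  then show ?thesis using assms by simp
qed

lemma infsum_finite_support:
  fixes f :: "'i \<Rightarrow> ennreal"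
  assumes "finite F" "\<And>i. i \<notin> F \<Longrightarrow> f i = 0"
  shows "(\<Sum>\<^sub>\<infinity>i. f i) = (\<Sum>i\<in>F. f i)"
proof -
  have "infsum f UNIV = infsum f F"
    by (rule infsum_cong_neutral) (use assms in auto)
  then show ?thesis using assms by simp
qed

lemma lq_norm_ge:
  assumes "0 < q"
  shows "a i \<le> lq_norm q UNIV a"
proof (cases "q = \<infinity>")
  case True
  then show ?thesis by (simp add: lq_norm_def SUP_upper)
next
  case False
  then obtain Q where Q: "q = ennreal Q" "0 < Q"
    using assms by (cases q) auto
  have "epowr (a i) Q \<le> (\<Sum>\<^sub>\<infinity>i. epowr (a i) Q)"
    using sum_le_infsum_ennreal[of "{i}" "\<lambda>i. epowr (a i) Q"] by simp
  then have "epowr (epowr (a i) Q) (1 / Q) \<le> epowr (\<Sum>\<^sub>\<infinity>i. epowr (a i) Q) (1 / Q)"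
    using Q by (intro epowr_mono) auto
  then show ?thesis
    using Q enn2real_one_divide[OF assms] by (simp add: lq_norm_def epowr_epowr epowr_one)
qed

text \<open>The maximum with 1 lets the supremum and the power sum share one constant.\<close>

lemma lq_norm_le:
  assumes q: "0 < q" and F: "finite F" and le: "\<And>i. i \<in> F \<Longrightarrow> a i \<le> ennreal v"
    and zero: "\<And>i. i \<notin> F \<Longrightarrow> a i = 0" and v: "0 \<le> v"
  shows "lq_norm q UNIV a \<le> ennreal (max 1 (real (card F) powr enn2real (1 / q)) * v)"
proof (cases "q = \<infinity>")
  case True
  have "(SUP i. a i) \<le> ennreal v"
    using le zero v by (intro SUP_least) (metis zero_le)
  also have "\<dots> \<le> ennreal (max 1 (real (card F) powr enn2real (1 / q)) * v)"
    using v mult_right_mono[of 1 "max 1 (real (card F) powr enn2real (1 / q))" v] by (intro ennreal_leI) auto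
  finally show ?thesis using True by (simp add: lq_norm_def)
next
  case False
  then obtain Q where Q: "q = ennreal Q" "0 < Q"
    using q by (cases q) auto
  have "(\<Sum>\<^sub>\<infinity>i. epowr (a i) Q) = (\<Sum>i\<in>F. epowr (a i) Q)"
    using zero Q by (intro infsum_finite_support F) (auto simp: epowr_def)
  also have "\<dots> \<le> (\<Sum>i\<in>F. ennreal (v powr Q))"
    using epowr_mono[OF less_imp_le[OF Q(2)] le] v by (intro sum_mono) (simp add: epowr_ennreal)
  also have "\<dots> = ennreal (real (card F) * v powr Q)"
    by (simp add: ennreal_mult ennreal_of_nat_eq_real_of_nat)
  finally have "epowr (\<Sum>\<^sub>\<infinity>i. epowr (a i) Q) (1 / Q) \<le> epowr (ennreal (real (card F) * v powr Q)) (1 / Q)"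
    using Q by (intro epowr_mono) auto
  also have "\<dots> = ennreal (real (card F) powr (1 / Q) * v)"
    using v Q by (simp add: epowr_ennreal powr_mult powr_powr)
  also have "\<dots> \<le> ennreal (max 1 (real (card F) powr (1 / Q)) * v)"
    using v by (intro ennreal_leI mult_right_mono) auto
  finally show ?thesis
    using Q enn2real_one_divide[OF q] by (simp add: lq_norm_def)
qed

text \<open>The quasi-norm without its outer root: lower bounds obtained by integrating over a cube
  apply to it directly.\<close>

definition TL_modular ::
    "('a::euclidean_space \<Rightarrow> complex) \<Rightarrow> real \<Rightarrow> ennreal \<Rightarrow> ('a \<Rightarrow> complex) \<Rightarrow> ennreal" where
  "TL_modular \<phi> P q f = (\<integral>\<^sup>+x. epowr (lq_norm q UNIV
     (\<lambda>k. ennreal (norm (LP_piece \<phi> k (distribution_of f) x)))) P \<partial>lborel)"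

lemma TL_norm_eq: "0 < P \<Longrightarrow> TL_norm \<phi> (ennreal P) q (distribution_of f) = epowr (TL_modular \<phi> P q f) (1 / P)"
  using enn2real_one_divide[of "ennreal P"] by (simp add: TL_norm_def Lp_norm_def TL_modular_def)

text \<open>Raising to the power \<open>P\<close> turns the operator bound into a linear one between
  modulars, with a constant independent of \<open>f\<close>.\<close>

lemma multiplier_bounded_modular:
  assumes "multiplier_bounded \<phi> (ennreal P) q m" and P: "0 < P"
  shows "\<exists>K. \<forall>f\<in>S_infinity. \<forall>E\<ge>0. TL_modular \<phi> P q f \<le> ennreal E \<longrightarrow>
    TL_modular \<phi> P q (multiplier_op m f) \<le> ennreal (K * E)"
proof -
  obtain C where C: "\<And>f. f \<in> S_infinity \<Longrightarrow>
     (if distribution_of (multiplier_op m f) \<in> TL_space \<phi> (ennreal P) q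
      then TL_norm \<phi> (ennreal P) q (distribution_of (multiplier_op m f)) else \<infinity>)
     \<le> ennreal C * TL_norm \<phi> (ennreal P) q (distribution_of f)"
    using assms(1) unfolding multiplier_bounded_def by (elim exE) (rule that, blast)
  have "TL_modular \<phi> P q (multiplier_op m f) \<le> ennreal (max C 0 powr P * E)"
    if f: "f \<in> S_infinity" and E: "0 \<le> E" "TL_modular \<phi> P q f \<le> ennreal E" for f E
  proof -
    let ?X = "TL_modular \<phi> P q (multiplier_op m f)"
    have "TL_norm \<phi> (ennreal P) q (distribution_of f) \<le> ennreal (E powr (1 / P))"
      unfolding TL_norm_eq[OF P] using epowr_mono[OF _ E(2), of "1 / P"] P E(1) by (simp add: epowr_ennreal)
    then have "ennreal C * TL_norm \<phi> (ennreal P) q (distribution_of f) \<le> ennreal (max C 0) * ennreal (E powr (1 / P))"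
      by (intro mult_mono ennreal_leI) auto
    also have "\<dots> = ennreal (max C 0 * E powr (1 / P))"
      by (simp add: ennreal_mult)
    finally have b: "ennreal C * TL_norm \<phi> (ennreal P) q (distribution_of f) \<le> ennreal (max C 0 * E powr (1 / P))" .
    \<comment> \<open>If the image were outside the space, the left side of the bound would be
      infinite, while the right side is finite.\<close>
    have "distribution_of (multiplier_op m f) \<in> TL_space \<phi> (ennreal P) q"
    proof (rule ccontr)
      assume "\<not> ?thesis"
      then have "\<infinity> \<le> ennreal C * TL_norm \<phi> (ennreal P) q (distribution_of f)"
        using C[OF f] by (simp only: if_False)
      with b show False by (simp add: top_unique)
    qed
    then have "epowr ?X (1 / P) \<le> ennreal (max C 0 * E powr (1 / P))"
      using order_trans[OF C[OF f] b] unfolding TL_norm_eq[OF P] by (simp only: if_True)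
    then have "epowr (epowr ?X (1 / P)) P \<le> epowr (ennreal (max C 0 * E powr (1 / P))) P"
      using P by (intro epowr_mono) auto
    then show ?thesis
      using P E(1) by (simp add: epowr_epowr epowr_one epowr_ennreal powr_mult powr_powr)
  qed
  then show ?thesis by blast
qed

lemma character_int_vec:
  assumes "int_vec v" "b \<in> Basis"
  shows "character v b = 1"
proof -
  have "v \<bullet> b \<in> \<int>"
    using assms by (simp add: int_vec_def)
  then show ?thesis
    by (simp add: character_def cis_multiple_2pi)
qed

lemma weight_half_powr:
  assumes "0 < r" "0 \<le> \<delta>"
  shows "(weight r \<delta> x / 2) powr r = (1 / 2) powr r * inverse (logweight \<delta> x)"
proof -
  have "(weight r \<delta> x / 2) powr r = (weight r \<delta> x * (1 / 2)) powr r"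
    by simp
  also have "\<dots> = weight r \<delta> x powr r * (1 / 2) powr r"
    by (rule powr_mult)
  finally show ?thesis
    by (simp add: weight_powr_r[OF assms])
qed

lemma nn_integral_weight_half:
  assumes "0 < r" "0 \<le> \<delta>" "\<delta> \<le> 1"
  shows "(\<integral>\<^sup>+x. ennreal ((weight r \<delta> (x :: 'a::euclidean_space) / 2) powr r) \<partial>lborel) = \<infinity>"
proof -
  have "(\<integral>\<^sup>+x. ennreal ((weight r \<delta> (x :: 'a) / 2) powr r) \<partial>lborel)
      = (\<integral>\<^sup>+x. ennreal ((1 / 2) powr r) * ennreal (inverse (logweight \<delta> (x :: 'a))) \<partial>lborel)"
  proof (intro nn_integral_cong)
    fix x :: 'a
    have "0 \<le> inverse (logweight \<delta> x)"
      using logweight_ge_1[OF assms(2), of x] by simp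
    then show "ennreal ((weight r \<delta> x / 2) powr r) = ennreal ((1 / 2) powr r) * ennreal (inverse (logweight \<delta> x))"
      unfolding weight_half_powr[OF assms(1,2)] by (intro ennreal_mult) auto
  qed
  also have "\<dots> = ennreal ((1 / 2) powr r) * (\<integral>\<^sup>+x. ennreal (inverse (logweight \<delta> (x :: 'a))) \<partial>lborel)"
    by (rule nn_integral_cmult) measurable
  also have "\<dots> = \<infinity>"
    unfolding nn_integral_inverse_logweight[OF assms(2,3)] by (simp add: ennreal_mult_top)
  finally show ?thesis .
qed

context lp_function
begin

section \<open>The single bump, for p \<le> q\<close>

lemma TL_modular_single_bump:
  assumes P: "0 < P" and q: "0 < q"
  shows "\<exists>E\<ge>0. TL_modular \<phi> P q (superpose \<phi> {(0, 0)}) \<le> ennreal E"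
proof -
  let ?d = "real DIM('a)"
  \<comment> \<open>Decay of order \<open>A\<close> with \<open>A * P > d\<close> makes the
    \<open>P\<close>-th power of the pieces integrable.\<close>
  obtain A :: nat where A: "?d / P < real A"
    using reals_Archimedean2 by blast
  obtain C where C: "0 < C" "\<And>I j x. finite I \<Longrightarrow> norm (bump_piece j I x)
    \<le> C * (\<Sum>(e, c)\<in>{i \<in> I. \<bar>j - 8 * fst i\<bar> \<le> 1}. inverse ((1 + norm (octave e *\<^sub>R (x - c))) ^ A))"
    using norm_LP_piece_superpose_le[of A] by (elim exE conjE) (rule that, assumption, simp)
  have fin: "finite {(0::int, 0::'a)}" by simp
  let ?V = "\<lambda>x::'a. inverse ((1 + norm x) ^ A)"
  have V0: "0 \<le> ?V x" for x :: 'a by (auto intro!: zero_le_power)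
  define K where "K = max 1 (real (card {- 1..1::int}) powr enn2real (1 / q)) * C"
  have K: "0 \<le> K" unfolding K_def using C(1) by (intro mult_nonneg_nonneg) auto
  have lq: "lq_norm q UNIV (\<lambda>k. ennreal (norm (bump_piece k {(0, 0)} x))) \<le> ennreal (K * ?V x)" for x
    unfolding K_def mult.assoc
  proof (rule lq_norm_le[OF q])
    fix j :: int
    show "ennreal (norm (bump_piece j {(0, 0)} x)) \<le> ennreal (C * ?V x)" if "j \<in> {- 1..1}"
    proof -
      have e: "{i \<in> {(0, 0 :: 'a)}. \<bar>j - 8 * fst i\<bar> \<le> 1} = {(0, 0)}"
        using that by auto
      show ?thesis
        using C(2)[OF fin, of j x] unfolding e by (intro ennreal_leI) simp
    qed
    show "ennreal (norm (bump_piece j {(0, 0)} x)) = 0" if "j \<notin> {- 1..1}"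
    proof -
      have e: "{i \<in> {(0, 0 :: 'a)}. \<bar>j - 8 * fst i\<bar> \<le> 1} = {}"
        using that by auto
      show ?thesis
        using C(2)[OF fin, of j x] unfolding e by simp
    qed
  qed (use C(1) V0[of x] in auto)
  have D: "?d < real A * P" using A P by (simp add: field_simps)
  define J where "J = (LINT x::'a|lborel. decay (real A * P) x)"
  have Ji: "(\<integral>\<^sup>+x. ennreal (decay (real A * P) x) \<partial>(lborel :: 'a measure)) = ennreal J"
    unfolding J_def by (rule nn_integral_eq_integral[OF integrable_decay[OF D]]) simp
  have J0: "0 \<le> J" unfolding J_def by (intro integral_nonneg_AE) simp
  have "TL_modular \<phi> P q (superpose \<phi> {(0, 0)}) \<le> (\<integral>\<^sup>+x. ennreal (K powr P) * ennreal (decay (real A * P) x) \<partial>(lborel :: 'a measure))"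
    unfolding TL_modular_def
  proof (intro nn_integral_mono)
    fix x :: 'a
    have "epowr (lq_norm q UNIV (\<lambda>k. ennreal (norm (bump_piece k {(0, 0)} x)))) P
       \<le> epowr (ennreal (K * ?V x)) P"
      using P by (intro epowr_mono lq) auto
    also have "\<dots> = ennreal ((K * ?V x) powr P)"
      using K V0[of x] by (intro epowr_ennreal mult_nonneg_nonneg)
    also have "(K * ?V x) powr P = K powr P * decay (real A * P) x"
    proof -
      have "?V x = decay (real A) x"
        by (simp add: powr_minus powr_realpow add_pos_nonneg)
      then show ?thesis
        using K by (simp add: powr_mult powr_powr)
    qed
    finally show "epowr (lq_norm q UNIV (\<lambda>k. ennreal (norm (bump_piece k {(0, 0)} x)))) P
       \<le> ennreal (K powr P) * ennreal (decay (real A * P) x)"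
      by (simp add: ennreal_mult)
  qed
  also have "\<dots> = ennreal (K powr P) * ennreal J"
    by (subst nn_integral_cmult) (auto simp: Ji)
  also have "\<dots> = ennreal (K powr P * J)"
    using J0 by (simp add: ennreal_mult)
  finally show ?thesis
    using J0 by (intro exI[of _ "K powr P * J"]) simp
qed

text \<open>The piece of index 0 alone has modulus at least half the weight, whose
  \<open>r\<close>-th power has infinite integral.\<close>

lemma TL_modular_single_bump_image:
  assumes r: "0 < r" "r < 1" and \<delta>: "0 < \<delta>" "\<delta> \<le> 1" and q: "0 < q"
    and lower: "\<And>x. weight r \<delta> x / 2 \<le>
      Re (character (- x) b * (LINT y|lborel. (complex_of_real (weight r \<delta> y) * character y b) * triple (x - y)))"
  shows "TL_modular \<phi> r q (multiplier_op (lacunary (modulated_weight r \<delta> b)) (superpose \<phi> {(0, 0)})) = \<infinity>"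
proof -
  let ?T = "multiplier_op (lacunary (modulated_weight r \<delta> b)) (superpose \<phi> {(0, 0)})"
  have "(\<integral>\<^sup>+x. ennreal ((weight r \<delta> (x :: 'a) / 2) powr r) \<partial>lborel) \<le> TL_modular \<phi> r q ?T"
    unfolding TL_modular_def
  proof (intro nn_integral_mono)
    fix x :: 'a
    have "weight r \<delta> (octave 0 *\<^sub>R (x - 0)) / 2 \<le> norm (LP_piece \<phi> (8 * 0) (distribution_of ?T) x)"
      by (rule norm_LP_piece_multiplier_op_ge[OF r \<delta>(1) lower]) auto
    then have "ennreal (weight r \<delta> x / 2) \<le> ennreal (norm (LP_piece \<phi> 0 (distribution_of ?T) x))"
      by (intro ennreal_leI) simp
    also have "\<dots> \<le> lq_norm q UNIV (\<lambda>k. ennreal (norm (LP_piece \<phi> k (distribution_of ?T) x)))"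
      by (rule lq_norm_ge[OF q])
    finally have "epowr (ennreal (weight r \<delta> x / 2)) r \<le> epowr (lq_norm q UNIV (\<lambda>k. ennreal (norm (LP_piece \<phi> k (distribution_of ?T) x)))) r"
      using r by (intro epowr_mono) auto
    then show "ennreal ((weight r \<delta> x / 2) powr r) \<le> epowr (lq_norm q UNIV (\<lambda>k. ennreal (norm (LP_piece \<phi> k (distribution_of ?T) x)))) r"
      using weight_pos[of \<delta> r x] \<delta> by (simp add: epowr_ennreal)
  qed
  then show ?thesis
    using nn_integral_weight_half[OF r(1) less_imp_le[OF \<delta>(1)] \<delta>(2), where 'a='a] by (simp add: top_unique)
qed

section \<open>The superposed bumps, for q < p\<close>

definition radix :: "nat \<Rightarrow> nat" where
  "radix l = 2 ^ (8 * Suc l)"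

text \<open>\<open>R = 2^(8(l+1))\<close> amounts to \<open>l + 1\<close> octaves, so the dilation
  by \<open>R^(m+1)\<close> at level \<open>m\<close> is that of octave
  \<open>(l+1)(m+1)\<close>.\<close>

definition bumps :: "nat \<Rightarrow> (int \<times> 'a) set" where
  "bumps l = (\<lambda>(m, n). (int (Suc l * Suc m), (1 / real (radix l ^ m)) *\<^sub>R (n + half_vec)))
     ` (SIGMA m:{..<radix l ^ DIM('a)}. grid (radix l ^ m))"

lemma radix_ge_1: "1 \<le> radix l"
  by (simp add: radix_def)

lemma radix_powr: "octave (int (Suc l * Suc m)) = real (radix l) * real (radix l ^ m)"
proof -
  have "octave (int (Suc l * Suc m)) = 2 powr real (8 * Suc l * Suc m)"
    by (simp only: of_int_of_nat_eq mult.assoc of_nat_mult of_int_mult of_nat_numeral)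
  also have "\<dots> = 2 ^ (8 * Suc l * Suc m)"
    by (rule powr_realpow) simp
  also have "\<dots> = real (radix l ^ Suc m)"
    unfolding radix_def by (simp only: power_mult of_nat_power of_nat_numeral)
  finally show ?thesis by simp
qed

lemma finite_bumps: "finite (bumps l)"
  unfolding bumps_def by (intro finite_imageI finite_SigmaI) auto

lemma bumps_level: "{i \<in> bumps l. \<bar>j - 8 * fst i\<bar> \<le> 1}
  = (\<Union>m\<in>{m. m < radix l ^ DIM('a) \<and> \<bar>j - 8 * int (Suc l * Suc m)\<bar> \<le> 1}.
      (\<lambda>n. (int (Suc l * Suc m), (1 / real (radix l ^ m)) *\<^sub>R (n + half_vec))) ` grid (radix l ^ m))"
  unfolding bumps_def by (auto simp del: mult_Suc mult_Suc_right)

text \<open>Octaves of different levels differ by at least \<open>l + 1\<close>, hence the indices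
  by at least 8, and windows of radius 1 around them are disjoint.\<close>

lemma levels_separated:
  assumes "\<bar>j - 8 * int (Suc l * Suc m)\<bar> \<le> 1" "\<bar>j - 8 * int (Suc l * Suc m')\<bar> \<le> 1"
  shows "m = m'"
proof (rule ccontr)
  have *: False if "m < m'" "\<bar>j - 8 * int (Suc l * Suc m)\<bar> \<le> 1" "\<bar>j - 8 * int (Suc l * Suc m')\<bar> \<le> 1" for m m'
  proof -
    have "Suc l * Suc m + 1 \<le> Suc l * Suc m'"
    proof -
      have "Suc l * Suc m + 1 \<le> Suc l * Suc m + Suc l" by simp
      also have "\<dots> = Suc l * Suc (Suc m)" by simp
      also have "\<dots> \<le> Suc l * Suc m'"
        using that(1) by (intro mult_le_mono2) simp
      finally show ?thesis .
    qed
    then have "int (Suc l * Suc m) + 1 \<le> int (Suc l * Suc m')"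
      by linarith
    then show False using that(2,3) by linarith
  qed
  assume "m \<noteq> m'"
  then show False
    using *[of m m'] *[of m' m] assms by (meson linorder_neqE_nat)
qed

text \<open>Rescaled to the cells of level \<open>m\<close>, the bounds for the bumps take the form
  of the sums in the moment estimate.\<close>

lemma norm_LP_piece_bumps_le:
  "\<exists>C>0. \<forall>l x. (\<forall>j m. m < radix l ^ DIM('a) \<longrightarrow> \<bar>j - 8 * int (Suc l * Suc m)\<bar> \<le> 1 \<longrightarrow>
      norm (bump_piece j (bumps l) x) \<le> C *
        (\<Sum>n\<in>grid (radix l ^ m). decay (real A) (real (radix l) *\<^sub>R (real (radix l ^ m) *\<^sub>R x - n - half_vec)))) \<and>
    (\<forall>j. (\<forall>m < radix l ^ DIM('a). \<not> \<bar>j - 8 * int (Suc l * Suc m)\<bar> \<le> 1) \<longrightarrow>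
      bump_piece j (bumps l) x = 0)"
proof -
  obtain C where C: "0 < C" "\<And>I j x. finite I \<Longrightarrow> norm (bump_piece j I x)
    \<le> C * (\<Sum>(e, c)\<in>{i \<in> I. \<bar>j - 8 * fst i\<bar> \<le> 1}. inverse ((1 + norm (octave e *\<^sub>R (x - c))) ^ A))"
    using norm_LP_piece_superpose_le[of A] by (elim exE conjE) (rule that, assumption, simp)
  note b = C(2)[OF finite_bumps]
  have 1: "norm (bump_piece j (bumps l) x) \<le> C *
        (\<Sum>n\<in>grid (radix l ^ m). decay (real A) (real (radix l) *\<^sub>R (real (radix l ^ m) *\<^sub>R x - n - half_vec)))"
    if m: "m < radix l ^ DIM('a)" "\<bar>j - 8 * int (Suc l * Suc m)\<bar> \<le> 1" for l x j m
  proof -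
    let ?R = "radix l"
    let ?M = "real (?R ^ m)"
    have M: "?M \<noteq> 0" using radix_ge_1[of l] by simp
    have "{m. m < ?R ^ DIM('a) \<and> \<bar>j - 8 * int (Suc l * Suc m)\<bar> \<le> 1} = {m}"
      using m levels_separated by blast
    then have lev: "{i \<in> bumps l. \<bar>j - 8 * fst i\<bar> \<le> 1}
        = (\<lambda>n. (int (Suc l * Suc m), (1 / ?M) *\<^sub>R (n + half_vec))) ` grid (?R ^ m)"
      unfolding bumps_level by simp
    have inj: "inj_on (\<lambda>n. (int (Suc l * Suc m), (1 / ?M) *\<^sub>R (n + half_vec))) (grid (?R ^ m))"
      using M by (auto intro!: inj_onI)
    have "(\<Sum>(e, c)\<in>{i \<in> bumps l. \<bar>j - 8 * fst i\<bar> \<le> 1}. inverse ((1 + norm (octave e *\<^sub>R (x - c))) ^ A))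
      = (\<Sum>n\<in>grid (?R ^ m). decay (real A) (real ?R *\<^sub>R (?M *\<^sub>R x - n - half_vec)))"
      unfolding lev sum.reindex[OF inj] comp_def prod.case
    proof (rule sum.cong[OF refl])
      fix n :: 'a
      have "octave (int (Suc l * Suc m)) *\<^sub>R (x - (1 / ?M) *\<^sub>R (n + half_vec))
          = real ?R *\<^sub>R (?M *\<^sub>R x - n - half_vec)"
        unfolding radix_powr scaleR_scaleR[symmetric] using M by (simp add: scaleR_diff_right scaleR_add_right)
      then show "inverse ((1 + norm (octave (int (Suc l * Suc m)) *\<^sub>R (x - (1 / ?M) *\<^sub>R (n + half_vec)))) ^ A)
          = decay (real A) (real ?R *\<^sub>R (?M *\<^sub>R x - n - half_vec))"
        by (simp only: powr_minus) (simp add: powr_realpow add_pos_nonneg)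
    qed
    then show ?thesis using b[of j l x] by simp
  qed
  have 2: "bump_piece j (bumps l) x = 0"
    if "\<forall>m < radix l ^ DIM('a). \<not> \<bar>j - 8 * int (Suc l * Suc m)\<bar> \<le> 1" for l x j
  proof -
    have e: "{i \<in> bumps l. \<bar>j - 8 * fst i\<bar> \<le> 1} = {}"
      unfolding bumps_level using that by blast
    show ?thesis using b[of j l x] unfolding e by simp
  qed
  show ?thesis
    using C(1) 1 2 by (intro exI[of _ C]) blast
qed

text \<open>Each index belongs to at most one level and each level has three indices, so the inner
  sum is at most \<open>3 * C powr Q\<close> times the sum over levels in the moment
  estimate.\<close>

lemma TL_modular_bumps:
  assumes Q: "0 < Q" "Q < 1" and P: "Q \<le> P"
  shows "\<exists>E\<ge>0. \<forall>l. TL_modular \<phi> P (ennreal Q) (superpose \<phi> (bumps l)) \<le> ennreal E"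
proof -
  obtain A :: nat where "2 * real DIM('a) / Q < real A"
    using reals_Archimedean2 by blast
  then have A: "2 * real DIM('a) < real A * Q"
    using Q by (simp add: field_simps)
  obtain C where C: "0 < C"
    "\<And>l x j m. m < radix l ^ DIM('a) \<Longrightarrow> \<bar>j - 8 * int (Suc l * Suc m)\<bar> \<le> 1 \<Longrightarrow>
      norm (bump_piece j (bumps l) x) \<le> C *
        (\<Sum>n\<in>grid (radix l ^ m). decay (real A) (real (radix l) *\<^sub>R (real (radix l ^ m) *\<^sub>R x - n - half_vec)))"
    "\<And>l x j. (\<forall>m < radix l ^ DIM('a). \<not> \<bar>j - 8 * int (Suc l * Suc m)\<bar> \<le> 1) \<Longrightarrow>
      bump_piece j (bumps l) x = 0"
    using norm_LP_piece_bumps_le[of A] by (elim exE conjE) (rule that, assumption, blast, blast)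
  obtain E where "\<forall>R::nat. 1 \<le> R \<longrightarrow>
    (\<integral>\<^sup>+x. ennreal ((\<Sum>m<R ^ DIM('a). (\<Sum>n\<in>grid (R ^ m).
        decay (real A) (real R *\<^sub>R (real (R ^ m) *\<^sub>R x - n - half_vec))) powr Q) powr (P / Q)) \<partial>(lborel :: 'a measure))
    \<le> ennreal E"
    using superposition_moment_bounded[OF Q P A] by (rule exE)
  note E = this[rule_format]
  define K where "K = (3 * C powr Q) powr (P / Q)"
  have "TL_modular \<phi> P (ennreal Q) (superpose \<phi> (bumps l)) \<le> ennreal (K * max E 0)" for l
  proof -
    let ?R = "radix l"
    let ?N = "?R ^ DIM('a)"
    let ?S = "\<lambda>m x::'a. \<Sum>n\<in>grid (?R ^ m). decay (real A) (real ?R *\<^sub>R (real (?R ^ m) *\<^sub>R x - n - half_vec))"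
    let ?a = "\<lambda>x j. ennreal (norm (bump_piece j (bumps l) x))"
    let ?J = "\<lambda>m. {j. \<bar>j - 8 * int (Suc l * Suc m)\<bar> \<le> 1}"
    have J: "?J m = {8 * int (Suc l * Suc m) - 1..8 * int (Suc l * Suc m) + 1}" for m
      by (auto simp del: mult_Suc mult_Suc_right)
    have finJ: "finite (?J m)" for m
      unfolding J by simp
    have S0: "0 \<le> ?S m x" for m x by (intro sum_nonneg) auto
    have pt: "epowr (lq_norm (ennreal Q) UNIV (?a x)) P \<le> ennreal K * ennreal ((\<Sum>m<?N. ?S m x powr Q) powr (P / Q))" for x
    proof -
      have "(\<Sum>\<^sub>\<infinity>j. epowr (?a x j) Q) = (\<Sum>j\<in>(\<Union>m<?N. ?J m). epowr (?a x j) Q)"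
      proof (rule infsum_finite_support)
        show "finite (\<Union>m<?N. ?J m)"
          by (intro finite_UN_I finite_lessThan finJ)
        fix j assume "j \<notin> (\<Union>m<?N. ?J m)"
        then have "bump_piece j (bumps l) x = 0"
          by (intro C(3)) blast
        then show "epowr (?a x j) Q = 0"
          using Q by (simp add: epowr_def)
      qed
      also have "\<dots> = (\<Sum>m<?N. \<Sum>j\<in>?J m. epowr (?a x j) Q)"
        using levels_separated by (intro sum.UNION_disjoint finite_lessThan ballI impI finJ) blast
      also have "\<dots> \<le> (\<Sum>m<?N. ennreal (3 * C powr Q * ?S m x powr Q))"
      proof (intro sum_mono)
        fix m assume m: "m \<in> {..<?N}"
        have "(\<Sum>j\<in>?J m. epowr (?a x j) Q) \<le> (\<Sum>j\<in>?J m. ennreal ((C * ?S m x) powr Q))"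
        proof (intro sum_mono)
          fix j assume "j \<in> ?J m"
          then have "?a x j \<le> ennreal (C * ?S m x)"
            using m by (intro ennreal_leI C(2)) auto
          then have "epowr (?a x j) Q \<le> epowr (ennreal (C * ?S m x)) Q"
            using Q by (intro epowr_mono) auto
          then show "epowr (?a x j) Q \<le> ennreal ((C * ?S m x) powr Q)"
            using C(1) S0[of m x] by (simp add: epowr_ennreal)
        qed
        also have "\<dots> = of_nat (card (?J m)) * ennreal (C powr Q * ?S m x powr Q)"
          using C(1) S0[of m x] by (simp add: powr_mult)
        also have "card (?J m) = 3"
          unfolding J by simp
        finally show "(\<Sum>j\<in>?J m. epowr (?a x j) Q) \<le> ennreal (3 * C powr Q * ?S m x powr Q)"
          by (simp add: ennreal_mult mult.assoc)
      qed
      also have "\<dots> = ennreal (3 * C powr Q * (\<Sum>m<?N. ?S m x powr Q))"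
        by (simp add: sum_distrib_left)
      finally have "epowr (\<Sum>\<^sub>\<infinity>j. epowr (?a x j) Q) (P / Q) \<le> epowr (ennreal (3 * C powr Q * (\<Sum>m<?N. ?S m x powr Q))) (P / Q)"
        using P Q by (intro epowr_mono) auto
      also have "\<dots> = ennreal ((3 * C powr Q * (\<Sum>m<?N. ?S m x powr Q)) powr (P / Q))"
        by (intro epowr_ennreal mult_nonneg_nonneg sum_nonneg) auto
      also have "(3 * C powr Q * (\<Sum>m<?N. ?S m x powr Q)) powr (P / Q) = K * (\<Sum>m<?N. ?S m x powr Q) powr (P / Q)"
        unfolding K_def by (rule powr_mult)
      also have "ennreal \<dots> = ennreal K * ennreal ((\<Sum>m<?N. ?S m x powr Q) powr (P / Q))"
        by (rule ennreal_mult) (auto simp: K_def)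
      finally have "epowr (\<Sum>\<^sub>\<infinity>j. epowr (?a x j) Q) (P / Q) \<le> ennreal K * ennreal ((\<Sum>m<?N. ?S m x powr Q) powr (P / Q))" .
      moreover have "epowr (lq_norm (ennreal Q) UNIV (?a x)) P = epowr (\<Sum>\<^sub>\<infinity>j. epowr (?a x j) Q) (P / Q)"
        using Q P enn2real_one_divide[of "ennreal Q"] by (simp add: lq_norm_def epowr_epowr)
      ultimately show ?thesis by simp
    qed
    have "TL_modular \<phi> P (ennreal Q) (superpose \<phi> (bumps l))
        \<le> (\<integral>\<^sup>+x. ennreal K * ennreal ((\<Sum>m<?N. ?S m x powr Q) powr (P / Q)) \<partial>lborel)"
      unfolding TL_modular_def by (intro nn_integral_mono pt)
    also have "\<dots> = ennreal K * (\<integral>\<^sup>+x. ennreal ((\<Sum>m<?N. ?S m x powr Q) powr (P / Q)) \<partial>lborel)"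
      by (rule nn_integral_cmult) measurable
    also have "\<dots> \<le> ennreal K * ennreal (max E 0)"
      by (intro mult_left_mono order_trans[OF E[OF radix_ge_1]] ennreal_leI) auto
    also have "\<dots> = ennreal (K * max E 0)"
      by (simp add: ennreal_mult K_def)
    finally show ?thesis .
  qed
  then show ?thesis
    by (intro exI[of _ "K * max E 0"]) (auto simp: K_def)
qed

text \<open>The inner sum dominates \<open>H\<close>, a sum of powers of halved weights at the cell
  positions, whose average is the truncated integral. The \<open>+ 1\<close> pays for replacing
  \<open>H\<close> by \<open>H powr (P / r)\<close> on a cube of measure 1.\<close>

lemma TL_modular_bumps_image_ge:
  assumes r: "0 < r" "r < 1" and \<delta>: "0 < \<delta>" and P: "r \<le> P" and b: "b \<in> Basis"
    and lower: "\<And>x. weight r \<delta> x / 2 \<le>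
      Re (character (- x) b * (LINT y|lborel. (complex_of_real (weight r \<delta> y) * character y b) * triple (x - y)))"
  shows "(\<integral>\<^sup>+y. ennreal ((weight r \<delta> (y::'a) / 2) powr r) * indicator unit_cube (half_vec + (1 / real (radix l)) *\<^sub>R y) \<partial>lborel)
    \<le> TL_modular \<phi> P (ennreal r) (multiplier_op (lacunary (modulated_weight r \<delta> b)) (superpose \<phi> (bumps l))) + 1"
proof -
  let ?R = "radix l"
  let ?N = "?R ^ DIM('a)"
  let ?T = "multiplier_op (lacunary (modulated_weight r \<delta> b)) (superpose \<phi> (bumps l))"
  let ?a = "\<lambda>x j. ennreal (norm (LP_piece \<phi> j (distribution_of ?T) x))"
  let ?y = "\<lambda>m x. real ?R *\<^sub>R (frac_vec (real (?R ^ m) *\<^sub>R x) - half_vec)"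
  let ?g = "\<lambda>y::'a. (weight r \<delta> y / 2) powr r"
  have w0: "0 < weight r \<delta> y" for y :: 'a
    using weight_pos[of \<delta> r y] \<delta> by simp
  have piece: "weight r \<delta> (?y m x) / 2 \<le> norm (LP_piece \<phi> (8 * int (Suc l * Suc m)) (distribution_of ?T) x)"
    if m: "m < ?N" and x: "x \<in> unit_cube" for m x
  proof -
    let ?M = "real (?R ^ m)"
    have M: "?M \<noteq> 0" "0 < ?R ^ m" using radix_ge_1[of l] by auto
    define n where "n = floor_vec (?M *\<^sub>R x)"
    obtain n' where n': "n' \<in> grid (?R ^ m)" "?M *\<^sub>R x - n' \<in> unit_cube"
      using scaled_unit_cube_iff[OF M(2), of x] x by blast
    have "n' = n"
      unfolding n_def using n' grid_iff[of n' "?R ^ m"] by (intro int_vec_unit_cube_unique) blast+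
    then have n: "n \<in> grid (?R ^ m)" using n'(1) by simp
    let ?c = "\<lambda>n. (1 / ?M) *\<^sub>R (n + half_vec) :: 'a"
    let ?e = "int (Suc l * Suc m)"
    have scaled: "octave ?e *\<^sub>R ?c k = real ?R *\<^sub>R (k + half_vec)" for k
      unfolding radix_powr scaleR_scaleR[symmetric] using M by simp
    have "weight r \<delta> (octave ?e *\<^sub>R (x - ?c n)) / 2
        \<le> norm (LP_piece \<phi> (8 * ?e) (distribution_of ?T) x)"
    proof (rule norm_LP_piece_multiplier_op_ge[OF r \<delta> lower finite_bumps])
      show "(?e, ?c n) \<in> bumps l"
        unfolding bumps_def using m n by force
      \<comment> \<open>Two centres of one level differ, after dilation by their common frequency,
        by \<open>R\<close> times an integer vector; as \<open>b\<close> is a basis vector, the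
        character is 1.\<close>
      fix c assume "(?e, c) \<in> bumps l"
      then obtain m' k where k: "k \<in> grid (?R ^ m')" "?e = int (Suc l * Suc m')" "c = (1 / real (?R ^ m')) *\<^sub>R (k + half_vec)"
        unfolding bumps_def by (auto simp del: mult_Suc mult_Suc_right)
      have "Suc l * Suc m = Suc l * Suc m'"
        using k(2) by (simp only: of_nat_eq_iff)
      then have "m' = m"
        by (simp only: nat_mult_eq_cancel1[OF zero_less_Suc] nat.inject)
      then have "octave ?e *\<^sub>R (?c n - c) = real ?R *\<^sub>R (n - k)"
        using k(3) by (simp only: scaleR_diff_right[of "2 powr _"] scaled) (simp add: scaleR_diff_right scaleR_add_right)
      moreover have "int_vec (real ?R *\<^sub>R (n - k))"
        using n k(1) by (intro int_vec_scaleR_nat int_vec_diff) (auto simp: grid_iff)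
      ultimately show "character (octave ?e *\<^sub>R (?c n - c)) b = 1"
        by (simp only: character_int_vec[OF _ b])
    qed
    also have "octave ?e *\<^sub>R (x - ?c n) = ?y m x"
    proof -
      have sx: "octave ?e *\<^sub>R x = real ?R *\<^sub>R (?M *\<^sub>R x)"
        unfolding radix_powr by simp
      show ?thesis
        by (simp only: scaleR_diff_right[of "2 powr _"] scaled sx)
          (simp add: n_def frac_vec_def scaleR_diff_right scaleR_add_right)
    qed
    finally show ?thesis .
  qed
  have inj: "inj_on (\<lambda>m. 8 * int (Suc l * Suc m)) {..<?N}"
    by (intro inj_onI) (simp del: mult_Suc)
  define H where "H x = (\<Sum>m<?N. ?g (?y m x))" for x
  have H0: "0 \<le> H x" for x
    unfolding H_def by (intro sum_nonneg) auto
  have [measurable]: "H \<in> borel_measurable borel"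
    unfolding H_def[abs_def] by measurable
  have pt: "ennreal (H x powr (P / r)) \<le> epowr (lq_norm (ennreal r) UNIV (?a x)) P" if x: "x \<in> unit_cube" for x
  proof -
    have "ennreal (H x) = (\<Sum>m<?N. ennreal (?g (?y m x)))"
      unfolding H_def by simp
    also have "\<dots> \<le> (\<Sum>m<?N. epowr (?a x (8 * int (Suc l * Suc m))) r)"
    proof (intro sum_mono)
      fix m assume "m \<in> {..<?N}"
      then have "ennreal (weight r \<delta> (?y m x) / 2) \<le> ?a x (8 * int (Suc l * Suc m))"
        by (intro ennreal_leI piece x) simp
      then have "epowr (ennreal (weight r \<delta> (?y m x) / 2)) r \<le> epowr (?a x (8 * int (Suc l * Suc m))) r"
        using r by (intro epowr_mono) auto
      then show "ennreal (?g (?y m x)) \<le> epowr (?a x (8 * int (Suc l * Suc m))) r"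
        using less_imp_le[OF w0[of "?y m x"]] by (simp add: epowr_ennreal)
    qed
    also have "\<dots> = (\<Sum>j\<in>(\<lambda>m. 8 * int (Suc l * Suc m)) ` {..<?N}. epowr (?a x j) r)"
      by (simp only: sum.reindex[OF inj] comp_def)
    also have "\<dots> \<le> (\<Sum>\<^sub>\<infinity>j. epowr (?a x j) r)"
      by (rule sum_le_infsum_ennreal) simp
    finally have "epowr (ennreal (H x)) (P / r) \<le> epowr (\<Sum>\<^sub>\<infinity>j. epowr (?a x j) r) (P / r)"
      using P r by (intro epowr_mono) auto
    also have "\<dots> = epowr (lq_norm (ennreal r) UNIV (?a x)) P"
      using r P enn2real_one_divide[of "ennreal r"] by (simp add: lq_norm_def epowr_epowr)
    finally show ?thesis
      using H0[of x] by (simp add: epowr_ennreal)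
  qed
  have H_le: "H x \<le> H x powr (P / r) + 1" for x
  proof (cases "H x \<le> 1")
    case False
    then show ?thesis
      using powr_mono[of 1 "P / r" "H x"] P r by simp
  qed (use powr_ge_zero[of "H x" "P / r"] in linarith)
  have "(\<integral>\<^sup>+y. ennreal (?g y) * indicator unit_cube (half_vec + (1 / real ?R) *\<^sub>R y) \<partial>lborel)
      = (\<integral>\<^sup>+x\<in>unit_cube. (\<Sum>m<?N. ennreal (?g (?y m x))) \<partial>lborel)"
    by (rule superposition_average[symmetric, OF _ radix_ge_1]) measurable
  also have "\<dots> = (\<integral>\<^sup>+x\<in>unit_cube. ennreal (H x) \<partial>lborel)"
    unfolding H_def by simp
  also have "\<dots> \<le> (\<integral>\<^sup>+x. ennreal (H x powr (P / r)) * indicator unit_cube x + indicator unit_cube x \<partial>lborel)"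
  proof (intro nn_integral_mono)
    fix x :: 'a
    have "ennreal (H x) \<le> ennreal (H x powr (P / r)) + 1"
      using ennreal_leI[OF H_le[of x]] by (simp add: ennreal_plus)
    then show "ennreal (H x) * indicator unit_cube x \<le> ennreal (H x powr (P / r)) * indicator unit_cube x + indicator unit_cube x"
      by (auto simp: indicator_def)
  qed
  also have "\<dots> = (\<integral>\<^sup>+x. ennreal (H x powr (P / r)) * indicator unit_cube x \<partial>lborel) + 1"
    by (subst nn_integral_add) (auto simp: emeasure_unit_cube)
  also have "\<dots> \<le> TL_modular \<phi> P (ennreal r) ?T + 1"
    unfolding TL_modular_def using pt
    by (intro add_right_mono nn_integral_mono) (auto simp: indicator_def)
  finally show ?thesis .
qed

end

theorem theorem3p3:
  fixes \<eta> :: "'a::euclidean_space \<Rightarrow> real" and \<phi> :: "'a \<Rightarrow> complex"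
    and p q r u t :: ennreal and s :: real
  assumes "cutoff \<eta>" and "littlewood_paley \<phi>"
    and "0 < p" and "0 < q" and "p < \<infinity> \<or> 1 \<le> q"
    and "r = min p q" and "r < 1" and "r < u" and "0 < t"
    and "s < real DIM('a) * enn2real (1 / r) - real DIM('a) * enn2real (1 / u) \<or>
         (s = real DIM('a) * enn2real (1 / r) - real DIM('a) * enn2real (1 / u) \<and> r < t)"
  shows "\<exists>m\<in>L_infinity. herz_multiplier_norm \<eta> u s t m < \<infinity> \<and> \<not> multiplier_bounded \<phi> p q m"
proof -
  interpret lp_function \<phi>
    by unfold_locales (rule assms(2))
  \<comment> \<open>Infinite \<open>p\<close> would force \<open>1 \<le> q\<close>, hence
    \<open>1 \<le> r\<close>.\<close>
  have "p < \<infinity>"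
  proof (rule ccontr)
    assume "\<not> p < \<infinity>"
    then have "p = \<infinity>" and "1 \<le> q"
      using assms(5) by (auto simp: not_less top_unique)
    then have "1 \<le> r"
      using assms(6) by simp
    then show False
      using assms(7) by simp
  qed
  then obtain P where P: "p = ennreal P" "0 < P"
    using assms(3) by (cases p) auto
  have "0 < r"
    using assms(3,4,6) by (simp add: min_def)
  then obtain \<rho> where \<rho>: "r = ennreal \<rho>" "0 < \<rho>" "\<rho> < 1"
    using assms(7) by (cases r) auto
  have "\<rho> \<le> P"
    using assms(6) P \<rho> by (metis ennreal_le_iff less_imp_le min.cobounded1)
  have "0 < u" using assms(8) by (rule le_less_trans[rotated]) simp
  obtain b :: 'a where b: "b \<in> Basis"
    using nonempty_Basis by blast
  \<comment> \<open>The kernel oscillates at the frequency \<open>b\<close>, where the transform of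
    \<open>triple\<close> equals 1.\<close>
  obtain \<delta> where \<delta>: "0 < \<delta>" "\<delta> \<le> 1" and lower: "\<And>x. weight \<rho> \<delta> x / 2 \<le>
    Re (character (- x) b * (LINT y|lborel. (complex_of_real (weight \<rho> \<delta> y) * character y b) * triple (x - y)))"
    using weight_modulated_convolution_ge[OF \<rho>(2,3) rapid_triple borel_measurable_triple fourier_triple[of b]] b
    by auto
  define m where "m = lacunary (modulated_weight \<rho> \<delta> b)"
  have "m \<in> L_infinity"
    unfolding m_def by (intro lacunary_L_infinity integrable_modulated_weight \<rho> \<delta>)
  moreover have "herz_multiplier_norm \<eta> u s t m < \<infinity>"
    unfolding m_def
    using assms(10) \<rho> enn2real_one_divide[OF \<open>0 < r\<close>]
    by (intro herz_multiplier_norm_lacunary assms \<rho> \<delta> \<open>0 < u\<close>) auto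
  moreover have "\<not> multiplier_bounded \<phi> p q m"
  proof
    assume "multiplier_bounded \<phi> p q m"
    then obtain K where K: "\<And>f E. f \<in> S_infinity \<Longrightarrow> 0 \<le> E \<Longrightarrow> TL_modular \<phi> P q f \<le> ennreal E \<Longrightarrow>
        TL_modular \<phi> P q (multiplier_op m f) \<le> ennreal (K * E)"
      unfolding P(1) using multiplier_bounded_modular[OF _ P(2)] by blast
    show False
    proof (cases "p \<le> q")
      case True
      then have "P = \<rho>"
        using assms(6) P \<rho> by (simp add: min_def)
      obtain E where "0 \<le> E" "TL_modular \<phi> P q (superpose \<phi> {(0, 0)}) \<le> ennreal E"
        using TL_modular_single_bump[OF P(2) assms(4)] by blast
      from K[OF superpose_S_infinity this] have "TL_modular \<phi> P q (multiplier_op m (superpose \<phi> {(0, 0)})) \<le> ennreal (K * E)"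
        by simp
      moreover have "TL_modular \<phi> P q (multiplier_op m (superpose \<phi> {(0, 0)})) = \<infinity>"
        unfolding \<open>P = \<rho>\<close> m_def by (rule TL_modular_single_bump_image[OF \<rho>(2,3) \<delta> assms(4) lower])
      ultimately show False by (simp add: top_unique)
    next
      case False
      then have q: "q = ennreal \<rho>"
        using assms(6) \<rho> by (simp add: min_def)
      obtain E where E: "0 \<le> E" "\<And>l. TL_modular \<phi> P q (superpose \<phi> (bumps l)) \<le> ennreal E"
        unfolding q using TL_modular_bumps[OF \<rho>(2,3) \<open>\<rho> \<le> P\<close>] by blast
      let ?g = "\<lambda>y::'a. ennreal ((weight \<rho> \<delta> y / 2) powr \<rho>)"
      have "(\<integral>\<^sup>+y. ?g y * indicator unit_cube (half_vec + (1 / real (2 ^ (8 * Suc l))) *\<^sub>R y) \<partial>lborel)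
          \<le> ennreal (K * E) + 1" for l
        using order_trans[OF TL_modular_bumps_image_ge[OF \<rho>(2,3) \<delta>(1) \<open>\<rho> \<le> P\<close> b lower, of l]
            add_right_mono[OF K[OF superpose_S_infinity[OF finite_bumps] E, of l, unfolded q m_def], of 1]]
        unfolding radix_def .
      \<comment> \<open>The bound does not depend on \<open>l\<close>, while the truncated integrals
        increase to an infinite one.\<close>
      then have "(SUP l. \<integral>\<^sup>+y. ?g y * indicator unit_cube (half_vec + (1 / real (2 ^ (8 * Suc l))) *\<^sub>R y) \<partial>lborel)
          \<le> ennreal (K * E) + 1"
        by (rule SUP_least)
      also have "(SUP l. \<integral>\<^sup>+y. ?g y * indicator unit_cube (half_vec + (1 / real (2 ^ (8 * Suc l))) *\<^sub>R y) \<partial>lborel)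
          = (\<integral>\<^sup>+y. ?g y \<partial>lborel)"
        by (rule SUP_truncated_integral) measurable
      also have "\<dots> = \<infinity>"
        by (rule nn_integral_weight_half[OF \<rho>(2) less_imp_le[OF \<delta>(1)] \<delta>(2)])
      finally show False by (simp add: top_unique)
    qed
  qed
  ultimately show ?thesis by blast
qed

end
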